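(* The following decision problem is NP-hard: given a (not necessarily bipartite) graph $G=(V,E)$ in which every node has a strict preference order over its neighbours, decide whether $G$ admits a popular matching.
   Context: A matching is a set of pairwise disjoint edges; $M(u)$ denotes the partner of $u$ in $M$. An unmatched node is considered to prefer any neighbour to being unmatched. A node $u$ prefers matching $M$ to matching $N$ if either $u$ is matched in $M$ and unmatched in $N$, or $u$ is matched in both and prefers $M(u)$ to $N(u)$. Let $\phi(M,N)$ be the number of nodes preferring $M$ to $N$ and $\Delta(M,N)=\phi(M,N)-\phi(N,M)$. A matching $M$ is popular if $\Delta(M,N)\ge 0$ for every matching $N$ of $G$. *)

theory Defs
  imports Main "HOL-Computational_Algebra.Polynomial"
begin

section \<open>Popular matchings\<close>

definition neighbours :: "'a set set \<Rightarrow> 'a \<Rightarrow> 'a set" where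
  "neighbours E u = {v. {u, v} \<in> E}"

text \<open>\<open>P u v w\<close> means that node \<open>u\<close> strictly prefers its neighbour \<open>v\<close> to its neighbour \<open>w\<close>.
  Values of \<open>P\<close> outside the neighbourhoods carry no meaning.\<close>

definition preference_graph :: "'a set \<Rightarrow> 'a set set \<Rightarrow> ('a \<Rightarrow> 'a \<Rightarrow> 'a \<Rightarrow> bool) \<Rightarrow> bool" where
  "preference_graph V E P \<longleftrightarrow>
     finite V \<and> (\<forall>e\<in>E. e \<subseteq> V \<and> card e = 2) \<and>
     (\<forall>u\<in>V. irreflp_on (neighbours E u) (P u) \<and> transp_on (neighbours E u) (P u) \<and>
            totalp_on (neighbours E u) (P u))"

definition matching :: "'a set set \<Rightarrow> 'a set set \<Rightarrow> bool" where
  "matching E M \<longleftrightarrow> M \<subseteq> E \<and> pairwise disjnt M"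

definition matched :: "'a set set \<Rightarrow> 'a \<Rightarrow> bool" where
  "matched M u \<longleftrightarrow> (\<exists>v. {u, v} \<in> M)"

definition partner :: "'a set set \<Rightarrow> 'a \<Rightarrow> 'a" where
  "partner M u = (THE v. {u, v} \<in> M)"

definition prefers_matching ::
    "('a \<Rightarrow> 'a \<Rightarrow> 'a \<Rightarrow> bool) \<Rightarrow> 'a \<Rightarrow> 'a set set \<Rightarrow> 'a set set \<Rightarrow> bool" where
  "prefers_matching P u M N \<longleftrightarrow>
     (matched M u \<and> \<not> matched N u) \<or>
     (matched M u \<and> matched N u \<and> P u (partner M u) (partner N u))"

definition votes ::
    "'a set \<Rightarrow> ('a \<Rightarrow> 'a \<Rightarrow> 'a \<Rightarrow> bool) \<Rightarrow> 'a set set \<Rightarrow> 'a set set \<Rightarrow> nat" where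
  "votes V P M N = card {u \<in> V. prefers_matching P u M N}"

definition vote_margin ::
    "'a set \<Rightarrow> ('a \<Rightarrow> 'a \<Rightarrow> 'a \<Rightarrow> bool) \<Rightarrow> 'a set set \<Rightarrow> 'a set set \<Rightarrow> int" where
  "vote_margin V P M N = int (votes V P M N) - int (votes V P N M)"

definition popular ::
    "'a set \<Rightarrow> 'a set set \<Rightarrow> ('a \<Rightarrow> 'a \<Rightarrow> 'a \<Rightarrow> bool) \<Rightarrow> 'a set set \<Rightarrow> bool" where
  "popular V E P M \<longleftrightarrow>
     matching E M \<and> (\<forall>N. matching E N \<longrightarrow> vote_margin V P M N \<ge> 0)"


section \<open>Nondeterministic multi-tape Turing machines\<close>

text \<open>Tapes are two-way infinite; a tape consists of its contents and the position of its head.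
  States and tape symbols are natural numbers. A machine is given by its finite set of transitions
  (state, symbols read, new state, symbol written and head move for each tape), so only finitely
  many states and symbols matter. The blank symbol is 0.\<close>

type_synonym tape = "(int \<Rightarrow> nat) \<times> int"

type_synonym config = "nat \<times> tape list"

datatype head_move = Move_Left | Stay | Move_Right

record turing_machine =
  tapes :: nat
  start :: nat
  accept :: nat
  transitions :: "(nat \<times> nat list \<times> nat \<times> (nat \<times> head_move) list) set"

definition wf_tm :: "turing_machine \<Rightarrow> bool" where
  "wf_tm M \<longleftrightarrow> tapes M \<ge> 1 \<and> finite (transitions M) \<and>
     (\<forall>(q, r, q', a) \<in> transitions M. length r = tapes M \<and> length a = tapes M)"

definition deterministic :: "turing_machine \<Rightarrow> bool" where
  "deterministic M \<longleftrightarrow>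
     (\<forall>q r q1 a1 q2 a2. (q, r, q1, a1) \<in> transitions M \<longrightarrow> (q, r, q2, a2) \<in> transitions M \<longrightarrow>
        q1 = q2 \<and> a1 = a2)"

fun read_tape :: "tape \<Rightarrow> nat" where
  "read_tape (f, i) = f i"

fun offset :: "head_move \<Rightarrow> int" where
  "offset Move_Left = -1"
| "offset Stay = 0"
| "offset Move_Right = 1"

fun write_move :: "nat \<times> head_move \<Rightarrow> tape \<Rightarrow> tape" where
  "write_move (s, d) (f, i) = (f(i := s), i + offset d)"

definition step :: "turing_machine \<Rightarrow> config \<Rightarrow> config \<Rightarrow> bool" where
  "step M c c' \<longleftrightarrow>
     (\<exists>a. (fst c, map read_tape (snd c), fst c', a) \<in> transitions M \<and>
          snd c' = map2 write_move a (snd c))"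

definition halted :: "turing_machine \<Rightarrow> config \<Rightarrow> bool" where
  "halted M c \<longleftrightarrow> \<not> (\<exists>c'. step M c c')"

definition word_contents :: "bool list \<Rightarrow> int \<Rightarrow> nat" where
  "word_contents w i =
     (if 0 \<le> i \<and> i < int (length w) then (if w ! nat i then 2 else 1) else 0)"

definition init_config :: "turing_machine \<Rightarrow> bool list \<Rightarrow> config" where
  "init_config M w =
     (start M, (word_contents w, 0) # replicate (tapes M - 1) (word_contents [], 0))"


section \<open>NP-hardness\<close>

definition accepts :: "turing_machine \<Rightarrow> bool list \<Rightarrow> bool" where
  "accepts M w \<longleftrightarrow>
     (\<exists>c. (step M)\<^sup>*\<^sup>* (init_config M w) c \<and> halted M c \<and> fst c = accept M)"

text \<open>Every computation path, accepting or not, has at most \<open>t\<close> steps.\<close>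

definition runs_within :: "turing_machine \<Rightarrow> bool list \<Rightarrow> nat \<Rightarrow> bool" where
  "runs_within M w t \<longleftrightarrow> (\<forall>n c. (step M ^^ n) (init_config M w) c \<longrightarrow> n \<le> t)"

definition NP :: "bool list set set" where
  "NP = {A. \<exists>M (p :: nat poly). wf_tm M \<and> (\<forall>w. runs_within M w (poly p (length w))) \<and>
              A = {w. accepts M w}}"

text \<open>Input is on the first tape; output is left on the second tape.\<close>

definition poly_time_computable :: "(bool list \<Rightarrow> bool list) \<Rightarrow> bool" where
  "poly_time_computable f \<longleftrightarrow>
     (\<exists>M (p :: nat poly). wf_tm M \<and> deterministic M \<and> tapes M \<ge> 2 \<and>
        (\<forall>w. \<exists>n c. n \<le> poly p (length w) \<and> (step M ^^ n) (init_config M w) c \<and> halted M c \<and>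
               fst (snd c ! 1) = word_contents (f w)))"

definition poly_time_reducible :: "bool list set \<Rightarrow> bool list set \<Rightarrow> bool" where
  "poly_time_reducible A B \<longleftrightarrow>
     (\<exists>f. poly_time_computable f \<and> (\<forall>w. w \<in> A \<longleftrightarrow> f w \<in> B))"

definition NP_hard :: "bool list set \<Rightarrow> bool" where
  "NP_hard B \<longleftrightarrow> (\<forall>A\<in>NP. poly_time_reducible A B)"


section \<open>The decision problem\<close>

text \<open>An instance on the nodes \<open>0, \<dots>, n - 1\<close> is presented as a list of \<open>n\<close> preference lists,
  the one at index \<open>u\<close> enumerating the neighbours of \<open>u\<close> from most to least preferred.\<close>

definition presents ::
    "nat list list \<Rightarrow> nat set \<Rightarrow> nat set set \<Rightarrow> (nat \<Rightarrow> nat \<Rightarrow> nat \<Rightarrow> bool) \<Rightarrow> bool" where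
  "presents pl V E P \<longleftrightarrow> V = {..<length pl} \<and>
     (\<forall>u\<in>V. distinct (pl ! u) \<and> set (pl ! u) = neighbours E u \<and> sorted_wrt (P u) (pl ! u))"

text \<open>Numbers are written in unary. Every number occurring in an instance is smaller than
  its number of nodes, so this is only polynomially longer than binary notation.\<close>

definition encode_nat :: "nat \<Rightarrow> bool list" where
  "encode_nat n = replicate n True @ [False]"

definition encode_list :: "('a \<Rightarrow> bool list) \<Rightarrow> 'a list \<Rightarrow> bool list" where
  "encode_list enc xs = concat (map (\<lambda>x. True # enc x) xs) @ [False]"

definition encode_instance :: "nat list list \<Rightarrow> bool list" where
  "encode_instance = encode_list (encode_list encode_nat)"

definition popular_matching_problem :: "bool list set" where
  "popular_matching_problem =
     {encode_instance pl | pl V E P.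
        preference_graph V E P \<and> presents pl V E P \<and> (\<exists>M. popular V E P M)}"

lemma encode_nat_prefix_free:
  "encode_nat m @ r = encode_nat n @ s \<Longrightarrow> m = n \<and> r = s"
proof (induction m arbitrary: n)
  case 0
  then show ?case by (cases n) (auto simp: encode_nat_def)
next
  case (Suc m)
  then show ?case by (cases n) (auto simp: encode_nat_def)
qed

lemma encode_list_prefix_free:
  assumes "\<And>x y r s. enc x @ r = enc y @ s \<Longrightarrow> x = y \<and> r = s"
  shows "encode_list enc xs @ r = encode_list enc ys @ s \<Longrightarrow> xs = ys \<and> r = s"
proof (induction xs arbitrary: ys)
  case Nil
  then show ?case by (cases ys) (auto simp: encode_list_def)
next
  case (Cons x xs)
  show ?case
  proof (cases ys)
    case Nil
    with Cons.prems show ?thesis by (simp add: encode_list_def)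
  next
    case (Cons y ys')
    with Cons.prems have "enc x @ (encode_list enc xs @ r) = enc y @ (encode_list enc ys' @ s)"
      by (simp add: encode_list_def)
    then have "x = y" "encode_list enc xs @ r = encode_list enc ys' @ s"
      using assms by blast+
    with Cons.IH Cons show ?thesis by blast
  qed
qed

lemma inj_encode_instance: "inj encode_instance"
proof (rule injI)
  fix x y assume "encode_instance x = encode_instance y"
  then have "encode_list (encode_list encode_nat) x @ [] = encode_list (encode_list encode_nat) y @ []"
    by (simp add: encode_instance_def)
  then show "x = y"
    using encode_list_prefix_free[of "encode_list encode_nat"]
      encode_list_prefix_free[of encode_nat] encode_nat_prefix_free by (smt (verit, best))
qed

text \<open>A list of preference lists presents at most one instance: the edges are determined, and
  so are the preferences between neighbours.\<close>

lemma presents_unique: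
  assumes "preference_graph V E P" "presents pl V E P"
    and "preference_graph V' E' P'" "presents pl V' E' P'"
  shows "V = V' \<and> E = E' \<and>
    (\<forall>u\<in>V. \<forall>v\<in>neighbours E u. \<forall>w\<in>neighbours E u. P u v w \<longleftrightarrow> P' u v w)"
proof -
  have V: "V = V'" and N: "\<And>u. u \<in> V \<Longrightarrow> neighbours E u = neighbours E' u"
    using assms(2,4) by (auto simp: presents_def)
  have sub: "F \<subseteq> F'" if F: "preference_graph V F Q"
    and eq: "\<And>u. u \<in> V \<Longrightarrow> neighbours F u = neighbours F' u" for F F' Q
  proof
    fix e assume e: "e \<in> F"
    then have "card e = 2" "e \<subseteq> V" using F by (auto simp: preference_graph_def)
    then obtain u v where uv: "e = {u, v}" "u \<in> V" by (auto simp: card_2_iff)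
    then have "v \<in> neighbours F u" using e by (simp add: neighbours_def)
    with eq[OF uv(2)] uv(1) show "e \<in> F'" by (simp add: neighbours_def)
  qed
  have E: "E = E'" using sub[of E P E'] sub[of E' P' E] assms(1,3) V N by auto
  have "P u v w \<longleftrightarrow> P' u v w"
    if u: "u \<in> V" and v: "v \<in> neighbours E u" and w: "w \<in> neighbours E u" for u v w
  proof -
    have iff: "Q u v w \<longleftrightarrow> (\<exists>i j. i < j \<and> j < length (pl ! u) \<and> pl ! u ! i = v \<and> pl ! u ! j = w)"
      if Q: "preference_graph V E Q" "presents pl V E Q" for Q
    proof -
      let ?A = "neighbours E u"
      have ir: "irreflp_on ?A (Q u)" and tr: "transp_on ?A (Q u)"
        and so: "sorted_wrt (Q u) (pl ! u)" and st: "set (pl ! u) = ?A"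
        using Q u by (auto simp: preference_graph_def presents_def)
      obtain i where i: "i < length (pl ! u)" "pl ! u ! i = v"
        using v st by (metis in_set_conv_nth)
      obtain j where j: "j < length (pl ! u)" "pl ! u ! j = w"
        using w st by (metis in_set_conv_nth)
      show ?thesis
      proof
        assume q: "Q u v w"
        have "\<not> j < i"
        proof
          assume "j < i"
          then have "Q u w v" using so i j by (metis sorted_wrt_nth_less)
          with q tr ir v w show False by (meson irreflp_onD transp_onD)
        qed
        moreover have "i \<noteq> j" using q ir v i j by (metis irreflp_onD)
        ultimately show "\<exists>i j. i < j \<and> j < length (pl ! u) \<and> pl ! u ! i = v \<and> pl ! u ! j = w"
          using i j by (metis linorder_neqE_nat)
      next
        assume "\<exists>i j. i < j \<and> j < length (pl ! u) \<and> pl ! u ! i = v \<and> pl ! u ! j = w"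
        then show "Q u v w" using so by (metis sorted_wrt_nth_less)
      qed
    qed
    show ?thesis using iff[of P] iff[of P'] assms V E by simp
  qed
  with V E show ?thesis by blast
qed

lemma finite_strict_order_sorted:
  assumes "finite A" "irreflp_on A R" "transp_on A R" "totalp_on A R"
  shows "\<exists>xs. distinct xs \<and> set xs = A \<and> sorted_wrt R xs"
  using assms
proof (induction A rule: finite_induct)
  case empty
  then show ?case by simp
next
  case (insert x A)
  have "irreflp_on A R" "transp_on A R" "totalp_on A R"
    using insert.prems by (meson irreflp_on_subset transp_on_subset totalp_on_subset subset_insertI)+
  then obtain xs where xs: "distinct xs" "set xs = A" "sorted_wrt R xs"
    using insert.IH by blast
  let ?ys = "filter (\<lambda>y. R y x) xs @ x # filter (\<lambda>y. \<not> R y x) xs"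
  have tot: "R x y" if "y \<in> A" "\<not> R y x" for y
    using insert.prems(3) insert.hyps(2) that by (auto simp: totalp_on_def)
  have tr: "R y z" if "y \<in> A" "z \<in> A" "R y x" "R x z" for y z
    using insert.prems(2) that by (meson insertCI transp_onD)
  have "sorted_wrt R ?ys"
    using xs tot tr by (auto simp: sorted_wrt_append sorted_wrt_filter)
  moreover have "distinct ?ys" using xs insert.hyps(2) by auto
  moreover have "set ?ys = insert x A" using xs by auto
  ultimately show ?case by blast
qed

lemma presents_exists:
  assumes "preference_graph {..<n} E P"
  shows "\<exists>pl. presents pl {..<n} E P"
proof -
  have "\<exists>xs. distinct xs \<and> set xs = neighbours E u \<and> sorted_wrt (P u) xs" if "u < n" for u
  proof (rule finite_strict_order_sorted)
    have "neighbours E u \<subseteq> {..<n}"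
      using assms by (auto simp: preference_graph_def neighbours_def)
    then show "finite (neighbours E u)" by (rule finite_subset) simp
  qed (use assms that in \<open>auto simp: preference_graph_def\<close>)
  then obtain h where "\<And>u. u < n \<Longrightarrow>
      distinct (h u) \<and> set (h u) = neighbours E u \<and> sorted_wrt (P u) (h u)"
    by metis
  then have "presents (map h [0..<n]) {..<n} E P" by (auto simp: presents_def)
  then show ?thesis by blast
qed

end

theory Submission
  imports Defs
begin

text \<open>An accepting computation is a consistent labelling of a space-time diagram: every cell
  (tape, time, position relative to the head) carries the transition fired at that time together
  with a symbol. Each cell gets two labels \<open>f c\<close> and \<open>g c\<close>, and all constraints are expressed as
  forbidden pairs \<open>conf q (g q) c (f c)\<close>: \<open>f\<close> and \<open>g\<close> agree at equal times, and the labels \<open>f\<close> at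
  time \<open>t + 1\<close> follow from the labels \<open>g\<close> at time \<open>t\<close>.

  In the graph, each pair of a cell and a label gives two 4-cycles, one for \<open>f\<close> and one for \<open>g\<close>, each of
  which has two stable matchings; one of them says that the label is chosen. A forbidden pair is an edge
  that blocks the matching if both labels are chosen. The 4-cycles of a cell lie on a path from a
  node that stays unmatched to the node \<open>D0\<close>, and the path is interrupted exactly by the chosen labels.
  The nodes \<open>D0, D1, D2, D3\<close> are the known gadget without a stable matching: because \<open>D1, D2, D3\<close> have cyclic
  preferences, \<open>D0\<close> is matched to one of them, and any alternating path that frees \<open>D0\<close> wins
  two extra votes. Hence a popular matching is stable outside this gadget and admits no uninterrupted
  path, so every cell has a chosen label.

  The adjacency of two nodes depends only on comparisons of their coordinates with each other and with the
  ends of their range, so that a machine looping over all nodes can write the preference lists.\<close>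


section \<open>Structured programs for Turing machines\<close>

text \<open>The X and Y 4-cycles are mirror images: being chosen is the bad outcome for
  \<open>XA\<close> in the first family and for \<open>YB\<close> in the second. A forbidden pair
  can therefore be one edge between an A node and a B node that blocks exactly if both have their
  worse mate. Such an edge within a single family would not do, since there the A and B nodes never
  fare badly together; hence the two labels per cell, and hence even a constraint on one cell is a
  pair of an \<open>f\<close> and a \<open>g\<close>. The converse direction needs a certificate of
  popularity, but the graph is not bipartite and no node potential covers all edges at once. A rival
  matching uses at most one edge at \<open>D0\<close>, so it is enough that each rival is covered by
  one of two potentials. Adjacency is given by ranks with ties, and strict preferences arise from
  breaking ties by node number. Everything about the gadget is therefore derived from votes that the
  ranks determine; a vote between equal ranks is only known to be at least -1. For a fixed machine
  the numbers of roles, tapes and labels are constant. Only time and distance from the head grow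
  with the input, and both stay below a number of the form
  \<open>(length w + c) ^ d\<close>.\<close>

type_synonym action = "nat \<times> head_move"
type_synonym store = "nat \<Rightarrow> tape"

datatype com =
    Skip
  | Act "(nat \<Rightarrow> nat) \<Rightarrow> nat \<Rightarrow> action"
  | Seq com com  (infixr ";;" 60)
  | Cond "(nat \<Rightarrow> nat) \<Rightarrow> bool" com com
  | While "(nat \<Rightarrow> nat) \<Rightarrow> bool" com

definition reads :: "store \<Rightarrow> nat \<Rightarrow> nat" where
  "reads s i = read_tape (s i)"

text \<open>Programs write only symbols up to 3, so that finitely many transitions suffice.\<close>

definition clip :: "nat \<Rightarrow> action \<Rightarrow> action" where
  "clip old a = (if fst a = old then old else min 3 (fst a), snd a)"

definition perform :: "nat \<Rightarrow> (nat \<Rightarrow> action) \<Rightarrow> store \<Rightarrow> store" where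
  "perform K a s = (\<lambda>i. if i < K then write_move (a i) (s i) else s i)"

abbreviation stay :: "(nat \<Rightarrow> nat) \<Rightarrow> nat \<Rightarrow> action" where
  "stay r \<equiv> \<lambda>i. (r i, Stay)"

text \<open>The symbols under the heads determine the whole step. A test, or the removal of a
  finished left part, is a step of its own in which all tapes stay, so every step is exactly one
  transition.\<close>

fun nxt :: "com \<Rightarrow> (nat \<Rightarrow> nat) \<Rightarrow> com \<times> (nat \<Rightarrow> action)" where
  "nxt Skip r = (Skip, stay r)"
| "nxt (Act f) r = (Skip, \<lambda>i. clip (r i) (f r i))"
| "nxt (c ;; d) r = (if c = Skip then (d, stay r) else (fst (nxt c r) ;; d, snd (nxt c r)))"
| "nxt (Cond P c d) r = (if P r then c else d, stay r)"
| "nxt (While P c) r = (if P r then c ;; While P c else Skip, stay r)"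

text \<open>The control states of the compiled machine: a finite set of programs that contains the
  initial one and is closed under \<open>nxt\<close>.\<close>

fun residuals :: "com \<Rightarrow> com set" where
  "residuals Skip = {Skip}"
| "residuals (Act f) = {Act f, Skip}"
| "residuals (c ;; d) = (\<lambda>c'. c' ;; d) ` residuals c \<union> residuals d"
| "residuals (Cond P c d) = insert (Cond P c d) (residuals c \<union> residuals d)"
| "residuals (While P c) = {While P c, Skip} \<union> (\<lambda>c'. c' ;; While P c) ` residuals c"

lemma finite_residuals: "finite (residuals c)"
  by (induction c) auto

lemma self_in_residuals: "c \<in> residuals c"
  by (induction c) auto

lemma Skip_in_residuals: "Skip \<in> residuals c"
  by (induction c) auto

lemma Seq_neq_right [simp]: "c ;; d \<noteq> d"
  by (induction d arbitrary: c) auto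

lemma right_neq_Seq [simp]: "d \<noteq> c ;; d"
  using Seq_neq_right by metis

lemma nxt_in_residuals: "c' \<in> residuals c \<Longrightarrow> fst (nxt c' r) \<in> residuals c"
proof (induction c arbitrary: c')
  case (Seq c d)
  then show ?case by (auto simp: self_in_residuals)
next
  case (Cond P c d)
  then show ?case by (auto simp: self_in_residuals)
next
  case (While P c)
  then show ?case by (auto simp: self_in_residuals split: if_splits)
qed auto

definition small_step :: "nat \<Rightarrow> com \<times> store \<Rightarrow> com \<times> store \<Rightarrow> bool" where
  "small_step K x y \<longleftrightarrow> fst x \<noteq> Skip \<and>
     y = (fst (nxt (fst x) (reads (snd x))), perform K (snd (nxt (fst x) (reads (snd x)))) (snd x))"

lemma perform_stay [simp]: "perform K (stay (reads s)) s = s"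
  by (rule ext) (auto simp: perform_def reads_def split: prod.splits, metis fun_upd_triv add.right_neutral offset.simps(2) read_tape.simps surj_pair write_move.simps)

text \<open>The unvisited tapes are required blank so that \<open>reads\<close> is determined by the first \<open>K\<close> tapes.\<close>

definition wf_store :: "nat \<Rightarrow> store \<Rightarrow> bool" where
  "wf_store K s \<longleftrightarrow> (\<forall>i\<ge>K. s i = (\<lambda>_. 0, 0)) \<and> (\<forall>i j. fst (s i) j \<le> 3)"

lemma wf_store_reads: "wf_store K s \<Longrightarrow> reads s i \<le> 3"
  by (cases "s i") (auto simp: wf_store_def reads_def, metis fst_conv)

lemma nxt_symbols: "(\<And>i. r i \<le> 3) \<Longrightarrow> fst (snd (nxt c r) i) \<le> 3"
  by (induction c) (auto simp: clip_def)

lemma wf_store_perform: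
  assumes "wf_store K s" "\<And>i. fst (a i) \<le> 3"
  shows "wf_store K (perform K a s)"
proof -
  have "fst (write_move (a i) (s i)) j \<le> 3" for i j
    using assms by (cases "a i"; cases "s i") (auto simp: wf_store_def, metis fst_conv, metis fst_conv)
  then show ?thesis using assms(1) by (auto simp: wf_store_def perform_def)
qed

lemma wf_store_small_step: "small_step K x y \<Longrightarrow> wf_store K (snd x) \<Longrightarrow> wf_store K (snd y)"
  unfolding small_step_def
  by (auto intro!: wf_store_perform nxt_symbols wf_store_reads)

text \<open>\<open>N\<close> bounds the number of iterations of every loop, so that the running time is bounded by a
  polynomial in \<open>N\<close> which depends on the program only.\<close>

inductive big_step :: "nat \<Rightarrow> nat \<Rightarrow> com \<Rightarrow> store \<Rightarrow> store \<Rightarrow> bool" for K N where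
  Skip: "big_step K N Skip s s"
| Act: "big_step K N (Act f) s (perform K (\<lambda>i. clip (reads s i) (f (reads s) i)) s)"
| Seq: "big_step K N c s s' \<Longrightarrow> big_step K N d s' s'' \<Longrightarrow> big_step K N (c ;; d) s s''"
| Cond_True: "P (reads s) \<Longrightarrow> big_step K N c s s' \<Longrightarrow> big_step K N (Cond P c d) s s'"
| Cond_False: "\<not> P (reads s) \<Longrightarrow> big_step K N d s s' \<Longrightarrow> big_step K N (Cond P c d) s s'"
| While: "m \<le> N \<Longrightarrow> \<forall>k<m. P (reads (\<sigma> k)) \<and> big_step K N c (\<sigma> k) (\<sigma> (Suc k)) \<Longrightarrow>
    \<not> P (reads (\<sigma> m)) \<Longrightarrow> big_step K N (While P c) (\<sigma> 0) (\<sigma> m)"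

text \<open>The extra steps are one per test and one to drop a finished left part. A round of a loop
  thus spends at most two steps more than its body, and the factor N + 1 in place of N pays for the
  final test.\<close>

fun cost :: "com \<Rightarrow> nat poly" where
  "cost Skip = 0"
| "cost (Act f) = 1"
| "cost (c ;; d) = cost c + cost d + 1"
| "cost (Cond P c d) = cost c + cost d + 1"
| "cost (While P c) = [:1, 1:] * (cost c + 2)"

lemma small_steps_Seq:
  "(small_step K ^^ k) (c, s) (c', s') \<Longrightarrow> (small_step K ^^ k) (c ;; d, s) (c' ;; d, s')"
proof (induction k arbitrary: c' s')
  case (Suc k)
  then obtain c1 s1 where 1: "(small_step K ^^ k) (c, s) (c1, s1)" and 2: "small_step K (c1, s1) (c', s')"
    by auto
  from 2 have "small_step K (c1 ;; d, s1) (c' ;; d, s')"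
    by (auto simp: small_step_def)
  with Suc.IH[OF 1] show ?case by auto
qed simp

lemma small_steps_trans:
  "(small_step K ^^ k) x y \<Longrightarrow> (small_step K ^^ l) y z \<Longrightarrow> (small_step K ^^ (k + l)) x z"
  by (auto simp: relpowp_add)

lemma small_step_1: "small_step K x y \<Longrightarrow> (small_step K ^^ 1) x y"
  by (metis relpowp_1)

lemma poly_cost_numeral: "poly (2 :: nat poly) n = 2"
  by (metis of_nat_numeral poly_of_nat of_nat_id)

lemma big_step_small_steps:
  "big_step K N c s s' \<Longrightarrow> \<exists>k\<le>poly (cost c) N. (small_step K ^^ k) (c, s) (Skip, s')"
proof (induction rule: big_step.induct)
  case (Skip s)
  then show ?case by (intro exI[of _ 0]) auto
next
  case (Act f s)
  then show ?case by (intro exI[of _ 1]) (auto simp: small_step_def)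
next
  case (Seq c s s' d s'')
  then obtain k l where k: "k \<le> poly (cost c) N" "(small_step K ^^ k) (c, s) (Skip, s')"
    and l: "l \<le> poly (cost d) N" "(small_step K ^^ l) (d, s') (Skip, s'')" by blast
  have "small_step K (Skip ;; d, s') (d, s')" by (simp add: small_step_def)
  with small_steps_Seq[OF k(2)] have "(small_step K ^^ (k + 1)) (c ;; d, s) (d, s')"
    using small_steps_trans small_step_1 by metis
  with l(2) have "(small_step K ^^ (k + 1 + l)) (c ;; d, s) (Skip, s'')"
    by (rule small_steps_trans[rotated])
  then show ?case using k(1) l(1) by (intro exI[of _ "k + 1 + l"]) auto
next
  case (Cond_True P s c s' d)
  then obtain k where k: "k \<le> poly (cost c) N" "(small_step K ^^ k) (c, s) (Skip, s')" by blast
  have "small_step K (Cond P c d, s) (c, s)" using Cond_True by (simp add: small_step_def)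
  with k(2) have "(small_step K ^^ (1 + k)) (Cond P c d, s) (Skip, s')"
    using small_steps_trans small_step_1 by metis
  then show ?case using k(1) by (intro exI[of _ "1 + k"]) auto
next
  case (Cond_False P s d s' c)
  then obtain k where k: "k \<le> poly (cost d) N" "(small_step K ^^ k) (d, s) (Skip, s')" by blast
  have "small_step K (Cond P c d, s) (d, s)" using Cond_False by (simp add: small_step_def)
  with k(2) have "(small_step K ^^ (1 + k)) (Cond P c d, s) (Skip, s')"
    using small_steps_trans small_step_1 by metis
  then show ?case using k(1) by (intro exI[of _ "1 + k"]) auto
next
  case (While m P \<sigma> c)
  have "\<exists>k\<le>l * (poly (cost c) N + 2). (small_step K ^^ k) (While P c, \<sigma> 0) (While P c, \<sigma> l)"
    if "l \<le> m" for l
    using that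
  proof (induction l)
    case (Suc l)
    then obtain k where k: "k \<le> l * (poly (cost c) N + 2)"
      "(small_step K ^^ k) (While P c, \<sigma> 0) (While P c, \<sigma> l)" by auto
    obtain j where j: "j \<le> poly (cost c) N" "(small_step K ^^ j) (c, \<sigma> l) (Skip, \<sigma> (Suc l))"
      using While.IH[rule_format, of l] Suc.prems by auto
    have "small_step K (While P c, \<sigma> l) (c ;; While P c, \<sigma> l)"
      using While.IH[rule_format, of l] Suc.prems by (simp add: small_step_def)
    then have "(small_step K ^^ (1 + j)) (While P c, \<sigma> l) (Skip ;; While P c, \<sigma> (Suc l))"
      using small_steps_Seq[OF j(2)] small_steps_trans small_step_1 by metis
    moreover have "small_step K (Skip ;; While P c, \<sigma> (Suc l)) (While P c, \<sigma> (Suc l))"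
      by (simp add: small_step_def)
    ultimately have "(small_step K ^^ (1 + j + 1)) (While P c, \<sigma> l) (While P c, \<sigma> (Suc l))"
      using small_steps_trans small_step_1 by metis
    with k(2) have "(small_step K ^^ (k + (1 + j + 1))) (While P c, \<sigma> 0) (While P c, \<sigma> (Suc l))"
      by (rule small_steps_trans)
    then show ?case using k(1) j(1) by (intro exI[of _ "k + (1 + j + 1)"]) auto
  qed (auto intro: exI[of _ 0])
  then obtain k where k: "k \<le> m * (poly (cost c) N + 2)"
    "(small_step K ^^ k) (While P c, \<sigma> 0) (While P c, \<sigma> m)" by blast
  have "small_step K (While P c, \<sigma> m) (Skip, \<sigma> m)" using While.hyps by (simp add: small_step_def)
  with k(2) have *: "(small_step K ^^ (k + 1)) (While P c, \<sigma> 0) (Skip, \<sigma> m)"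
    using small_steps_trans small_step_1 by metis
  have "m * (poly (cost c) N + 2) \<le> N * (poly (cost c) N + 2)"
    using While.hyps(1) by (rule mult_le_mono1)
  then have "k + 1 \<le> poly (cost (While P c)) N"
    using k(1) by (simp add: poly_cost_numeral)
  with * show ?case by blast
qed

section \<open>Compilation of programs to Turing machines\<close>

definition ext_reads :: "nat list \<Rightarrow> nat \<Rightarrow> nat" where
  "ext_reads r i = (if i < length r then r ! i else 0)"

text \<open>The table is finite because only symbols up to 3 are ever under a head.
  \<open>Skip\<close> gets no transition, so a finished program is a halted machine.\<close>

definition machine :: "nat \<Rightarrow> (com \<Rightarrow> nat) \<Rightarrow> com \<Rightarrow> turing_machine" where
  "machine K enc c = \<lparr>tapes = K, start = enc c, accept = 0,
     transitions = (\<lambda>(c', r). (enc c', r, enc (fst (nxt c' (ext_reads r))),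
         map (snd (nxt c' (ext_reads r))) [0..<K])) `
       ((residuals c - {Skip}) \<times> {r. set r \<subseteq> {..3} \<and> length r = K})\<rparr>"

definition tm_config :: "nat \<Rightarrow> (com \<Rightarrow> nat) \<Rightarrow> com \<times> store \<Rightarrow> config" where
  "tm_config K enc x = (enc (fst x), map (snd x) [0..<K])"

lemma ext_reads_map:
  "wf_store K s \<Longrightarrow> ext_reads (map read_tape (map s [0..<K])) = reads s"
  by (rule ext) (auto simp: ext_reads_def reads_def wf_store_def)

lemma step_machine:
  assumes "small_step K x y" "fst x \<in> residuals c" "wf_store K (snd x)"
  shows "step (machine K enc c) (tm_config K enc x) (tm_config K enc y)"
proof -
  let ?r = "map read_tape (map (snd x) [0..<K])"
  let ?a = "map (snd (nxt (fst x) (ext_reads ?r))) [0..<K]"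
  have r: "ext_reads ?r = reads (snd x)" using assms(3) by (rule ext_reads_map)
  have "set ?r \<subseteq> {..3}" using wf_store_reads[OF assms(3)] by (auto simp: reads_def)
  then have "?r \<in> {r. set r \<subseteq> {..3} \<and> length r = K}" by simp
  then have "(enc (fst x), ?r, enc (fst (nxt (fst x) (ext_reads ?r))), ?a) \<in> transitions (machine K enc c)"
    using assms unfolding machine_def small_step_def
    by (auto simp del: map_map mem_Collect_eq intro!: image_eqI[where x = "(fst x, ?r)"])
  moreover have "map (snd y) [0..<K] = map2 write_move ?a (map (snd x) [0..<K])"
    using assms(1) by (intro nth_equalityI) (auto simp: small_step_def perform_def r simp del: map_map)
  ultimately show ?thesis
    using assms(1) unfolding step_def tm_config_def
    by (intro exI[of _ ?a]) (simp add: small_step_def r del: map_map)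
qed

lemma steps_machine:
  assumes "(small_step K ^^ k) x y" "fst x \<in> residuals c" "wf_store K (snd x)"
  shows "(step (machine K enc c) ^^ k) (tm_config K enc x) (tm_config K enc y) \<and>
    fst y \<in> residuals c \<and> wf_store K (snd y)"
  using assms
proof (induction k arbitrary: y)
  case (Suc k)
  then obtain z where z: "(small_step K ^^ k) x z" "small_step K z y" by auto
  with Suc have IH: "(step (machine K enc c) ^^ k) (tm_config K enc x) (tm_config K enc z)"
    "fst z \<in> residuals c" "wf_store K (snd z)" by blast+
  have "fst y \<in> residuals c" using z(2) IH(2) by (simp add: small_step_def nxt_in_residuals)
  moreover have "wf_store K (snd y)" using z(2) IH(3) by (rule wf_store_small_step)
  moreover have "step (machine K enc c) (tm_config K enc z) (tm_config K enc y)"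
    using step_machine z(2) IH by blast
  ultimately show ?case using IH(1) by auto
qed simp

definition input_store :: "bool list \<Rightarrow> store" where
  "input_store w i = (if i = 0 then (word_contents w, 0) else (\<lambda>_. 0, 0))"

lemma word_contents_Nil: "word_contents [] = (\<lambda>_. 0)"
  by (auto simp: word_contents_def)

text \<open>Two polynomials are composed: \<open>q\<close> bounds the rounds of a loop in terms of
  the input length, and \<open>cost c\<close> bounds the steps in terms of the rounds.\<close>

lemma poly_time_computableI:
  assumes K: "K \<ge> 2"
    and run: "\<And>w. \<exists>s. big_step K (poly q (length w)) c (input_store w) s \<and> fst (s 1) = word_contents (f w)"
  shows "poly_time_computable f"
proof -
  obtain enc :: "com \<Rightarrow> nat" where enc: "inj_on enc (residuals c)"
    using finite_imp_inj_to_nat_seg[OF finite_residuals[of c]] by blast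
  let ?M = "machine K enc c"
  have fin: "finite {r :: nat list. set r \<subseteq> {..3} \<and> length r = K}"
    by (rule finite_lists_length_eq) simp
  have wf: "wf_tm ?M"
    using K fin by (auto simp: wf_tm_def machine_def finite_residuals)
  have det: "deterministic ?M"
    unfolding deterministic_def machine_def by (auto dest!: inj_onD[OF enc])
  have "\<exists>n c'. n \<le> poly (pcompose (cost c) q) (length w) \<and> (step ?M ^^ n) (init_config ?M w) c' \<and>
      halted ?M c' \<and> fst (snd c' ! 1) = word_contents (f w)" for w
  proof -
    obtain s where s: "big_step K (poly q (length w)) c (input_store w) s" "fst (s 1) = word_contents (f w)"
      using run by blast
    from big_step_small_steps[OF s(1)] obtain k where k: "k \<le> poly (cost c) (poly q (length w))"
      "(small_step K ^^ k) (c, input_store w) (Skip, s)" by blast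
    have wfs: "wf_store K (input_store w)"
      using K by (auto simp: wf_store_def input_store_def word_contents_def)
    have "(step ?M ^^ k) (tm_config K enc (c, input_store w)) (tm_config K enc (Skip, s))"
      using steps_machine[OF k(2)] wfs self_in_residuals by simp
    moreover have "tm_config K enc (c, input_store w) = init_config ?M w"
      unfolding tm_config_def init_config_def
      using K by (auto simp: machine_def input_store_def word_contents_Nil nth_Cons' intro!: nth_equalityI)
    moreover have "halted ?M (tm_config K enc (Skip, s))"
      by (auto simp: halted_def step_def machine_def tm_config_def Skip_in_residuals dest!: inj_onD[OF enc])
    moreover have "fst (snd (tm_config K enc (Skip, s)) ! 1) = word_contents (f w)"
      using K s(2) by (simp add: tm_config_def)
    ultimately show ?thesis using k(1) unfolding poly_pcompose by metis
  qed
  then show ?thesis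
    unfolding poly_time_computable_def using wf det K
    by (intro exI[of _ ?M] exI[of _ "pcompose (cost c) q"]) (simp add: machine_def)
qed

section \<open>Building blocks for programs\<close>

lemma big_step_WhileI:
  assumes "\<sigma> 0 = s" "\<sigma> m = s'" "m \<le> N" "\<And>k. k < m \<Longrightarrow> P (reads (\<sigma> k))"
    "\<And>k. k < m \<Longrightarrow> big_step K N c (\<sigma> k) (\<sigma> (Suc k))" "\<not> P (reads (\<sigma> m))"
  shows "big_step K N (While P c) s s'"
  using big_step.While[of m N P \<sigma> K c] assms by blast

lemma big_step_ActI:
  assumes "perform K (\<lambda>i. clip (reads s i) (f (reads s) i)) s = s'"
  shows "big_step K N (Act f) s s'"
  using big_step.Act[of K N f s] assms by simp

section \<open>Loops that restore the head positions\<close>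

definition shift :: "(nat \<Rightarrow> head_move) \<Rightarrow> int \<Rightarrow> store \<Rightarrow> store" where
  "shift v k s = (\<lambda>i. (fst (s i), snd (s i) + k * offset (v i)))"

definition move :: "(nat \<Rightarrow> head_move) \<Rightarrow> com" where
  "move v = Act (\<lambda>r i. (r i, v i))"

lemma shift_0 [simp]: "shift v 0 s = s"
  by (simp add: shift_def)

lemma shift_shift [simp]: "shift v k (shift v l s) = shift v (l + k) s"
  by (simp add: shift_def algebra_simps)

lemma write_move_read: "write_move (read_tape x, d) x = (fst x, snd x + offset d)"
  by (cases x) auto

lemma big_step_move:
  assumes "\<And>i. i \<ge> K \<Longrightarrow> v i = Stay"
  shows "big_step K N (move v) s (shift v 1 s)"
  unfolding move_def using assms
  by (intro big_step_ActI) (auto simp: perform_def clip_def shift_def reads_def write_move_read not_less)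

fun opposite :: "head_move \<Rightarrow> head_move" where
  "opposite Move_Left = Move_Right"
| "opposite Stay = Stay"
| "opposite Move_Right = Move_Left"

lemma offset_opposite [simp]: "offset (opposite d) = - offset d"
  by (cases d) auto

lemma shift_opposite: "shift (\<lambda>i. opposite (v i)) k s = shift v (- k) s"
  by (simp add: shift_def)

text \<open>The second pass undoes the head moves of the first, so that only the effect of the body
  remains and loops can be nested. \<open>P\<close> fails at the far end, \<open>Q\<close> fails at
  the origin.\<close>

definition loop :: "((nat \<Rightarrow> nat) \<Rightarrow> bool) \<Rightarrow> ((nat \<Rightarrow> nat) \<Rightarrow> bool) \<Rightarrow> (nat \<Rightarrow> head_move) \<Rightarrow> com \<Rightarrow> com" where
  "loop P Q v c = While P (c ;; move v) ;; While Q (move (\<lambda>i. opposite (v i)))"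

lemma big_step_loop:
  assumes v: "\<And>i. i \<ge> K \<Longrightarrow> v i = Stay" and m: "m \<le> N"
    and ends: "\<sigma> 0 = s" "\<sigma> m = s'"
    and body: "\<And>k. k < m \<Longrightarrow> big_step K N c (shift v (int k) (\<sigma> k)) (shift v (int k) (\<sigma> (Suc k)))"
    and P: "\<And>k. k < m \<Longrightarrow> P (reads (shift v (int k) (\<sigma> k)))" "\<not> P (reads (shift v (int m) (\<sigma> m)))"
    and Q: "\<And>k. 0 < k \<Longrightarrow> k \<le> m \<Longrightarrow> Q (reads (shift v (int k) (\<sigma> m)))" "\<not> Q (reads (\<sigma> m))"
  shows "big_step K N (loop P Q v c) s s'"
  unfolding loop_def
proof (rule big_step.Seq)
  show "big_step K N (While P (c ;; move v)) s (shift v (int m) (\<sigma> m))"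
  proof (rule big_step_WhileI[where \<sigma> = "\<lambda>k. shift v (int k) (\<sigma> k)" and m = m])
    fix k assume "k < m"
    from body[OF this] big_step_move[of K v N "shift v (int k) (\<sigma> (Suc k))"] v
    show "big_step K N (c ;; move v) (shift v (int k) (\<sigma> k)) (shift v (int (Suc k)) (\<sigma> (Suc k)))"
      by (auto intro: big_step.Seq simp: add.commute)
  qed (use assms in auto)
  show "big_step K N (While Q (move (\<lambda>i. opposite (v i)))) (shift v (int m) (\<sigma> m)) s'"
  proof (rule big_step_WhileI[where \<sigma> = "\<lambda>k. shift v (int (m - k)) (\<sigma> m)" and m = m])
    fix k assume k: "k < m"
    show "big_step K N (move (\<lambda>i. opposite (v i)))
        (shift v (int (m - k)) (\<sigma> m)) (shift v (int (m - Suc k)) (\<sigma> m))"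
      using big_step_move[of K "\<lambda>i. opposite (v i)" N "shift v (int (m - k)) (\<sigma> m)"] v k
      by (simp add: shift_opposite of_nat_diff algebra_simps)
  next
    fix k assume "k < m"
    then show "Q (reads (shift v (int (m - k)) (\<sigma> m)))" using Q(1)[of "m - k"] by simp
  qed (use assms in auto)
qed

text \<open>A tape used as a counter: the blank behind the end stops a forward pass, the mark 1
  stops the return, and 3 makes the last cell recognisable. On a ruler of length 1 the mark 1
  wins.\<close>

definition ruler :: "nat \<Rightarrow> int \<Rightarrow> nat" where
  "ruler m i = (if i < 0 \<or> int m \<le> i then 0 else if i = 0 then 1 else if i = int m - 1 then 3 else 2)"

definition for_loop :: "nat \<Rightarrow> (nat \<Rightarrow> head_move) \<Rightarrow> com \<Rightarrow> com" where
  "for_loop x v c = loop (\<lambda>r. r x \<noteq> 0) (\<lambda>r. r x \<noteq> 1) v c"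

lemma big_step_for_loop:
  assumes v: "\<And>i. i \<ge> K \<Longrightarrow> v i = Stay" and m: "0 < m" "m \<le> N"
    and x: "v x = Move_Right" "\<And>k. \<sigma> k x = (ruler m, 0)"
    and ends: "\<sigma> 0 = s" "\<sigma> m = s'"
    and body: "\<And>k. k < m \<Longrightarrow> big_step K N c (shift v (int k) (\<sigma> k)) (shift v (int k) (\<sigma> (Suc k)))"
  shows "big_step K N (for_loop x v c) s s'"
  unfolding for_loop_def
  by (rule big_step_loop[where \<sigma> = \<sigma> and m = m]) (use assms in \<open>auto simp: reads_def shift_def ruler_def split: if_splits\<close>)

fun seqs :: "com list \<Rightarrow> com" where
  "seqs [] = Skip"
| "seqs (c # cs) = c ;; seqs cs"

definition put :: "nat set \<Rightarrow> tape \<Rightarrow> store \<Rightarrow> store" where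
  "put A x s = (\<lambda>i. if i \<in> A then x else s i)"

definition along :: "nat set \<Rightarrow> head_move \<Rightarrow> nat \<Rightarrow> head_move" where
  "along A d i = (if i \<in> A then d else Stay)"

definition write_at :: "nat set \<Rightarrow> nat \<Rightarrow> head_move \<Rightarrow> com" where
  "write_at A a d = Act (\<lambda>r i. if i \<in> A then (a, d) else (r i, Stay))"

lemma big_step_write_at:
  assumes "A \<subseteq> {..<K}" "a \<le> 3"
  shows "big_step K N (write_at A a d) (put A (f, i) s) (put A (f(i := a), i + offset d) s)"
  unfolding write_at_def using assms
  by (intro big_step_ActI)
    (auto simp: perform_def clip_def put_def reads_def write_move_read fun_eq_iff)

definition filled :: "nat \<Rightarrow> int \<Rightarrow> nat" where
  "filled k i = (if 0 \<le> i \<and> i < int k then 2 else 0)"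

definition mark :: "nat set \<Rightarrow> com" where
  "mark A = write_at A 2 Move_Right"

lemma big_step_mark:
  assumes "A \<subseteq> {..<K}"
  shows "big_step K N (mark A) (put A (filled k, int k) s) (put A (filled (Suc k), int (Suc k)) s)"
proof -
  have "(filled k)(int k := 2) = filled (Suc k)" by (auto simp: filled_def)
  with big_step_write_at[OF assms, of 2 N Move_Right "filled k" "int k" s] show ?thesis
    by (simp add: mark_def add.commute)
qed

lemma big_step_marks:
  assumes "A \<subseteq> {..<K}"
  shows "big_step K N (seqs (replicate c (mark A)))
    (put A (filled k, int k) s) (put A (filled (k + c), int (k + c)) s)"
proof (induction c arbitrary: k)
  case 0
  then show ?case by (auto intro: big_step.Skip)
next
  case (Suc c)
  from big_step.Seq[OF big_step_mark[OF assms] Suc[of "Suc k"]] show ?case by simp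
qed

definition rewind :: "nat set \<Rightarrow> nat \<Rightarrow> com" where
  "rewind A x = move (along A Move_Left) ;; While (\<lambda>r. r x \<noteq> 0) (move (along A Move_Left)) ;;
     move (along A Move_Right)"

lemma shift_along_Left: "shift (along A Move_Left) k s = shift (along A Move_Right) (- k) s"
  by (auto simp: shift_def along_def)

lemma big_step_rewind:
  assumes A: "A \<subseteq> {..<K}" "x \<in> A" and m: "m \<le> N"
    and s: "s x = (f, 0)" "f (-1) = 0" "\<And>i. 0 \<le> i \<Longrightarrow> i < int m \<Longrightarrow> f i \<noteq> 0"
  shows "big_step K N (rewind A x) (shift (along A Move_Right) (int m) s) s"
proof -
  let ?R = "\<lambda>k. shift (along A Move_Right) k s"
  have stay: "along A d i = Stay" if "i \<ge> K" for d i using A(1) that by (auto simp: along_def)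
  have left: "big_step K N (move (along A Move_Left)) (?R k) (?R (k - 1))" for k
    using big_step_move[of K "along A Move_Left" N "?R k"] stay by (simp add: shift_along_Left)
  have right: "big_step K N (move (along A Move_Right)) (?R k) (?R (k + 1))" for k
    using big_step_move[of K "along A Move_Right" N "?R k"] stay by simp
  have reads: "reads (?R k) x = f k" for k using s(1) A(2) by (simp add: reads_def shift_def along_def)
  have "big_step K N (While (\<lambda>r. r x \<noteq> 0) (move (along A Move_Left))) (?R (int m - 1)) (?R (-1))"
  proof (rule big_step_WhileI[where \<sigma> = "\<lambda>k. ?R (int m - 1 - int k)" and m = m])
    fix k assume "k < m"
    show "big_step K N (move (along A Move_Left)) (?R (int m - 1 - int k)) (?R (int m - 1 - int (Suc k)))"
      using left[of "int m - 1 - int k"] by (simp add: algebra_simps)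
  qed (use m s reads in \<open>auto simp: reads\<close>)
  then show ?thesis
    unfolding rewind_def using left[of "int m"] right[of "-1"] by (auto intro!: big_step.Seq)
qed

text \<open>Turns a block of equal marks, with the heads just behind it, into a ruler. The mark 1 is
  written last, so it overrides 3 on a block of one cell.\<close>

definition finish :: "nat set \<Rightarrow> nat \<Rightarrow> com" where
  "finish A x = move (along A Move_Left) ;; write_at A 3 Move_Right ;; rewind A x ;; write_at A 1 Stay"

lemma big_step_finish:
  assumes A: "A \<subseteq> {..<K}" "x \<in> A" and m: "0 < m" "m \<le> N"
  shows "big_step K N (finish A x) (put A (filled m, int m) s) (put A (ruler m, 0) s)"
proof -
  let ?f = "(filled m)(int m - 1 := 3)"
  have stay: "along A d i = Stay" if "i \<ge> K" for d i using A(1) that by (auto simp: along_def)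
  have sh: "shift (along A d) k (put A (f, i) s) = put A (f, i + k * offset d) s" for d k f i
    by (auto simp: shift_def along_def put_def)
  have 1: "big_step K N (move (along A Move_Left)) (put A (filled m, int m) s) (put A (filled m, int m - 1) s)"
    using big_step_move[of K "along A Move_Left" N "put A (filled m, int m) s"] stay by (simp add: sh)
  have 2: "big_step K N (write_at A 3 Move_Right) (put A (filled m, int m - 1) s) (put A (?f, int m) s)"
    using big_step_write_at[of A K 3 N Move_Right "filled m" "int m - 1" s] A by simp
  have 3: "big_step K N (rewind A x) (put A (?f, int m) s) (put A (?f, 0) s)"
    using big_step_rewind[of A K x m N "put A (?f, 0) s" ?f] A m
    by (simp add: sh) (simp add: put_def filled_def)
  have "?f(0 := 1) = ruler m" using m(1) by (auto simp: filled_def ruler_def fun_eq_iff)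
  then have 4: "big_step K N (write_at A 1 Stay) (put A (?f, 0) s) (put A (ruler m, 0) s)"
    using big_step_write_at[of A K 1 N Stay ?f 0 s] A by simp
  from 1 2 3 4 show ?thesis unfolding finish_def by (meson big_step.Seq)
qed

fun nest :: "nat list \<Rightarrow> com \<Rightarrow> com" where
  "nest [] c = c"
| "nest (x # xs) c = for_loop x (along {x} Move_Right) (nest xs c)"

text \<open>Exponentiation: every loop around \<open>mark\<close> multiplies the number of marks by
  \<open>b\<close>. In this way a length polynomial in the input is laid out on tapes.\<close>

lemma big_step_nest_mark:
  assumes A: "A \<subseteq> {..<K}" and xs: "distinct xs" "set xs \<subseteq> {..<K} - A"
    and b: "0 < b" "b \<le> N" and s: "\<And>x. x \<in> set xs \<Longrightarrow> s x = (ruler b, 0)"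
  shows "big_step K N (nest xs (mark A)) (put A (filled k, int k) s)
    (put A (filled (k + b ^ length xs), int (k + b ^ length xs)) s)"
  using xs s
proof (induction xs arbitrary: s k)
  case Nil
  then show ?case using big_step_mark[OF A, of N k s] by simp
next
  case (Cons x xs)
  let ?n = "b ^ length xs"
  let ?\<sigma> = "\<lambda>l. put A (filled (k + l * ?n), int (k + l * ?n)) s"
  have x: "x < K" "x \<notin> A" "x \<notin> set xs" using Cons.prems by auto
  have sh: "shift (along {x} Move_Right) l (put A t s) = put A t (shift (along {x} Move_Right) l s)" for l t
    using x by (auto simp: shift_def along_def put_def)
  show ?case unfolding nest.simps
  proof (rule big_step_for_loop[where \<sigma> = ?\<sigma> and m = b])
    fix l
    have "big_step K N (nest xs (mark A)) (put A (filled (k + l * ?n), int (k + l * ?n)) (shift (along {x} Move_Right) (int l) s))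
      (put A (filled (k + l * ?n + ?n), int (k + l * ?n + ?n)) (shift (along {x} Move_Right) (int l) s))"
      using Cons.prems x by (intro Cons.IH) (auto simp: shift_def along_def)
    then show "big_step K N (nest xs (mark A)) (shift (along {x} Move_Right) (int l) (?\<sigma> l))
      (shift (along {x} Move_Right) (int l) (?\<sigma> (Suc l)))"
      by (simp add: sh algebra_simps)
  qed (use x b Cons.prems in \<open>auto simp: along_def put_def\<close>)
qed

section \<open>A program writing preference lists\<close>

definition base_tapes :: "nat \<Rightarrow> nat set" where
  "base_tapes d = {11..<11 + d}"

definition ticks :: "int \<Rightarrow> nat" where
  "ticks i = (if i = 0 then 1 else if i = 1 then 2 else if i = -1 then 3 else 0)"

text \<open>The \<open>c\<close> initial marks and one mark per input letter give the length
  \<open>length w + c\<close>, and \<open>d\<close> nested loops produce its \<open>d\<close>-th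
  power. For the ticks the heads visit the cells 0, 1, 0, -1 and return to 0; the second visit to 0
  only repeats its symbol.\<close>

definition prologue :: "nat \<Rightarrow> nat \<Rightarrow> com" where
  "prologue c d =
     seqs (replicate c (mark (base_tapes d))) ;;
     While (\<lambda>r. r 0 \<noteq> 0) (mark (base_tapes d) ;; move (along {0} Move_Right)) ;;
     rewind {0} 0 ;; finish (base_tapes d) 11 ;;
     nest [11..<11 + d] (mark {2..8}) ;; finish {2..8} 2 ;;
     write_at {9, 10} 1 Move_Right ;; write_at {9, 10} 2 Move_Left ;;
     write_at {9, 10} 1 Move_Left ;; write_at {9, 10} 3 Move_Right"

text \<open>Tape 0 holds the input and tape 1 the output. Tapes 2 to 5 hold the coordinates \<open>t\<close>, \<open>j\<close>
  of a node and \<open>t'\<close>, \<open>j'\<close> of a second node as head positions on rulers of length \<open>N\<close>;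
  tapes 6 to 8 are further rulers. The heads of tapes 9 and 10 stay at the positions \<open>t' - t\<close> and
  \<open>j' - j\<close>, so that comparing coordinates amounts to reading a symbol. The remaining tapes
  hold rulers of length \<open>length w + c\<close>, from which \<open>N\<close> is built.\<close>

definition layout :: "bool list \<Rightarrow> nat \<Rightarrow> nat \<Rightarrow> nat \<Rightarrow> (nat \<Rightarrow> int) \<Rightarrow> bool list \<Rightarrow> store" where
  "layout w N b d pos out i =
     (if i = 1 then (word_contents out, int (length out))
      else (if i = 0 then word_contents w else if i \<in> {2..8} then ruler N
            else if i \<in> {9, 10} then ticks else if i \<in> base_tapes d then ruler b else (\<lambda>_. 0), pos i))"

text \<open>All that the program sees of a pair of nodes besides their kinds. The vector has fixed
  length and entries at most 3, so a test on it is a finite table.\<close>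

definition observe :: "bool list \<Rightarrow> nat \<Rightarrow> nat \<Rightarrow> nat \<Rightarrow> nat \<Rightarrow> nat \<Rightarrow> nat list" where
  "observe w N t j t' j' =
     [word_contents w (int j), ruler N (int t), ruler N (int j), ruler N (int t'), ruler N (int j'),
      ticks (int t' - int t), ticks (int j' - int j)]"

definition view :: "(nat \<Rightarrow> nat) \<Rightarrow> nat list" where
  "view r = [r 0, r 2, r 3, r 4, r 5, r 9, r 10]"

definition emit :: "bool \<Rightarrow> com" where
  "emit b = write_at {1} (if b then 2 else 1) Move_Right"

text \<open>Runs the body as often as the coordinate stored as the head position of tape
  \<open>x\<close>. That head walks down to the origin while the head of tape 8 counts, and tape 8
  then ends the way back.\<close>

definition repeat_down :: "nat \<Rightarrow> com \<Rightarrow> com" where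
  "repeat_down x c = loop (\<lambda>r. r x \<noteq> 1) (\<lambda>r. r 8 \<noteq> 1)
     (\<lambda>i. if i = x then Move_Left else if i = 8 then Move_Right else Stay) c"

text \<open>A node of kind \<open>z\<close> with coordinates t' and j' has the number z*N*N + t'*N +
  j'. The three parts write the three summands in unary.\<close>

definition emit_node :: "nat \<Rightarrow> com" where
  "emit_node z =
     seqs (replicate z (for_loop 6 (along {6} Move_Right) (for_loop 7 (along {7} Move_Right) (emit True)))) ;;
     repeat_down 4 (for_loop 6 (along {6} Move_Right) (emit True)) ;;
     repeat_down 5 (emit True)"

definition t_moves :: "nat \<Rightarrow> head_move" where
  "t_moves i = (if i = 2 then Move_Right else if i = 9 then Move_Left else Stay)"

text \<open>The input head moves along with j, which makes the letter at position j visible. Head 10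
  moves left because it records j' - j.\<close>

definition j_moves :: "nat \<Rightarrow> head_move" where
  "j_moves i = (if i \<in> {0, 3} then Move_Right else if i = 10 then Move_Left else Stay)"

definition t'_moves :: "nat \<Rightarrow> head_move" where
  "t'_moves = along {4, 9} Move_Right"

definition j'_moves :: "nat \<Rightarrow> head_move" where
  "j'_moves = along {5, 10} Move_Right"

definition position :: "nat \<Rightarrow> nat \<Rightarrow> nat \<Rightarrow> nat \<Rightarrow> nat \<Rightarrow> int" where
  "position t j t' j' i = int t * offset (t_moves i) + int j * offset (j_moves i) +
     int t' * offset (t'_moves i) + int j' * offset (j'_moves i)"

text \<open>Kinds and ranks have constant ranges and are unrolled; only coordinates need loops. For
  each node all nodes are scanned once per rank, which lists the neighbours by rank and, within a
  rank, by number. Each \<open>emit True\<close> outside \<open>emit_node\<close> is the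
  continuation mark of a list, and each \<open>emit False\<close> ends a number or a list.\<close>

definition emit_lists :: "nat \<Rightarrow> nat \<Rightarrow> (nat \<Rightarrow> nat \<Rightarrow> nat \<Rightarrow> nat list \<Rightarrow> bool) \<Rightarrow> com" where
  "emit_lists Z R A =
     seqs (map (\<lambda>z. for_loop 2 t_moves (for_loop 3 j_moves (emit True ;;
       seqs (map (\<lambda>r. seqs (map (\<lambda>z'. for_loop 4 t'_moves (for_loop 5 j'_moves
         (Cond (\<lambda>rd. A z r z' (view rd)) (emit True ;; emit_node z' ;; emit False) Skip))) [0..<Z])) [0..<R]) ;;
       emit False))) [0..<Z]) ;; emit False"

definition pref_lists :: "nat \<Rightarrow> nat \<Rightarrow> (nat \<Rightarrow> nat \<Rightarrow> nat) \<Rightarrow> nat list list" where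
  "pref_lists n R rk =
     map (\<lambda>u. concat (map (\<lambda>r. filter (\<lambda>v. rk u v = r) [0..<n]) [0..<R])) [0..<n]"

lemma concat_map_upt_mult:
  "concat (map (\<lambda>i. concat (map (\<lambda>j. F (i * m + j)) [0..<m])) [0..<k]) = concat (map F [0..<k * m])"
proof (induction k)
  case (Suc k)
  have "[k * m..<k * m + m] = map (\<lambda>j. k * m + j) [0..<m]"
    using map_add_upt[of "k * m" m] by (simp add: add.commute)
  then have "concat (map F [k * m..<k * m + m]) = concat (map (\<lambda>j. F (k * m + j)) [0..<m])"
    by (simp add: o_def)
  moreover have "[0..<Suc k * m] = [0..<k * m] @ [k * m..<k * m + m]"
    by (metis add.commute le0 mult_Suc upt_add_eq_append)
  ultimately show ?case using Suc by simp
qed simp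

lemma concat_map_upt_mult2:
  "concat (map (\<lambda>z. concat (map (\<lambda>t. concat (map (\<lambda>j. F (z * N * N + t * N + j)) [0..<N])) [0..<N])) [0..<Z])
     = concat (map F [0..<Z * N * N])"
proof -
  have "concat (map F [0..<Z * (N * N)]) =
      concat (map (\<lambda>z. concat (map (\<lambda>i. F (z * (N * N) + i)) [0..<N * N])) [0..<Z])"
    by (rule concat_map_upt_mult[symmetric])
  also have "\<dots> = concat (map (\<lambda>z. concat (map (\<lambda>t. concat (map (\<lambda>j. F (z * (N * N) + (t * N + j))) [0..<N])) [0..<N])) [0..<Z])"
    by (simp only: concat_map_upt_mult[of "\<lambda>i. F (z * (N * N) + i)" N N for z])
  finally show ?thesis by (simp add: mult.assoc add.assoc)
qed

lemma concat_map_filter: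
  "concat (map f (filter P xs)) = concat (map (\<lambda>x. if P x then f x else []) xs)"
  by (induction xs) auto

lemma concat_map_concat: "concat (map f (concat (map g xs))) = concat (map (\<lambda>x. concat (map f (g x))) xs)"
  by (induction xs) auto

lemma encode_pref_lists:
  "encode_instance (pref_lists (Z * N * N) R rk) =
     concat (map (\<lambda>z. concat (map (\<lambda>t. concat (map (\<lambda>j. [True] @
       concat (map (\<lambda>r. concat (map (\<lambda>z'. concat (map (\<lambda>t'. concat (map (\<lambda>j'.
         if rk (z * N * N + t * N + j) (z' * N * N + t' * N + j') = r
         then [True] @ replicate (z' * N * N + t' * N + j') True @ [False] else [])
       [0..<N])) [0..<N])) [0..<Z])) [0..<R]) @ [False]) [0..<N])) [0..<N])) [0..<Z]) @ [False]"
  unfolding encode_instance_def encode_list_def[of "encode_list encode_nat"] pref_lists_def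
  by (simp add: encode_list_def encode_nat_def concat_map_concat concat_map_filter o_def
      concat_map_upt_mult2[symmetric] cong: if_cong)

section \<open>Correctness of the list-writing program\<close>

locale writer =
  fixes w :: "bool list" and c d N :: nat
  assumes c: "c \<ge> 2" and d: "d \<ge> 1" and N: "N = (length w + c) ^ d"
begin

abbreviation "b \<equiv> length w + c"
abbreviation "runs \<equiv> big_step (11 + d) (N + 1)"
abbreviation "state \<equiv> layout w N b d"

lemma b_le_N: "b \<le> N"
  using c d unfolding N by (cases d) auto

lemma N_ge_2: "N \<ge> 2"
  using b_le_N c by simp

lemma prologue: "runs (prologue c d) (input_store w) (state (\<lambda>_. 0) [])"
proof -
  let ?B = "base_tapes d" and ?s = "input_store w"
  have B: "?B \<subseteq> {..<11 + d}" "11 \<in> ?B" using d by (auto simp: base_tapes_def)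
  let ?R = "\<lambda>k. shift (along {0} Move_Right) k ?s"
  have nB: "put ?B x (shift (along {0} Move_Right) k s) = shift (along {0} Move_Right) k (put ?B x s)" for x k s
    by (auto simp: put_def shift_def along_def base_tapes_def)
  have "?s = put ?B (filled 0, int 0) ?s"
    by (auto simp: put_def base_tapes_def input_store_def filled_def fun_eq_iff)
  then have 1: "runs (seqs (replicate c (mark ?B))) ?s (put ?B (filled c, int c) ?s)"
    using big_step_marks[OF B(1), of "N + 1" c 0 ?s] by simp
  have 2: "runs (While (\<lambda>r. r 0 \<noteq> 0) (mark ?B ;; move (along {0} Move_Right)))
    (put ?B (filled c, int c) ?s) (put ?B (filled b, int b) (?R (int (length w))))"
  proof (rule big_step_WhileI[where \<sigma> = "\<lambda>k. put ?B (filled (c + k), int (c + k)) (?R (int k))" and m = "length w"])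
    fix k assume "k < length w"
    have "runs (mark ?B) (put ?B (filled (c + k), int (c + k)) (?R (int k)))
      (put ?B (filled (Suc (c + k)), int (Suc (c + k))) (?R (int k)))"
      by (rule big_step_mark[OF B(1)])
    moreover have "runs (move (along {0} Move_Right)) (put ?B (filled (Suc (c + k)), int (Suc (c + k))) (?R (int k)))
      (put ?B (filled (c + Suc k), int (c + Suc k)) (?R (int (Suc k))))"
      using big_step_move[of "11 + d" "along {0} Move_Right" "N + 1" "put ?B (filled (Suc (c + k)), int (Suc (c + k))) (?R (int k))"]
      by (simp add: nB along_def add.commute)
    ultimately show "runs (mark ?B ;; move (along {0} Move_Right)) (put ?B (filled (c + k), int (c + k)) (?R (int k)))
      (put ?B (filled (c + Suc k), int (c + Suc k)) (?R (int (Suc k))))"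
      by (rule big_step.Seq)
  qed (use b_le_N in \<open>auto simp: add.commute reads_def put_def base_tapes_def shift_def along_def input_store_def word_contents_def\<close>)
  have 3: "runs (rewind {0} 0) (put ?B (filled b, int b) (?R (int (length w)))) (put ?B (filled b, int b) ?s)"
    unfolding nB using b_le_N
    by (intro big_step_rewind[where f = "word_contents w"])
      (auto simp: put_def base_tapes_def input_store_def word_contents_def)
  have 4: "runs (finish ?B 11) (put ?B (filled b, int b) ?s) (put ?B (ruler b, 0) ?s)"
    using B b_le_N c by (intro big_step_finish) auto
  let ?s4 = "put ?B (ruler b, 0) ?s"
  have eq: "?s4 = put {2..8} (filled 0, int 0) ?s4"
    by (auto simp: put_def base_tapes_def input_store_def filled_def fun_eq_iff)
  have "runs (nest [11..<11 + d] (mark {2..8})) (put {2..8} (filled 0, int 0) ?s4)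
      (put {2..8} (filled (0 + b ^ length [11..<11 + d]), int (0 + b ^ length [11..<11 + d])) ?s4)"
    using b_le_N c by (intro big_step_nest_mark) (auto simp: put_def base_tapes_def)
  then have 5: "runs (nest [11..<11 + d] (mark {2..8})) ?s4 (put {2..8} (filled N, int N) ?s4)"
    unfolding eq[symmetric] by (simp add: N)
  have 6: "runs (finish {2..8} 2) (put {2..8} (filled N, int N) ?s4) (put {2..8} (ruler N, 0) ?s4)"
    using N_ge_2 by (intro big_step_finish) auto
  let ?s6 = "put {2..8} (ruler N, 0) ?s4"
  have eq6: "?s6 = put {9, 10} (\<lambda>_. 0, 0) ?s6"
    by (auto simp: put_def base_tapes_def input_store_def fun_eq_iff)
  note wr = big_step_write_at[of "{9, 10}" "11 + d" _ "N + 1"]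
  have 7: "runs (write_at {9, 10} 1 Move_Right) ?s6 (put {9, 10} ((\<lambda>_. 0)(0 := 1), 1) ?s6)"
    using wr[of 1 Move_Right "\<lambda>_. 0" 0 ?s6] unfolding eq6[symmetric] by simp
  have 8: "runs (write_at {9, 10} 2 Move_Left) (put {9, 10} ((\<lambda>_. 0)(0 := 1), 1) ?s6)
    (put {9, 10} ((\<lambda>_. 0)(0 := 1, 1 := 2), 0) ?s6)"
    using wr[of 2 Move_Left "(\<lambda>_. 0)(0 := 1)" 1 ?s6] by simp
  have 9: "runs (write_at {9, 10} 1 Move_Left) (put {9, 10} ((\<lambda>_. 0)(0 := 1, 1 := 2), 0) ?s6)
    (put {9, 10} ((\<lambda>_. 0)(0 := 1, 1 := 2, 0 := 1), - 1) ?s6)"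
    using wr[of 1 Move_Left "(\<lambda>_. 0)(0 := 1, 1 := 2)" 0 ?s6] by simp
  have 10: "runs (write_at {9, 10} 3 Move_Right) (put {9, 10} ((\<lambda>_. 0)(0 := 1, 1 := 2, 0 := 1), - 1) ?s6)
    (put {9, 10} ((\<lambda>_. 0)(0 := 1, 1 := 2, 0 := 1, -1 := 3), 0) ?s6)"
    using wr[of 3 Move_Right "(\<lambda>_. 0)(0 := 1, 1 := 2, 0 := 1)" "-1" ?s6] by simp
  have "put {9, 10} ((\<lambda>_. 0)(0 := 1, 1 := 2, 0 := 1, -1 := 3), 0) ?s6 = state (\<lambda>_. 0) []"
    by (auto simp: put_def layout_def fun_eq_iff ticks_def input_store_def word_contents_def base_tapes_def)
  with 10 have 10: "runs (write_at {9, 10} 3 Move_Right) (put {9, 10} ((\<lambda>_. 0)(0 := 1, 1 := 2, 0 := 1), - 1) ?s6)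
    (state (\<lambda>_. 0) [])"
    by simp
  note big_step.Seq[OF 1 big_step.Seq[OF 2 big_step.Seq[OF 3 big_step.Seq[OF 4 big_step.Seq[OF 5
      big_step.Seq[OF 6 big_step.Seq[OF 7 big_step.Seq[OF 8 big_step.Seq[OF 9 10]]]]]]]]]
  then show ?thesis unfolding prologue_def .
qed

text \<open>All heads except the output head return to \<open>pos\<close>, whatever has been written
  before. Hence outputs of consecutive programs simply concatenate.\<close>

definition emits :: "com \<Rightarrow> (nat \<Rightarrow> int) \<Rightarrow> bool list \<Rightarrow> bool" where
  "emits p pos xs \<longleftrightarrow> (\<forall>out. runs p (state pos out) (state pos (out @ xs)))"

lemma emits_Skip: "emits Skip pos []"
  by (simp add: emits_def big_step.Skip)

lemma emits_Seq: "emits p pos xs \<Longrightarrow> emits q pos ys \<Longrightarrow> emits (p ;; q) pos (xs @ ys)"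
  unfolding emits_def by (metis append.assoc big_step.Seq)

lemma emits_seqs:
  "(\<And>x. x \<in> set xs \<Longrightarrow> emits (p x) pos (f x)) \<Longrightarrow> emits (seqs (map p xs)) pos (concat (map f xs))"
  by (induction xs) (auto intro: emits_Skip emits_Seq)

lemma emits_replicate:
  "emits p pos xs \<Longrightarrow> emits (seqs (replicate k p)) pos (concat (replicate k xs))"
  by (induction k) (auto intro: emits_Skip emits_Seq)

lemma emits_emit: "emits (emit x) pos [x]"
  unfolding emits_def
proof
  fix out
  have "state pos out = put {1} (word_contents out, int (length out)) (state pos out)"
    by (auto simp: put_def layout_def)
  moreover have "(word_contents out)(int (length out) := (if x then 2 else 1)) = word_contents (out @ [x])"
    by (auto simp: word_contents_def nth_append fun_eq_iff nat_less_iff)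
  moreover have "state pos (out @ [x]) = put {1} (word_contents (out @ [x]), int (length out) + 1) (state pos out)"
    by (auto simp: put_def layout_def)
  ultimately show "runs (emit x) (state pos out) (state pos (out @ [x]))"
    using big_step_write_at[of "{1}" "11 + d" "if x then 2 else 1" "N + 1" Move_Right "word_contents out" "int (length out)" "state pos out"]
    by (simp add: emit_def split: if_splits)
qed

lemma emits_Cond:
  assumes "P (reads (state pos [])) \<Longrightarrow> emits p pos xs" "\<not> P (reads (state pos [])) \<Longrightarrow> emits q pos ys"
  shows "emits (Cond P p q) pos (if P (reads (state pos [])) then xs else ys)"
proof -
  \<comment> \<open>The output head stands on the blank cell behind the output, so what is read does
    not depend on the output.\<close>
  have "reads (state pos out) = reads (state pos [])" for out
    by (auto simp: reads_def layout_def word_contents_def)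
  then have P: "P (reads (state pos out)) = P (reads (state pos []))" for out
    by (rule arg_cong)
  show ?thesis
  proof (cases "P (reads (state pos []))")
    case True
    then have "emits p pos xs" by (rule assms(1))
    then show ?thesis unfolding emits_def using True P by (auto intro!: big_step.Cond_True)
  next
    case False
    then have "emits q pos ys" by (rule assms(2))
    then show ?thesis unfolding emits_def using False P by (auto intro!: big_step.Cond_False)
  qed
qed

abbreviation advance :: "(nat \<Rightarrow> int) \<Rightarrow> (nat \<Rightarrow> head_move) \<Rightarrow> nat \<Rightarrow> nat \<Rightarrow> int" where
  "advance pos v k \<equiv> \<lambda>i. pos i + int k * offset (v i)"

lemma shift_state: "v 1 = Stay \<Longrightarrow> shift v (int k) (state pos out) = state (advance pos v k) out"
  by (auto simp: shift_def layout_def)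

lemma emits_for_loop:
  assumes v: "\<And>i. i \<ge> 11 + d \<Longrightarrow> v i = Stay" "v 1 = Stay"
    and x: "x \<in> {2..8}" "v x = Move_Right" "pos x = 0"
    and body: "\<And>k. k < N \<Longrightarrow> emits p (advance pos v k) (f k)"
  shows "emits (for_loop x v p) pos (concat (map f [0..<N]))"
  unfolding emits_def
proof
  fix out
  show "runs (for_loop x v p) (state pos out) (state pos (out @ concat (map f [0..<N])))"
  proof (rule big_step_for_loop[where \<sigma> = "\<lambda>k. state pos (out @ concat (map f [0..<k]))" and m = N])
    fix k assume "k < N"
    from body[OF this] show "runs p (shift v (int k) (state pos (out @ concat (map f [0..<k]))))
      (shift v (int k) (state pos (out @ concat (map f [0..<Suc k]))))"
      unfolding shift_state[of v, OF v(2)] emits_def by (simp flip: append_assoc)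
  qed (use v x N_ge_2 in \<open>auto simp: layout_def\<close>)
qed

lemma emits_repeat_down:
  assumes x: "x \<in> {2..7}" "pos x = int m" "m < N" "pos 8 = 0"
    and body: "\<And>q. q 6 = pos 6 \<Longrightarrow> q 7 = pos 7 \<Longrightarrow> emits p q xs" and x': "x < 6"
  shows "emits (repeat_down x p) pos (concat (replicate m xs))"
  unfolding emits_def
proof
  fix out
  let ?v = "\<lambda>i. if i = x then Move_Left else if i = 8 then Move_Right else Stay"
  show "runs (repeat_down x p) (state pos out) (state pos (out @ concat (replicate m xs)))"
    unfolding repeat_down_def
  proof (rule big_step_loop[where \<sigma> = "\<lambda>k. state pos (out @ concat (replicate k xs))" and m = m])
    fix k assume "k < m"
    have sh: "shift ?v (int k) (state pos out) = state (advance pos ?v k) out" for out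
      using x by (intro shift_state) auto
    have "concat (replicate (Suc k) xs) = concat (replicate k xs) @ xs"
      by (metis append_Nil2 concat.simps concat_append replicate_Suc replicate_append_same)
    then show "runs p (shift ?v (int k) (state pos (out @ concat (replicate k xs))))
      (shift ?v (int k) (state pos (out @ concat (replicate (Suc k) xs))))"
      using body[of "advance pos ?v k"] x x' unfolding sh by (simp add: emits_def flip: append_assoc)
  qed (use x in \<open>auto simp: layout_def reads_def shift_def ruler_def\<close>)
qed

lemma concat_replicate_replicate: "concat (replicate k (replicate m x)) = replicate (k * m) x"
  by (induction k) (auto simp: replicate_add)

lemma emits_emit_node:
  assumes "t' < N" "j' < N"
  shows "emits (emit_node z) (position t j t' j') (replicate (z * N * N + t' * N + j') True)"
proof -
  let ?p = "position t j t' j'"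
  have pos: "?p 4 = int t'" "?p 5 = int j'" "?p 6 = 0" "?p 7 = 0" "?p 8 = 0"
    by (auto simp: position_def t_moves_def j_moves_def t'_moves_def j'_moves_def along_def)
  have 7: "emits (for_loop 7 (along {7} Move_Right) (emit True)) q (replicate N True)" if "q 7 = 0" for q
    using emits_for_loop[of "along {7} Move_Right" 7 q "emit True" "\<lambda>_. [True]"] that emits_emit
    by (simp add: along_def map_replicate_const)
  have 6: "emits (for_loop 6 (along {6} Move_Right) (emit True)) q (replicate N True)" if "q 6 = 0" for q
    using emits_for_loop[of "along {6} Move_Right" 6 q "emit True" "\<lambda>_. [True]"] that emits_emit
    by (simp add: along_def map_replicate_const)
  have "emits (for_loop 6 (along {6} Move_Right) (for_loop 7 (along {7} Move_Right) (emit True))) ?p (replicate (N * N) True)"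
    using emits_for_loop[of "along {6} Move_Right" 6 ?p "for_loop 7 (along {7} Move_Right) (emit True)" "\<lambda>_. replicate N True"] pos 7
    by (simp add: along_def map_replicate_const concat_replicate_replicate)
  then have A: "emits (seqs (replicate z (for_loop 6 (along {6} Move_Right) (for_loop 7 (along {7} Move_Right) (emit True))))) ?p
      (replicate (z * N * N) True)"
    using emits_replicate[of _ ?p _ z] by (fastforce simp: concat_replicate_replicate mult.assoc)
  have B: "emits (repeat_down 4 (for_loop 6 (along {6} Move_Right) (emit True))) ?p (replicate (t' * N) True)"
    using emits_repeat_down[of 4 ?p t' "for_loop 6 (along {6} Move_Right) (emit True)" "replicate N True"] pos assms 6
    by (simp add: concat_replicate_replicate)
  have C: "emits (repeat_down 5 (emit True)) ?p (replicate j' True)"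
    using emits_repeat_down[of 5 ?p j' "emit True" "[True]"] pos assms emits_emit
    by (simp add: concat_replicate_replicate[of j' 1, simplified])
  show ?thesis
    using emits_Seq[OF A emits_Seq[OF B C]] by (simp add: emit_node_def replicate_add)
qed

lemma view_state: "view (reads (state (position t j t' j') [])) = observe w N t j t' j'"
  by (simp add: view_def observe_def reads_def layout_def position_def t_moves_def j_moves_def
      t'_moves_def j'_moves_def along_def)

lemma emits_emit_lists:
  assumes rk: "\<And>z z' r t j t' j'. z < Z \<Longrightarrow> z' < Z \<Longrightarrow> r < R \<Longrightarrow> t < N \<Longrightarrow> j < N \<Longrightarrow> t' < N \<Longrightarrow> j' < N \<Longrightarrow>
    A z r z' (observe w N t j t' j') \<longleftrightarrow> rk (z * N * N + t * N + j) (z' * N * N + t' * N + j') = r"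
  shows "emits (emit_lists Z R A) (\<lambda>_. 0) (encode_instance (pref_lists (Z * N * N) R rk))"
proof -
  have adv: "(\<lambda>_. 0) = position 0 0 0 0" "advance (position 0 0 0 0) t_moves t = position t 0 0 0"
    "advance (position t 0 0 0) j_moves j = position t j 0 0"
    "advance (position t j 0 0) t'_moves t' = position t j t' 0"
    "advance (position t j t' 0) j'_moves j' = position t j t' j'" for t j t' j'
    by (auto simp: position_def)
  have stay: "v i = Stay" if "v \<in> {t_moves, j_moves, t'_moves, j'_moves}" "i \<ge> 11 + d \<or> i = 1" for v i
    using that by (auto simp: t_moves_def j_moves_def t'_moves_def j'_moves_def along_def)
  have right: "t_moves 2 = Move_Right" "j_moves 3 = Move_Right" "t'_moves 4 = Move_Right" "j'_moves 5 = Move_Right"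
    by (auto simp: t_moves_def j_moves_def t'_moves_def j'_moves_def along_def)
  have zero: "position 0 0 0 0 2 = 0" "position t 0 0 0 3 = 0" "position t j 0 0 4 = 0" "position t j t' 0 5 = 0" for t j t'
    by (auto simp: position_def t_moves_def j_moves_def t'_moves_def j'_moves_def along_def)
  have item: "emits (Cond (\<lambda>rd. A z r z' (view rd)) (emit True ;; emit_node z' ;; emit False) Skip) (position t j t' j')
     (if rk (z * N * N + t * N + j) (z' * N * N + t' * N + j') = r
      then [True] @ replicate (z' * N * N + t' * N + j') True @ [False] else [])"
    if "z < Z" "z' < Z" "r < R" "t < N" "j < N" "t' < N" "j' < N" for z z' r t j t' j'
    using emits_Cond[of "\<lambda>rd. A z r z' (view rd)" "position t j t' j'" "emit True ;; emit_node z' ;; emit False"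
        "[True] @ replicate (z' * N * N + t' * N + j') True @ [False]" Skip "[]"]
      emits_Seq[OF emits_emit emits_Seq[OF emits_emit_node emits_emit]] that
    by (simp only: view_state rk emits_Skip)
  have 5: "emits (for_loop 5 j'_moves p) (position t j t' 0) (concat (map f [0..<N]))"
    if "\<And>j'. j' < N \<Longrightarrow> emits p (position t j t' j') (f j')" for p f t j t'
    using that stay right zero by (intro emits_for_loop) (simp_all add: adv)
  have 4: "emits (for_loop 4 t'_moves p) (position t j 0 0) (concat (map f [0..<N]))"
    if "\<And>t'. t' < N \<Longrightarrow> emits p (position t j t' 0) (f t')" for p f t j
    using that stay right zero by (intro emits_for_loop) (simp_all add: adv)
  have 3: "emits (for_loop 3 j_moves p) (position t 0 0 0) (concat (map f [0..<N]))"
    if "\<And>j. j < N \<Longrightarrow> emits p (position t j 0 0) (f j)" for p f t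
    using that stay right zero by (intro emits_for_loop) (simp_all add: adv)
  have 2: "emits (for_loop 2 t_moves p) (position 0 0 0 0) (concat (map f [0..<N]))"
    if "\<And>t. t < N \<Longrightarrow> emits p (position t 0 0 0) (f t)" for p f
    using that stay right zero by (intro emits_for_loop) (simp_all add: adv)
  show ?thesis
    unfolding encode_pref_lists emit_lists_def adv(1)
    by (intro emits_Seq emits_emit emits_seqs 2 3 4 5 item) auto
qed

end

text \<open>\<open>A\<close> is wired into the machine and is therefore the same for all
  \<open>w\<close>: the ranks have to be recoverable from kinds and observed symbols alone.\<close>

theorem poly_time_pref_lists:
  assumes c: "c \<ge> 2" and d: "d \<ge> 1"
    and rk: "\<And>w z z' r t j t' j'. z < Z \<Longrightarrow> z' < Z \<Longrightarrow> r < R \<Longrightarrow>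
      t < (length w + c) ^ d \<Longrightarrow> j < (length w + c) ^ d \<Longrightarrow> t' < (length w + c) ^ d \<Longrightarrow> j' < (length w + c) ^ d \<Longrightarrow>
      A z r z' (observe w ((length w + c) ^ d) t j t' j') \<longleftrightarrow>
      rk w (z * (length w + c) ^ d * (length w + c) ^ d + t * (length w + c) ^ d + j)
        (z' * (length w + c) ^ d * (length w + c) ^ d + t' * (length w + c) ^ d + j') = r"
  shows "poly_time_computable
    (\<lambda>w. encode_instance (pref_lists (Z * (length w + c) ^ d * (length w + c) ^ d) R (rk w)))"
proof (rule poly_time_computableI)
  fix w :: "bool list"
  interpret writer w c d "(length w + c) ^ d" by standard (use c d in auto)
  let ?out = "encode_instance (pref_lists (Z * (length w + c) ^ d * (length w + c) ^ d) R (rk w))"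
  have "emits (emit_lists Z R A) (\<lambda>_. 0) ?out" by (intro emits_emit_lists rk)
  then have "runs (emit_lists Z R A) (state (\<lambda>_. 0) []) (state (\<lambda>_. 0) ([] @ ?out))"
    unfolding emits_def by blast
  with prologue have "runs (prologue c d ;; emit_lists Z R A) (input_store w) (state (\<lambda>_. 0) ([] @ ?out))"
    by (rule big_step.Seq)
  moreover have "poly ([:c, 1:] ^ d + 1) (length w) = (length w + c) ^ d + 1"
    by (simp add: poly_power add.commute)
  moreover have "fst (state (\<lambda>_. 0) ([] @ ?out) 1) = word_contents ?out" by (simp add: layout_def)
  ultimately show "\<exists>s. big_step (11 + d) (poly ([:c, 1:] ^ d + 1) (length w)) (prologue c d ;; emit_lists Z R A) (input_store w) s
      \<and> fst (s 1) = word_contents ?out" by metis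
qed simp

section \<open>Popular matchings as involutions\<close>

text \<open>A matching is given by the involution exchanging matched nodes; an unmatched node is its own mate.
  The rank \<open>R\<close> stands for "not a neighbour", so that by \<open>rank_self\<close> being unmatched is least preferred.\<close>

locale ranked_graph =
  fixes V :: "'v set" and R :: nat and rank :: "'v \<Rightarrow> 'v \<Rightarrow> nat" and vote :: "'v \<Rightarrow> 'v \<Rightarrow> 'v \<Rightarrow> int"
  assumes finite_V: "finite V"
    and rank_self: "rank x x = R"
    and vote_refl: "vote x y y = 0"
    and vote_less: "rank x y < rank x z \<Longrightarrow> vote x y z = 1"
    and vote_greater: "rank x z < rank x y \<Longrightarrow> vote x y z = -1"
    and vote_ge: "vote x y z \<ge> -1"
begin

definition mating :: "('v \<Rightarrow> 'v) \<Rightarrow> bool" where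
  "mating m \<longleftrightarrow> (\<forall>x\<in>V. m x \<in> V \<and> m (m x) = x \<and> (m x = x \<or> rank x (m x) < R))"

definition gain :: "('v \<Rightarrow> 'v) \<Rightarrow> ('v \<Rightarrow> 'v) \<Rightarrow> int" where
  "gain n m = (\<Sum>x\<in>V. vote x (n x) (m x))"

definition popular_mating :: "('v \<Rightarrow> 'v) \<Rightarrow> bool" where
  "popular_mating m \<longleftrightarrow> mating m \<and> (\<forall>n. mating n \<longrightarrow> gain n m \<le> 0)"

lemma sum_mating: "mating n \<Longrightarrow> (\<Sum>x\<in>V. h (n x)) = (\<Sum>x\<in>V. h x)"
  by (rule sum.reindex_bij_witness[of _ n n]) (auto simp: mating_def)

text \<open>A dual certificate in the sense of linear programming: \<alpha> has total 0 because it
  cancels along \<open>m\<close>, it covers both votes on every edge of \<open>n\<close>, and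
  \<alpha> \<ge> -1 covers the vote lost by a node that \<open>n\<close> leaves alone. Only the
  edges of the given \<open>n\<close> need to be covered, so different rivals may be refuted by
  different potentials.\<close>

lemma gain_nonpos:
  fixes \<alpha> :: "'v \<Rightarrow> int"
  assumes m: "mating m" and n: "mating n"
    and \<alpha>: "\<And>x. x \<in> V \<Longrightarrow> \<alpha> x + \<alpha> (m x) = 0"
    and ge: "\<And>x. x \<in> V \<Longrightarrow> -1 \<le> \<alpha> x"
    and edge: "\<And>x. x \<in> V \<Longrightarrow> n x \<noteq> x \<Longrightarrow>
      vote x (n x) (m x) + vote (n x) x (m (n x)) \<le> \<alpha> x + \<alpha> (n x)"
  shows "gain n m \<le> 0"
proof -
  let ?h = "\<lambda>x. \<alpha> x - vote x (n x) (m x)"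
  have "2 * (\<Sum>x\<in>V. \<alpha> x) = (\<Sum>x\<in>V. \<alpha> x + \<alpha> (m x))"
    by (simp add: sum.distrib sum_mating[OF m])
  then have 0: "(\<Sum>x\<in>V. \<alpha> x) = 0" using \<alpha> by simp
  have single: "vote x x (m x) \<le> \<alpha> x" if "x \<in> V" for x
  proof (cases "m x = x")
    case True
    then show ?thesis using \<alpha>[OF that] by (simp add: vote_refl)
  next
    case False
    then have "rank x (m x) < rank x x" using m that by (auto simp: mating_def rank_self)
    then show ?thesis using vote_greater ge[OF that] by simp
  qed
  have "2 * (\<Sum>x\<in>V. ?h x) = (\<Sum>x\<in>V. ?h x + ?h (n x))"
    by (simp add: sum.distrib sum_mating[OF n, of ?h])
  also have "\<dots> \<ge> 0"
  proof (rule sum_nonneg)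
    fix x assume x: "x \<in> V"
    then have "n (n x) = x" using n by (simp add: mating_def)
    then show "0 \<le> ?h x + ?h (n x)"
      using single[OF x] edge[OF x] by (cases "n x = x") auto
  qed
  finally show ?thesis using 0 by (simp add: gain_def sum_subtractf)
qed

text \<open>Rematching \<open>S\<close> within itself leaves alone those former mates of nodes of
  \<open>S\<close> that lie outside \<open>S\<close>. Each of them costs at most one vote, and all
  other nodes are indifferent.\<close>

lemma exchange:
  assumes m: "popular_mating m" and S: "S \<subseteq> V"
    and e: "\<And>x. x \<in> S \<Longrightarrow> e x \<in> S \<and> e (e x) = x \<and> rank x (e x) < R"
  shows "(\<Sum>x\<in>S. vote x (e x) (m x)) \<le> int (card (m ` S - S))"
proof -
  let ?n = "\<lambda>x. if x \<in> S then e x else if m x \<in> S then x else m x"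
  let ?W = "m ` S - S"
  have mat: "mating m" using m by (simp add: popular_mating_def)
  have "mating ?n"
    using mat S e by (auto simp: mating_def subset_iff)
  then have "gain ?n m \<le> 0" using m by (simp add: popular_mating_def)
  have WV: "?W \<subseteq> V" using mat S by (auto simp: mating_def)
  have fin: "finite S" "finite ?W" using finite_V S WV by (auto intro: finite_subset)
  have W: "x \<in> V \<Longrightarrow> x \<in> ?W \<longleftrightarrow> x \<notin> S \<and> m x \<in> S" for x
    using mat S by (auto simp: mating_def image_iff) (metis subsetD)
  have "gain ?n m = (\<Sum>x\<in>S \<union> ?W. vote x (?n x) (m x))"
    unfolding gain_def using finite_V S WV W
    by (intro sum.mono_neutral_right) (auto simp: vote_refl)
  also have "\<dots> = (\<Sum>x\<in>S. vote x (?n x) (m x)) + (\<Sum>x\<in>?W. vote x (?n x) (m x))"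
    using fin by (intro sum.union_disjoint) auto
  finally have "gain ?n m = (\<Sum>x\<in>S. vote x (e x) (m x)) + (\<Sum>x\<in>?W. vote x (?n x) (m x))" by simp
  moreover have "(\<Sum>x\<in>?W. -1) \<le> (\<Sum>x\<in>?W. vote x (?n x) (m x))"
    by (intro sum_mono vote_ge)
  ultimately have "gain ?n m \<ge> (\<Sum>x\<in>S. vote x (e x) (m x)) - int (card ?W)" by simp
  with \<open>gain ?n m \<le> 0\<close> show ?thesis by simp
qed

end

section \<open>The gadget graph\<close>

text \<open>The nodes \<open>XA, XB, XA', XB'\<close> with arguments \<open>c\<close> and \<open>s\<close> form the 4-cycle for \<open>f c = s\<close>; this label is chosen
  if \<open>XA\<close> is matched to \<open>XB'\<close>. The path for \<open>f c\<close> starts at the node \<open>XS\<close>, runs through the edges \<open>XA-XB\<close> of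
  all labels, and ends with \<open>XP-XQ\<close>. Analogously for \<open>g c\<close>, where a label is chosen if \<open>YA\<close> is matched to \<open>YB\<close>
  and the path runs through \<open>YP-YQ\<close> and then the edges \<open>YA-YB'\<close>. Nodes whose arguments have no meaning (such as
  \<open>D1\<close> away from \<open>o1\<close>) are isolated.\<close>

datatype role = XA | XB | XA' | XB' | XS | XP | XQ | YA | YB | YA' | YB' | YS | YP | YQ
  | D0 | D1 | D2 | D3

type_synonym 'c vertex = "role \<times> 'c \<times> nat"

text \<open>In each 4-cycle one stable matching pleases the A nodes and the other the B nodes. The
  \<open>conf\<close> edges have rank 1, between the ranks 0 and 2 of the two possible mates of
  \<open>XA\<close> and of \<open>YB\<close>. A path edge between consecutive labels is, for one
  end, better than the mate of an unchosen label, and for the other end worse than both possible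
  mates; rerouting past an unchosen label is therefore neutral. \<open>D0\<close> is the last choice
  of its outer neighbours, while it ranks all of them first. Rank 5 lies above all ranks in use and
  means non-adjacent.\<close>

fun gadget_rank ::
    "'c \<Rightarrow> nat \<Rightarrow> ('c \<Rightarrow> nat \<Rightarrow> 'c \<Rightarrow> nat \<Rightarrow> bool) \<Rightarrow> 'c vertex \<Rightarrow> 'c vertex \<Rightarrow> nat" where
  "gadget_rank o1 L conf (XA, c, s) (\<rho>, c', s') =
     (if \<rho> = XB \<and> c' = c \<and> s' = s then 0
      else if \<rho> = XB \<and> c' = c \<and> s = Suc s' then 3
      else if \<rho> = YB \<and> conf c' s' c s then 1
      else if \<rho> = XB' \<and> c' = c \<and> s' = s then 2
      else if \<rho> = XS \<and> c' = c \<and> s = 0 \<and> s' = 0 then 3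
      else if \<rho> = D0 \<and> c' = o1 \<and> s' = 0 then 4
      else 5)"
| "gadget_rank o1 L conf (XB, c, s) (\<rho>, c', s') =
     (if \<rho> = XA' \<and> c' = c \<and> s' = s then 0
      else if \<rho> = XA \<and> c' = c \<and> s' = s then 2
      else if \<rho> = XA \<and> c' = c \<and> s' = Suc s then 1
      else if \<rho> = XP \<and> c' = c \<and> s' = 0 \<and> Suc s = L then 1
      else 5)"
| "gadget_rank o1 L conf (XA', c, s) (\<rho>, c', s') =
     (if \<rho> = XB' \<and> c' = c \<and> s' = s then 0
      else if \<rho> = XB \<and> c' = c \<and> s' = s then 1
      else if \<rho> = D0 \<and> c' = o1 \<and> s' = 0 then 2
      else 5)"
| "gadget_rank o1 L conf (XB', c, s) (\<rho>, c', s') =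
     (if \<rho> = XA \<and> c' = c \<and> s' = s then 0
      else if \<rho> = XA' \<and> c' = c \<and> s' = s then 1
      else 5)"
| "gadget_rank o1 L conf (XS, c, s) (\<rho>, c', s') =
     (if \<rho> = XA \<and> c' = c \<and> s = 0 \<and> s' = 0 then 0
      else 5)"
| "gadget_rank o1 L conf (XP, c, s) (\<rho>, c', s') =
     (if \<rho> = XQ \<and> c' = c \<and> s = 0 \<and> s' = 0 then 0
      else if \<rho> = XB \<and> c' = c \<and> s = 0 \<and> Suc s' = L then 1
      else if \<rho> = D0 \<and> s = 0 \<and> c' = o1 \<and> s' = 0 then 2
      else 5)"
| "gadget_rank o1 L conf (XQ, c, s) (\<rho>, c', s') =
     (if \<rho> = XP \<and> c' = c \<and> s = 0 \<and> s' = 0 then 0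
      else if \<rho> = D0 \<and> s = 0 \<and> c' = o1 \<and> s' = 0 then 1
      else 5)"
| "gadget_rank o1 L conf (YA, c, s) (\<rho>, c', s') =
     (if \<rho> = YB \<and> c' = c \<and> s' = s then 0
      else if \<rho> = YB' \<and> c' = c \<and> s' = s then 2
      else if \<rho> = YB' \<and> c' = c \<and> s = Suc s' then 1
      else if \<rho> = YQ \<and> c' = c \<and> s = 0 \<and> s' = 0 then 1
      else if \<rho> = D0 \<and> c' = o1 \<and> s' = 0 then 3
      else 5)"
| "gadget_rank o1 L conf (YB, c, s) (\<rho>, c', s') =
     (if \<rho> = YA' \<and> c' = c \<and> s' = s then 0
      else if \<rho> = XA \<and> conf c s c' s' then 1
      else if \<rho> = YA \<and> c' = c \<and> s' = s then 2
      else 5)"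
| "gadget_rank o1 L conf (YA', c, s) (\<rho>, c', s') =
     (if \<rho> = YB' \<and> c' = c \<and> s' = s then 0
      else if \<rho> = YB \<and> c' = c \<and> s' = s then 1
      else if \<rho> = D0 \<and> c' = o1 \<and> s' = 0 then 2
      else 5)"
| "gadget_rank o1 L conf (YB', c, s) (\<rho>, c', s') =
     (if \<rho> = YA \<and> c' = c \<and> s' = s then 0
      else if \<rho> = YA \<and> c' = c \<and> s' = Suc s then 2
      else if \<rho> = YA' \<and> c' = c \<and> s' = s then 1
      else if \<rho> = D0 \<and> Suc s = L \<and> c' = o1 \<and> s' = 0 then 3
      else 5)"
| "gadget_rank o1 L conf (YS, c, s) (\<rho>, c', s') =
     (if \<rho> = YP \<and> c' = c \<and> s = 0 \<and> s' = 0 then 0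
      else 5)"
| "gadget_rank o1 L conf (YP, c, s) (\<rho>, c', s') =
     (if \<rho> = YQ \<and> c' = c \<and> s = 0 \<and> s' = 0 then 0
      else if \<rho> = YS \<and> c' = c \<and> s = 0 \<and> s' = 0 then 1
      else if \<rho> = D0 \<and> s = 0 \<and> c' = o1 \<and> s' = 0 then 2
      else 5)"
| "gadget_rank o1 L conf (YQ, c, s) (\<rho>, c', s') =
     (if \<rho> = YP \<and> c' = c \<and> s = 0 \<and> s' = 0 then 0
      else if \<rho> = YA \<and> c' = c \<and> s = 0 \<and> s' = 0 then 1
      else 5)"
| "gadget_rank o1 L conf (D0, c, s) (\<rho>, c', s') =
     (if c = o1 \<and> s = 0 then
        if \<rho> \<in> {XA, XA', YA, YA'} then 0
        else if \<rho> \<in> {XP, XQ, YP} \<and> s' = 0 then 0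
        else if \<rho> = YB' \<and> Suc s' = L then 0
        else if \<rho> = D1 \<and> c' = o1 \<and> s' = 0 then 1
        else if \<rho> = D2 \<and> c' = o1 \<and> s' = 0 then 2
        else if \<rho> = D3 \<and> c' = o1 \<and> s' = 0 then 3
        else 5
      else 5)"
| "gadget_rank o1 L conf (D1, c, s) (\<rho>, c', s') =
     (if c = o1 \<and> s = 0 \<and> c' = o1 \<and> s' = 0 then
        if \<rho> = D2 then 0 else if \<rho> = D3 then 1 else if \<rho> = D0 then 2 else 5
      else 5)"
| "gadget_rank o1 L conf (D2, c, s) (\<rho>, c', s') =
     (if c = o1 \<and> s = 0 \<and> c' = o1 \<and> s' = 0 then
        if \<rho> = D3 then 0 else if \<rho> = D1 then 1 else if \<rho> = D0 then 2 else 5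
      else 5)"
| "gadget_rank o1 L conf (D3, c, s) (\<rho>, c', s') =
     (if c = o1 \<and> s = 0 \<and> c' = o1 \<and> s' = 0 then
        if \<rho> = D1 then 0 else if \<rho> = D2 then 1 else if \<rho> = D0 then 2 else 5
      else 5)"

declare gadget_rank.simps [simp del]

lemma gadget_rank_self: "gadget_rank o1 L conf x x = 5"
proof -
  obtain \<rho> c s where "x = (\<rho>, c, s)" by (cases x) auto
  then show ?thesis by (cases \<rho>) (simp_all add: gadget_rank.simps)
qed

lemma gadget_rank_sym:
  assumes "gadget_rank o1 L conf x y < 5"
  shows "gadget_rank o1 L conf y x < 5"
proof -
  obtain \<rho> c s \<rho>' c' s' where x: "x = (\<rho>, c, s)" "y = (\<rho>', c', s')"
    by (metis prod_cases3)
  show ?thesis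
    using assms unfolding x
    by (cases \<rho>; auto simp: gadget_rank.simps split: if_splits)
qed

locale gadget =
  fixes C :: "'c set" and o1 :: 'c and L :: nat and conf :: "'c \<Rightarrow> nat \<Rightarrow> 'c \<Rightarrow> nat \<Rightarrow> bool"
    and vote :: "'c vertex \<Rightarrow> 'c vertex \<Rightarrow> 'c vertex \<Rightarrow> int"
  assumes finite_C: "finite C" and o1: "o1 \<in> C" and L: "L > 0"
    and vote_refl: "vote x y y = 0"
    and vote_less: "gadget_rank o1 L conf x y < gadget_rank o1 L conf x z \<Longrightarrow> vote x y z = 1"
    and vote_greater: "gadget_rank o1 L conf x z < gadget_rank o1 L conf x y \<Longrightarrow> vote x y z = -1"
    and vote_ge: "vote x y z \<ge> -1"
begin

abbreviation "rank \<equiv> gadget_rank o1 L conf"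
abbreviation "nodes \<equiv> (UNIV :: role set) \<times> C \<times> {..<L}"

lemma UNIV_role: "UNIV = {XA, XB, XA', XB', XS, XP, XQ, YA, YB, YA', YB', YS, YP, YQ, D0, D1, D2, D3}"
  by (auto intro: role.exhaust)

sublocale ranked_graph nodes 5 rank vote
proof
  have "finite (UNIV :: role set)" unfolding UNIV_role by simp
  then show "finite nodes" using finite_C by (intro finite_cartesian_product) simp_all
qed (auto intro: gadget_rank_self vote_refl vote_less vote_greater vote_ge)

abbreviation "d0 \<equiv> (D0, o1, 0 :: nat)"
abbreviation "d1 \<equiv> (D1, o1, 0 :: nat)"
abbreviation "d2 \<equiv> (D2, o1, 0 :: nat)"
abbreviation "d3 \<equiv> (D3, o1, 0 :: nat)"

subsection \<open>From a popular matching to a choice of labels\<close>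

context
  fixes m :: "'c vertex \<Rightarrow> 'c vertex"
  assumes pop: "popular_mating m"
begin

lemma mate_in: "x \<in> nodes \<Longrightarrow> m x \<in> nodes"
  and mate_mate: "x \<in> nodes \<Longrightarrow> m (m x) = x"
  and mate_rank: "x \<in> nodes \<Longrightarrow> m x \<noteq> x \<Longrightarrow> rank x (m x) < 5"
  using pop unfolding popular_mating_def mating_def by auto

lemma d_in: "(\<rho>, o1, 0) \<in> nodes"
  using o1 L by simp

text \<open>Two nodes would gain, and only one former mate at most would be abandoned.\<close>

lemma pair_exchange:
  assumes xy: "x \<in> nodes" "y \<in> nodes" "rank x y < rank x (m x)" "rank y x < rank y (m y)"
    and one: "m x = x \<or> m y = y"
  shows False
proof -
  have le: "rank u v \<le> 5" if "u \<in> nodes" "v = m u" for u v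
    using mate_rank[OF that(1)] that rank_self[of u] by (cases "m u = u") auto
  have ne: "x \<noteq> y" using xy(3) le[OF xy(1) refl] rank_self[of x] by auto
  have "(\<Sum>z\<in>{x, y}. vote z (if z = x then y else x) (m z)) \<le> int (card (m ` {x, y} - {x, y}))"
    using xy le[OF xy(1) refl] le[OF xy(2) refl] ne
    by (intro exchange[OF pop]) auto
  moreover have "(\<Sum>z\<in>{x, y}. vote z (if z = x then y else x) (m z)) = 2"
    using ne vote_less[OF xy(3)] vote_less[OF xy(4)] by simp
  moreover have "card (m ` {x, y} - {x, y}) \<le> 1"
  proof -
    have "m ` {x, y} - {x, y} \<subseteq> {m x} \<or> m ` {x, y} - {x, y} \<subseteq> {m y}" using one by auto
    then show ?thesis by (metis card_mono card.empty card_insert_disjoint empty_iff finite.emptyI finite.insertI One_nat_def)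
  qed
  ultimately show False by linarith
qed

lemma rank_le: "x \<in> nodes \<Longrightarrow> rank x (m x) \<le> 5"
  using mate_rank[of x] rank_self[of x] by (cases "m x = x") auto

section \<open>The core gadget of \<open>D0\<close>, \<open>D1\<close>, \<open>D2\<close>,
  \<open>D3\<close>\<close>

lemma D_neighbour:
  assumes "rank (\<rho>, o1, 0) y < 5" "\<rho> \<in> {D1, D2, D3}"
  shows "y \<in> {d0, d1, d2, d3} - {(\<rho>, o1, 0)}"
proof -
  obtain \<rho>' c' s' where y: "y = (\<rho>', c', s')" by (cases y) auto
  show ?thesis using assms unfolding y
    by (cases \<rho>'; auto simp: gadget_rank.simps split: if_splits)
qed

lemma D_rank [simp]:
  "rank d1 d2 = 0" "rank d1 d3 = 1" "rank d1 d0 = 2" "rank d2 d3 = 0" "rank d2 d1 = 1" "rank d2 d0 = 2"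
  "rank d3 d1 = 0" "rank d3 d2 = 1" "rank d3 d0 = 2" "rank d0 d1 = 1" "rank d0 d2 = 2" "rank d0 d3 = 3"
  by (simp_all add: gadget_rank.simps)

text \<open>If one of \<open>D1\<close>, \<open>D2\<close>, \<open>D3\<close> were unmatched, it and
  the node that ranks it first would contradict \<open>pair_exchange\<close>. So all three are
  matched, among themselves or to \<open>D0\<close>; since three is odd, exactly one of them has
  \<open>D0\<close>.\<close>

lemma D_matched:
  obtains x y z where "m d0 = x" "m x = d0" "m y = z" "m z = y"
    "(x, y, z) \<in> {(d1, d2, d3), (d2, d3, d1), (d3, d1, d2)}"
proof -
  have n: "m (\<rho>, o1, 0) \<in> {d0, d1, d2, d3}" if "\<rho> \<in> {D1, D2, D3}" for \<rho>
    using mate_rank[of "(\<rho>, o1, 0)"] D_neighbour[of \<rho> "m (\<rho>, o1, 0)"] that o1 L by (cases "m (\<rho>, o1, 0) = (\<rho>, o1, 0)") auto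
  have self [simp]: "rank x x = 5" for x by (rule rank_self)
  have mm: "m (m (\<rho>, o1, 0)) = (\<rho>, o1, 0)" for \<rho> by (rule mate_mate) (use o1 L in simp)
  have inn: "d1 \<in> nodes" "d2 \<in> nodes" "d3 \<in> nodes" by (rule d_in)+
  note n = n[of D1, simplified] n[of D2, simplified] n[of D3, simplified]
  note mm = mm[of D0] mm[of D1] mm[of D2] mm[of D3]
  have 12: "m d1 = d2 \<or> m d2 = d3" if "m d1 = d1 \<or> m d2 = d2"
    using pair_exchange[OF inn(1,2) _ _ that] n(1,2) mm by auto
  have 23: "m d2 = d3 \<or> m d3 = d1" if "m d2 = d2 \<or> m d3 = d3"
    using pair_exchange[OF inn(2,3) _ _ that] n(2,3) mm by auto
  have 31: "m d3 = d1 \<or> m d1 = d2" if "m d3 = d3 \<or> m d1 = d1"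
    using pair_exchange[OF inn(3,1) _ _ that] n(3,1) mm by auto
  have "m d1 = d0 \<and> m d2 = d3 \<or> m d2 = d0 \<and> m d3 = d1 \<or> m d3 = d0 \<and> m d1 = d2"
    using n(1)
  proof (elim disjE)
    assume "m d1 = d0"
    then show ?thesis using n(2,3) mm 12 23 31 by auto
  next
    assume "m d1 = d1"
    then show ?thesis using n(2,3) mm 12 23 31 by auto
  next
    assume "m d1 = d2"
    then show ?thesis using n(2,3) mm 12 23 31 by auto
  next
    assume "m d1 = d3"
    then show ?thesis using n(2,3) mm 12 23 31 by auto
  qed
  then show ?thesis
    using that[of d1 d2 d3] that[of d2 d3 d1] that[of d3 d1 d2] mm by auto
qed

text \<open>In each of the three cases above \<open>x\<close> and \<open>z\<close> block the matching. Freeing \<open>D0\<close> for another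
  neighbour \<open>v\<close> and pairing up \<open>x\<close> and \<open>z\<close> therefore wins two votes.\<close>

lemma boosted_exchange:
  assumes S: "S \<subseteq> nodes" "\<And>y. y \<in> S \<Longrightarrow> fst y \<notin> {D0, D1, D2, D3}"
    and v: "v \<in> S" "rank d0 v = 0" "e v = d0"
    and e: "\<And>x. x \<in> S \<Longrightarrow> x \<noteq> v \<Longrightarrow> e x \<in> S \<and> e x \<noteq> v \<and> e (e x) = x \<and> rank x (e x) < 5"
  shows "(\<Sum>x\<in>S. vote x (e x) (m x)) + 2 \<le> int (card (m ` S - S))"
proof -
  obtain x y z where D: "m d0 = x" "m x = d0" "m y = z" "m z = y"
    "(x, y, z) \<in> {(d1, d2, d3), (d2, d3, d1), (d3, d1, d2)}" by (rule D_matched)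
  have inn: "x \<in> nodes" "y \<in> nodes" "z \<in> nodes" using D(5) d_in by auto
  have ranks: "rank x z < rank x d0" "rank z x < rank z y" "rank x z < 5" "rank z x < 5" "0 < rank d0 x"
    using D(5) by auto
  have notS: "x \<notin> S" "y \<notin> S" "z \<notin> S" "d0 \<notin> S" using S(2) D(5) by force+
  have dist: "x \<noteq> z" "x \<noteq> d0" "z \<noteq> d0" using D(5) by auto
  let ?T = "S \<union> {d0, x, z}"
  let ?e = "\<lambda>u. if u = d0 then v else if u = x then z else if u = z then x else e u"
  have rv: "rank v d0 < 5" using gadget_rank_sym[of o1 L conf d0 v] v by simp
  have "(\<Sum>u\<in>?T. vote u (?e u) (m u)) \<le> int (card (m ` ?T - ?T))"
  proof (rule exchange[OF pop])
    show "?T \<subseteq> nodes" using S(1) inn d_in by blast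
    fix u assume u: "u \<in> ?T"
    show "?e u \<in> ?T \<and> ?e (?e u) = u \<and> rank u (?e u) < 5"
    proof (cases "u \<in> S")
      case True
      then have "u \<noteq> d0" "u \<noteq> x" "u \<noteq> z" using notS by auto
      show ?thesis
      proof (cases "u = v")
        case True
        then show ?thesis using v rv notS \<open>u \<noteq> d0\<close> \<open>u \<noteq> x\<close> \<open>u \<noteq> z\<close> by auto
      next
        case False
        with e[OF \<open>u \<in> S\<close>] have "e u \<in> S" "e (e u) = u" "rank u (e u) < 5" by auto
        moreover from \<open>e u \<in> S\<close> have "e u \<noteq> d0" "e u \<noteq> x" "e u \<noteq> z" using notS by auto
        ultimately show ?thesis using \<open>u \<noteq> d0\<close> \<open>u \<noteq> x\<close> \<open>u \<noteq> z\<close> by auto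
      qed
    next
      case False
      then show ?thesis using u v dist ranks notS by auto
    qed
  qed
  moreover have "(\<Sum>u\<in>?T. vote u (?e u) (m u)) = (\<Sum>u\<in>S. vote u (e u) (m u)) + 3"
  proof -
    have finS: "finite S" using S(1) finite_V by (rule finite_subset)
    have "(\<Sum>u\<in>?T. vote u (?e u) (m u)) = (\<Sum>u\<in>S. vote u (?e u) (m u)) + (\<Sum>u\<in>{d0, x, z}. vote u (?e u) (m u))"
      using finS notS by (intro sum.union_disjoint) auto
    also have "(\<Sum>u\<in>S. vote u (?e u) (m u)) = (\<Sum>u\<in>S. vote u (e u) (m u))"
      using notS by (intro sum.cong) auto
    also have "(\<Sum>u\<in>{d0, x, z}. vote u (?e u) (m u)) = vote d0 v x + vote x z d0 + vote z x y"
      using dist D by auto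
    also have "\<dots> = 3" using ranks v by (simp add: vote_less)
    finally show ?thesis .
  qed
  \<comment> \<open>\<open>y\<close>, the former mate of \<open>z\<close>, is the only additional
    node that is abandoned. This reduces the three votes won by \<open>D0\<close>, \<open>x\<close>
    and \<open>z\<close> to a net gain of two.\<close>
  moreover have "card (m ` ?T - ?T) \<le> card (m ` S - S) + 1"
  proof -
    have "m ` ?T - ?T \<subseteq> insert y (m ` S - S)" using D by auto
    moreover have "finite (m ` S - S)" using S(1) finite_V by (meson finite_Diff finite_imageI finite_subset)
    ultimately have "card (m ` ?T - ?T) \<le> card (insert y (m ` S - S))" by (intro card_mono) auto
    also have "\<dots> \<le> card (m ` S - S) + 1" using \<open>finite (m ` S - S)\<close> by (simp add: card_insert_if)
    finally show ?thesis .
  qed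
  ultimately show ?thesis by linarith
qed

text \<open>Joining \<open>D0\<close> would win the vote of the node itself on top of the two votes
  of the boost, and the node has no former mate to abandon. This is the purpose of the many edges at
  \<open>D0\<close>.\<close>

lemma adjacent_matched:
  assumes "x \<in> nodes" "rank d0 x = 0"
  shows "m x \<noteq> x"
proof
  assume x: "m x = x"
  have "fst x \<notin> {D0, D1, D2, D3}" using assms(2) by (cases x) (auto simp: gadget_rank.simps split: if_splits)
  then have "(\<Sum>u\<in>{x}. vote u d0 (m u)) + 2 \<le> int (card (m ` {x} - {x}))"
    using assms by (intro boosted_exchange[where v = x]) auto
  moreover have "vote x d0 x = 1"
    using gadget_rank_sym[of o1 L conf d0 x] assms(2) by (intro vote_less) (simp add: gadget_rank_self)
  ultimately show False using x by simp
qed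

lemma mate_d0: "m d0 \<in> {d1, d2, d3}"
  by (rule D_matched) auto

lemma mate_not_d0:
  assumes "x \<in> nodes" "fst x \<notin> {D1, D2, D3}"
  shows "m x \<noteq> d0"
proof
  assume "m x = d0"
  then have "m d0 = x" using mate_mate[OF assms(1)] by simp
  with mate_d0 assms(2) show False by auto
qed

text \<open>When such a node leaves its mate for another neighbour, the deserted mate can be handed
  to \<open>D0\<close>.\<close>

lemma inner_neighbour:
  assumes "rank y z < 5" "fst y \<in> {XB, XB', XQ, YB, YB', YQ}"
  shows "z = d0 \<or> rank d0 z = 0"
proof -
  obtain \<rho> c s \<rho>' c' s' where "y = (\<rho>, c, s)" "z = (\<rho>', c', s')" by (metis prod_cases3)
  then show ?thesis using assms by (cases \<rho>) (auto simp: gadget_rank.simps split: if_splits)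
qed

text \<open>If \<open>y\<close> is matched, then pairing \<open>x\<close> with \<open>y\<close> and
  handing the former mate of \<open>y\<close> to \<open>D0\<close> wins the votes of
  \<open>x\<close> and \<open>y\<close> and the two votes of the boost. At most one vote is lost at
  the former mate of \<open>y\<close> and at most one at that of \<open>x\<close>.\<close>

lemma no_blocking:
  assumes xy: "x \<in> nodes" "y \<in> nodes" "rank x y < rank x (m x)" "rank y x < rank y (m y)"
    and y: "fst y \<in> {XB, XB', XQ, YB, YB', YQ}" and x: "x \<noteq> d0"
  shows False
proof (cases "m y = y")
  case True
  then show False using pair_exchange xy by blast
next
  case False
  let ?z = "m y"
  have z: "?z \<in> nodes" "m ?z = y" using mate_in mate_mate xy by auto
  have lt: "rank x y < 5" "rank y x < 5"
    using rank_le[OF xy(1)] rank_le[OF xy(2)] xy(3,4) by auto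
  have "rank d0 x = 0" using inner_neighbour[OF lt(2) y] x by simp
  have "?z \<noteq> d0" using mate_not_d0[OF xy(2)] y by auto
  then have z0: "rank d0 ?z = 0" using inner_neighbour[OF mate_rank[OF xy(2) False] y] by simp
  have dist: "x \<noteq> y" "x \<noteq> ?z" "?z \<noteq> y" using xy(4) lt False gadget_rank_self[of o1 L conf x] by auto
  have notD: "fst u \<notin> {D0, D1, D2, D3}" if "rank d0 u = 0" for u
    using that by (cases u) (auto simp: gadget_rank.simps split: if_splits)
  let ?e = "\<lambda>u. if u = x then y else if u = y then x else d0"
  have "(\<Sum>u\<in>{x, y, ?z}. vote u (?e u) (m u)) + 2 \<le> int (card (m ` {x, y, ?z} - {x, y, ?z}))"
  proof (rule boosted_exchange[where v = ?z])
    show "fst u \<notin> {D0, D1, D2, D3}" if "u \<in> {x, y, ?z}" for u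
      using that notD[OF z0] notD[OF \<open>rank d0 x = 0\<close>] y by (elim insertE) auto
  qed (use xy z z0 dist lt in auto)
  moreover have "(\<Sum>u\<in>{x, y, ?z}. vote u (?e u) (m u)) \<ge> 1"
    using dist vote_less[OF xy(3)] vote_less[OF xy(4)] vote_ge[of ?z d0 y] z(2) by simp
  moreover have "card (m ` {x, y, ?z} - {x, y, ?z}) \<le> 1"
  proof -
    have "m ` {x, y, ?z} - {x, y, ?z} \<subseteq> {m x}" using z by auto
    then have "card (m ` {x, y, ?z} - {x, y, ?z}) \<le> card {m x}" by (intro card_mono) auto
    then show ?thesis by simp
  qed
  ultimately show False by linarith
qed

lemma no_blocking_favourite:
  assumes "x \<in> nodes" "y \<in> nodes" "rank x y < rank x (m x)" "rank y x = 0" "m y \<noteq> x"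
    and "fst y \<in> {XB, XB', XQ, YB, YB', YQ}" "x \<noteq> d0"
  shows False
proof (rule no_blocking[of x y])
  have "rank y z = 0 \<Longrightarrow> z = x" for z
    using assms(4,6) by (cases x; cases y; cases z) (auto simp: gadget_rank.simps split: if_splits)
  then show "rank y x < rank y (m y)" using assms(4,5) by fastforce
qed (use assms in auto)

section \<open>Mates within the paths and 4-cycles\<close>

lemma mate_YP:
  assumes "c \<in> C"
  shows "m (YP, c, 0) = (YQ, c, 0)"
proof (rule ccontr)
  assume ne: "m (YP, c, 0) \<noteq> (YQ, c, 0)"
  have inn: "(YP, c, 0) \<in> nodes" "(YQ, c, 0) \<in> nodes" using assms L by auto
  have "rank (YP, c, 0) (m (YP, c, 0)) \<noteq> 0"
    using ne by (cases "m (YP, c, 0)") (auto simp: gadget_rank.simps split: if_splits)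
  moreover have "m (YQ, c, 0) \<noteq> (YP, c, 0)" using ne mate_mate[OF inn(2)] by metis
  ultimately show False
    using no_blocking_favourite[OF inn] by (auto simp: gadget_rank.simps)
qed

lemma mate_YA':
  assumes "c \<in> C" "s < L"
  shows "m (YA', c, s) \<in> {(YB', c, s), (YB, c, s)}"
proof -
  have inn: "(YA', c, s) \<in> nodes" using assms by auto
  have "rank d0 (YA', c, s) = 0" by (simp add: gadget_rank.simps)
  from mate_rank[OF inn adjacent_matched[OF inn this]] mate_not_d0[OF inn]
  show ?thesis by (cases "m (YA', c, s)") (auto simp: gadget_rank.simps split: if_splits)
qed

lemma mate_YA:
  assumes "c \<in> C" "s < L"
  shows "m (YA, c, s) \<in> {(YB, c, s), (YB', c, s)}"
proof -
  have inn: "(YA, c, s) \<in> nodes" using assms by auto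
  have "rank d0 (YA, c, s) = 0" by (simp add: gadget_rank.simps)
  note lt = mate_rank[OF inn adjacent_matched[OF inn this]]
  have nQ: "m (YA, c, s) \<noteq> (YQ, c, 0)"
    using mate_YP[OF assms(1)] mate_mate[OF inn] mate_mate[of "(YP, c, 0)"] assms L by auto
  have nprev: "m (YA, c, s) \<noteq> (YB', c, s')" if s': "s = Suc s'" for s'
  proof
    assume a: "m (YA, c, s) = (YB', c, s')"
    then have b: "m (YB', c, s') = (YA, c, s)" using mate_mate[OF inn] by simp
    \<comment> \<open>With \<open>YB'\<close> of the previous label taken, its \<open>YA'\<close> is
      left with \<open>YB\<close>. These \<open>YA'\<close> and \<open>YB'\<close> then block,
      because \<open>YB'\<close> ranks the \<open>YA\<close> of the next label last among the A
      nodes.\<close>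
    have inn': "(YA', c, s') \<in> nodes" "(YB', c, s') \<in> nodes" using assms s' by auto
    have "m (YA', c, s') \<noteq> (YB', c, s')" using b mate_mate[OF inn'(1)] by auto
    then have "m (YA', c, s') = (YB, c, s')" using mate_YA'[of c s'] assms s' by auto
    then show False using no_blocking[OF inn'] b s' by (simp add: gadget_rank.simps)
  qed
  from lt nQ nprev mate_not_d0[OF inn]
  show ?thesis by (cases "m (YA, c, s)") (auto simp: gadget_rank.simps split: if_splits)
qed

lemma mate_YB:
  assumes "c \<in> C" "s < L"
  shows "m (YB, c, s) \<in> {(YA, c, s), (YA', c, s)}"
proof -
  have "m (YA, c, s) = (YB, c, s) \<or> m (YA', c, s) = (YB, c, s)"
    using mate_YA[OF assms] mate_YA'[OF assms] mate_mate[of "(YA, c, s)"] mate_mate[of "(YA', c, s)"] assms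
    by (auto dest: sym)
  then show ?thesis using mate_mate[of "(YA, c, s)"] mate_mate[of "(YA', c, s)"] assms by auto
qed

text \<open>The Y side is settled beforehand, so no \<open>conf\<close> edge can belong to the
  matching. A mate of rank 3 is excluded because \<open>XB'\<close> ranks its own \<open>XA\<close>
  first and would block with it.\<close>

lemma mate_XA:
  assumes "c \<in> C" "s < L"
  shows "m (XA, c, s) \<in> {(XB, c, s), (XB', c, s)}"
proof -
  have inn: "(XA, c, s) \<in> nodes" "(XB', c, s) \<in> nodes" using assms by auto
  have "rank d0 (XA, c, s) = 0" by (simp add: gadget_rank.simps)
  note mt = adjacent_matched[OF inn(1) this]
  note lt = mate_rank[OF inn(1) mt]
  have nY: "m (XA, c, s) \<noteq> (YB, c', s')" if "(YB, c', s') \<in> nodes" for c' s'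
    using mate_YB[of c' s'] mate_mate[OF inn(1)] that by auto
  have n3: "rank (XA, c, s) (m (XA, c, s)) \<noteq> 3"
  proof
    assume r: "rank (XA, c, s) (m (XA, c, s)) = 3"
    then have "m (XA, c, s) \<noteq> (XB', c, s)" by (auto simp: gadget_rank.simps)
    then have "m (XB', c, s) \<noteq> (XA, c, s)" using mate_mate[OF inn(2)] by auto
    then show False using no_blocking_favourite[OF inn] r by (simp add: gadget_rank.simps)
  qed
  from lt n3 nY mate_in[OF inn(1)] mate_not_d0[OF inn(1)]
  show ?thesis by (cases "m (XA, c, s)") (auto simp: gadget_rank.simps split: if_splits)
qed

lemma mate_XP:
  assumes "c \<in> C"
  shows "m (XP, c, 0) = (XQ, c, 0)"
proof (rule ccontr)
  assume ne: "m (XP, c, 0) \<noteq> (XQ, c, 0)"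
  have inn: "(XP, c, 0) \<in> nodes" "(XQ, c, 0) \<in> nodes" using assms L by auto
  have "rank (XP, c, 0) (m (XP, c, 0)) \<noteq> 0"
    using ne by (cases "m (XP, c, 0)") (auto simp: gadget_rank.simps split: if_splits)
  moreover have "m (XQ, c, 0) \<noteq> (XP, c, 0)" using ne mate_mate[OF inn(2)] by metis
  ultimately show False
    using no_blocking_favourite[OF inn] by (auto simp: gadget_rank.simps)
qed

text \<open>If no label were chosen at \<open>c\<close>, switching along the path through all gadgets of \<open>c\<close>, from the
  unmatched node \<open>XS\<close> to \<open>D0\<close>, would win a vote.\<close>

lemma X_choice:
  assumes c: "c \<in> C"
  shows "\<exists>s<L. m (XA, c, s) = (XB', c, s)"
proof (rule ccontr)
  assume "\<not> ?thesis"
  then have mA: "m (XA, c, s) = (XB, c, s)" if "s < L" for s using mate_XA[OF c that] that by auto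
  have mB: "m (XB, c, s) = (XA, c, s)" if "s < L" for s
    using mA[OF that] mate_mate[of "(XA, c, s)"] c that by auto
  have mP: "m (XP, c, 0) = (XQ, c, 0)" by (rule mate_XP[OF c])
  have mQ: "m (XQ, c, 0) = (XP, c, 0)" using mP mate_mate[of "(XP, c, 0)"] c L by auto
  have mS: "m (XS, c, 0) = (XS, c, 0)"
  proof (rule ccontr)
    assume ne: "m (XS, c, 0) \<noteq> (XS, c, 0)"
    have inn: "(XS, c, 0) \<in> nodes" using c L by auto
    have "m (XS, c, 0) = (XA, c, 0)"
      using mate_rank[OF inn ne] by (cases "m (XS, c, 0)") (auto simp: gadget_rank.simps split: if_splits)
    then show False using mate_mate[OF inn] mA[OF L] by auto
  qed
  define e :: "'c vertex \<Rightarrow> 'c vertex" where "e = (\<lambda>(\<rho>, _, s).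
    if \<rho> = XS then (XA, c, 0)
    else if \<rho> = XA then if s = 0 then (XS, c, 0) else (XB, c, s - 1)
    else if \<rho> = XB then if Suc s < L then (XA, c, Suc s) else (XP, c, 0)
    else if \<rho> = XP then (XB, c, L - 1) else d0)"
  let ?A = "(\<lambda>s. (XA, c, s)) ` {..<L}" and ?B = "(\<lambda>s. (XB, c, s)) ` {..<L}"
  let ?S = "{(XS, c, 0), (XP, c, 0), (XQ, c, 0)} \<union> (?A \<union> ?B)"
  have 1: "(\<Sum>u\<in>?S. vote u (e u) (m u)) + 2 \<le> int (card (m ` ?S - ?S))"
  proof (rule boosted_exchange[where v = "(XQ, c, 0)"])
    show "e u \<in> ?S \<and> e u \<noteq> (XQ, c, 0) \<and> e (e u) = u \<and> rank u (e u) < 5" if "u \<in> ?S" "u \<noteq> (XQ, c, 0)" for u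
      using that L by (auto simp: e_def gadget_rank.simps image_iff split: if_splits)
  qed (use c L in \<open>auto simp: e_def gadget_rank.simps\<close>)
  have 2: "m ` ?S - ?S = {}" using mA mB mP mQ mS by auto
  \<comment> \<open>\<open>XS\<close> gains, \<open>XP\<close> and \<open>XQ\<close> lose, and for
    each label the loss of \<open>XA\<close> cancels the gain of \<open>XB\<close>. The boost of two
    outweighs the remaining -1.\<close>
  have 3: "(\<Sum>u\<in>?S. vote u (e u) (m u)) = -1"
  proof -
    have "(\<Sum>u\<in>?S. vote u (e u) (m u)) =
        (\<Sum>u\<in>{(XS, c, 0), (XP, c, 0), (XQ, c, 0)}. vote u (e u) (m u)) + (\<Sum>u\<in>?A \<union> ?B. vote u (e u) (m u))"
      by (intro sum.union_disjoint) auto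
    also have "(\<Sum>u\<in>?A \<union> ?B. vote u (e u) (m u)) = (\<Sum>u\<in>?A. vote u (e u) (m u)) + (\<Sum>u\<in>?B. vote u (e u) (m u))"
      by (intro sum.union_disjoint) auto
    also have "(\<Sum>u\<in>?A. vote u (e u) (m u)) = (\<Sum>u\<in>?A. -1)"
      using mA by (intro sum.cong) (auto simp: e_def gadget_rank.simps intro!: vote_greater)
    also have "(\<Sum>u\<in>?B. vote u (e u) (m u)) = (\<Sum>u\<in>?B. 1)"
      using mB by (intro sum.cong) (auto simp: e_def gadget_rank.simps intro!: vote_less)
    finally have "(\<Sum>u\<in>?S. vote u (e u) (m u)) = (\<Sum>u\<in>{(XS, c, 0), (XP, c, 0), (XQ, c, 0)}. vote u (e u) (m u)) +
      ((\<Sum>u\<in>?A. -1) + (\<Sum>u\<in>?B. 1))" .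
    moreover have "card ?A = L" by (subst card_image) (auto simp: inj_on_def)
    moreover have "card ?B = L" by (subst card_image) (auto simp: inj_on_def)
    moreover have "vote (XS, c, 0) (e (XS, c, 0)) (m (XS, c, 0)) = 1"
      unfolding mS by (intro vote_less) (auto simp: e_def gadget_rank.simps)
    moreover have "vote (XP, c, 0) (e (XP, c, 0)) (m (XP, c, 0)) = -1"
      unfolding mP using L by (intro vote_greater) (auto simp: e_def gadget_rank.simps)
    moreover have "vote (XQ, c, 0) (e (XQ, c, 0)) (m (XQ, c, 0)) = -1"
      unfolding mQ by (intro vote_greater) (auto simp: e_def gadget_rank.simps)
    ultimately show ?thesis by simp
  qed
  from 1 show False unfolding 2 3 by simp
qed

text \<open>The mirror image of \<open>X_choice\<close>: the costly edge
  \<open>YP\<close>-\<open>YQ\<close> lies at the start of the path, and \<open>D0\<close> is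
  entered from \<open>YB'\<close> of the last label. Here \<open>YA\<close> gains and
  \<open>YB'\<close> loses, again with total -1 before the boost.\<close>

lemma Y_choice:
  assumes c: "c \<in> C"
  shows "\<exists>s<L. m (YA, c, s) = (YB, c, s)"
proof (rule ccontr)
  assume "\<not> ?thesis"
  then have mA: "m (YA, c, s) = (YB', c, s)" if "s < L" for s using mate_YA[OF c that] that by auto
  have mB: "m (YB', c, s) = (YA, c, s)" if "s < L" for s
    using mA[OF that] mate_mate[of "(YA, c, s)"] c that by auto
  have mP: "m (YP, c, 0) = (YQ, c, 0)" by (rule mate_YP[OF c])
  have mQ: "m (YQ, c, 0) = (YP, c, 0)" using mP mate_mate[of "(YP, c, 0)"] c L by auto
  have mS: "m (YS, c, 0) = (YS, c, 0)"
  proof (rule ccontr)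
    assume ne: "m (YS, c, 0) \<noteq> (YS, c, 0)"
    have inn: "(YS, c, 0) \<in> nodes" using c L by auto
    have "m (YS, c, 0) = (YP, c, 0)"
      using mate_rank[OF inn ne] by (cases "m (YS, c, 0)") (auto simp: gadget_rank.simps split: if_splits)
    then show False using mate_mate[OF inn] mP by auto
  qed
  define e :: "'c vertex \<Rightarrow> 'c vertex" where "e = (\<lambda>(\<rho>, _, s).
    if \<rho> = YS then (YP, c, 0)
    else if \<rho> = YP then (YS, c, 0)
    else if \<rho> = YQ then (YA, c, 0)
    else if \<rho> = YA then if s = 0 then (YQ, c, 0) else (YB', c, s - 1)
    else if Suc s < L then (YA, c, Suc s) else d0)"
  let ?A = "(\<lambda>s. (YA, c, s)) ` {..<L}" and ?B = "(\<lambda>s. (YB', c, s)) ` {..<L}"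
  let ?S = "{(YS, c, 0), (YP, c, 0), (YQ, c, 0)} \<union> (?A \<union> ?B)"
  have 1: "(\<Sum>u\<in>?S. vote u (e u) (m u)) + 2 \<le> int (card (m ` ?S - ?S))"
  proof (rule boosted_exchange[where v = "(YB', c, L - 1)"])
    show "e u \<in> ?S \<and> e u \<noteq> (YB', c, L - 1) \<and> e (e u) = u \<and> rank u (e u) < 5" if "u \<in> ?S" "u \<noteq> (YB', c, L - 1)" for u
      using that L by (auto simp: e_def gadget_rank.simps image_iff split: if_splits)
  qed (use c L in \<open>auto simp: e_def gadget_rank.simps\<close>)
  have 2: "m ` ?S - ?S = {}" using mA mB mP mQ mS by auto
  have 3: "(\<Sum>u\<in>?S. vote u (e u) (m u)) = -1"
  proof -
    have "(\<Sum>u\<in>?S. vote u (e u) (m u)) =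
        (\<Sum>u\<in>{(YS, c, 0), (YP, c, 0), (YQ, c, 0)}. vote u (e u) (m u)) + (\<Sum>u\<in>?A \<union> ?B. vote u (e u) (m u))"
      by (intro sum.union_disjoint) auto
    also have "(\<Sum>u\<in>?A \<union> ?B. vote u (e u) (m u)) = (\<Sum>u\<in>?A. vote u (e u) (m u)) + (\<Sum>u\<in>?B. vote u (e u) (m u))"
      by (intro sum.union_disjoint) auto
    also have "(\<Sum>u\<in>?A. vote u (e u) (m u)) = (\<Sum>u\<in>?A. 1)"
      using mA by (intro sum.cong) (auto simp: e_def gadget_rank.simps intro!: vote_less)
    also have "(\<Sum>u\<in>?B. vote u (e u) (m u)) = (\<Sum>u\<in>?B. -1)"
      using mB by (intro sum.cong) (auto simp: e_def gadget_rank.simps intro!: vote_greater)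
    finally have "(\<Sum>u\<in>?S. vote u (e u) (m u)) = (\<Sum>u\<in>{(YS, c, 0), (YP, c, 0), (YQ, c, 0)}. vote u (e u) (m u)) +
      ((\<Sum>u\<in>?A. 1) + (\<Sum>u\<in>?B. -1))" .
    moreover have "card ?A = L" by (subst card_image) (auto simp: inj_on_def)
    moreover have "card ?B = L" by (subst card_image) (auto simp: inj_on_def)
    moreover have "vote (YS, c, 0) (e (YS, c, 0)) (m (YS, c, 0)) = 1"
      unfolding mS by (intro vote_less) (auto simp: e_def gadget_rank.simps)
    moreover have "vote (YP, c, 0) (e (YP, c, 0)) (m (YP, c, 0)) = -1"
      unfolding mP using L by (intro vote_greater) (auto simp: e_def gadget_rank.simps)
    moreover have "vote (YQ, c, 0) (e (YQ, c, 0)) (m (YQ, c, 0)) = -1"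
      unfolding mQ by (intro vote_greater) (auto simp: e_def gadget_rank.simps)
    ultimately show ?thesis by simp
  qed
  from 1 show False unfolding 2 3 by simp
qed

lemma labels_of_popular:
  "\<exists>f g. (\<forall>c\<in>C. f c < L \<and> g c < L) \<and> (\<forall>q\<in>C. \<forall>c\<in>C. \<not> conf q (g q) c (f c))"
proof -
  obtain f where f: "\<And>c. c \<in> C \<Longrightarrow> f c < L \<and> m (XA, c, f c) = (XB', c, f c)"
    using X_choice by metis
  obtain g where g: "\<And>c. c \<in> C \<Longrightarrow> g c < L \<and> m (YA, c, g c) = (YB, c, g c)"
    using Y_choice by metis
  have "\<not> conf q (g q) c (f c)" if "q \<in> C" "c \<in> C" for q c
  proof
    assume conf: "conf q (g q) c (f c)"
    have "m (YB, q, g q) = (YA, q, g q)" using g[OF that(1)] mate_mate[of "(YA, q, g q)"] that by auto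
    then show False
      using no_blocking[of "(XA, c, f c)" "(YB, q, g q)"] f[OF that(2)] g[OF that(1)] that conf
      by (simp add: gadget_rank.simps)
  qed
  with f g show ?thesis by blast
qed

end

subsection \<open>From a choice of labels to a popular matching\<close>

context
  fixes f g :: "'c \<Rightarrow> nat"
  assumes labels: "\<And>c. c \<in> C \<Longrightarrow> f c < L" "\<And>c. c \<in> C \<Longrightarrow> g c < L"
    and consistent: "\<And>q c. q \<in> C \<Longrightarrow> c \<in> C \<Longrightarrow> \<not> conf q (g q) c (f c)"
begin

fun mate_of :: "'c vertex \<Rightarrow> 'c vertex" where
  "mate_of (XA, c, s) = (if s = f c then (XB', c, s) else (XB, c, s))"
| "mate_of (XB, c, s) = (if s = f c then (XA', c, s) else (XA, c, s))"
| "mate_of (XA', c, s) = (if s = f c then (XB, c, s) else (XB', c, s))"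
| "mate_of (XB', c, s) = (if s = f c then (XA, c, s) else (XA', c, s))"
| "mate_of (XS, c, s) = (XS, c, s)"
| "mate_of (XP, c, s) = (if s = 0 then (XQ, c, s) else (XP, c, s))"
| "mate_of (XQ, c, s) = (if s = 0 then (XP, c, s) else (XQ, c, s))"
| "mate_of (YA, c, s) = (if s = g c then (YB, c, s) else (YB', c, s))"
| "mate_of (YB, c, s) = (if s = g c then (YA, c, s) else (YA', c, s))"
| "mate_of (YA', c, s) = (if s = g c then (YB', c, s) else (YB, c, s))"
| "mate_of (YB', c, s) = (if s = g c then (YA', c, s) else (YA, c, s))"
| "mate_of (YS, c, s) = (YS, c, s)"
| "mate_of (YP, c, s) = (if s = 0 then (YQ, c, s) else (YP, c, s))"
| "mate_of (YQ, c, s) = (if s = 0 then (YP, c, s) else (YQ, c, s))"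
| "mate_of (D0, c, s) = (if c = o1 \<and> s = 0 then (D1, c, s) else (D0, c, s))"
| "mate_of (D1, c, s) = (if c = o1 \<and> s = 0 then (D0, c, s) else (D1, c, s))"
| "mate_of (D2, c, s) = (if c = o1 \<and> s = 0 then (D3, c, s) else (D2, c, s))"
| "mate_of (D3, c, s) = (if c = o1 \<and> s = 0 then (D2, c, s) else (D3, c, s))"

text \<open>Popularity is certified by a potential. Two potentials are needed: \<open>potential1\<close> for the matchings
  in which the mate of \<open>D0\<close> is not one of \<open>XA, XA', XP, YA, YA', YP\<close>, and \<open>potential2\<close> for those in which
  it is not one of \<open>XQ, YB'\<close>. No single potential works for both, because \<open>D0\<close> lies on odd cycles.\<close>

fun potential1 :: "'c vertex \<Rightarrow> int" where
  "potential1 (\<rho>, c, s) =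
     (if \<rho> \<in> {XA, XA'} then if s \<le> f c then 1 else -1
      else if \<rho> \<in> {XB, XB'} then if s \<le> f c then -1 else 1
      else if \<rho> \<in> {YA, YA'} then if s < g c then 1 else -1
      else if \<rho> \<in> {YB, YB'} then if s < g c then -1 else 1
      else if \<rho> \<in> {YP, XQ} \<and> s = 0 then 1
      else if \<rho> \<in> {YQ, XP} \<and> s = 0 then -1
      else if \<rho> \<in> {D1, D3} \<and> c = o1 \<and> s = 0 then 1
      else if \<rho> \<in> {D0, D2} \<and> c = o1 \<and> s = 0 then -1 else 0)"

fun potential2 :: "'c vertex \<Rightarrow> int" where
  "potential2 (\<rho>, c, s) =
     (if \<rho> \<in> {XA, XA', YA, YA'} then 1
      else if \<rho> \<in> {XB, XB', YB, YB'} then -1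
      else if \<rho> \<in> {XP, YP} \<and> s = 0 then 1
      else if \<rho> \<in> {XQ, YQ} \<and> s = 0 then -1
      else if \<rho> \<in> {D1, D3} \<and> c = o1 \<and> s = 0 then 1
      else if \<rho> \<in> {D0, D2} \<and> c = o1 \<and> s = 0 then -1 else 0)"

section \<open>Checking the certificates edge by edge\<close>

lemma mate_of_in: "x \<in> nodes \<Longrightarrow> mate_of x \<in> nodes"
  by (cases x rule: mate_of.cases) auto

lemma mate_of_mate_of: "mate_of (mate_of x) = x"
  by (cases x rule: mate_of.cases) auto

lemma mate_of_rank: "mate_of x = x \<or> rank x (mate_of x) < 5"
  by (cases x rule: mate_of.cases) (auto simp: gadget_rank.simps)

lemma mating_mate_of: "mating mate_of"
  using mate_of_in mate_of_mate_of mate_of_rank by (simp add: mating_def)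

text \<open>Every kind of adjacency is listed in one orientation, so that an inequality symmetric in
  the ends is checked once per rule instead of for all pairs of roles.\<close>

inductive edge :: "'c vertex \<Rightarrow> 'c vertex \<Rightarrow> bool" where
  "edge (XA, c, s) (XB, c, s)"
| "edge (XA, c, s) (XB', c, s)"
| "edge (XA', c, s) (XB, c, s)"
| "edge (XA', c, s) (XB', c, s)"
| "edge (XS, c, 0) (XA, c, 0)"
| "edge (XB, c, s) (XA, c, Suc s)"
| "Suc s = L \<Longrightarrow> edge (XB, c, s) (XP, c, 0)"
| "edge (XP, c, 0) (XQ, c, 0)"
| "edge (XQ, c, 0) d0"
| "edge (XP, c, 0) d0"
| "edge (XA, c, s) d0"
| "edge (XA', c, s) d0"
| "edge (YA, c, s) (YB, c, s)"
| "edge (YA, c, s) (YB', c, s)"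
| "edge (YA', c, s) (YB, c, s)"
| "edge (YA', c, s) (YB', c, s)"
| "edge (YS, c, 0) (YP, c, 0)"
| "edge (YP, c, 0) (YQ, c, 0)"
| "edge (YQ, c, 0) (YA, c, 0)"
| "edge (YB', c, s) (YA, c, Suc s)"
| "Suc s = L \<Longrightarrow> edge (YB', c, s) d0"
| "edge (YP, c, 0) d0"
| "edge (YA, c, s) d0"
| "edge (YA', c, s) d0"
| "conf q t c s \<Longrightarrow> edge (XA, c, s) (YB, q, t)"
| "edge d0 d1"
| "edge d0 d2"
| "edge d0 d3"
| "edge d1 d2"
| "edge d2 d3"
| "edge d3 d1"

lemma rank_edge:
  assumes "rank x y < 5"
  shows "edge x y \<or> edge y x"
proof (cases "fst x = D0")
  case True
  then obtain c s \<rho> c' s' where "x = (D0, c, s)" "y = (\<rho>, c', s')" by (cases x; cases y) auto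
  then show ?thesis
    using assms by (cases \<rho>) (auto simp: gadget_rank.simps edge.intros split: if_splits)
next
  case False
  obtain \<rho> c s \<rho>' c' s' where "x = (\<rho>, c, s)" "y = (\<rho>', c', s')" by (cases x; cases y) auto
  then show ?thesis
    using assms False by (cases \<rho>) (auto simp: gadget_rank.simps edge.intros split: if_splits)
qed

text \<open>Among the nodes, ties occur only between \<open>conf\<close> edges at an
  \<open>XA\<close> or a \<open>YB\<close> and between the first choices of \<open>D0\<close>.
  \<open>mate_of\<close> uses none of these edges, so tie-breaking never enters a comparison with a
  mate.\<close>

lemma rank_mate_of_unique:
  assumes "rank x y = rank x (mate_of x)" "rank x y < 5"
  shows "y = mate_of x"
  using rank_edge[OF assms(2)]
proof
  assume "edge x y"
  then show ?thesis using assms(1) by (cases rule: edge.cases) (auto simp: gadget_rank.simps split: if_splits)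
next
  assume "edge y x"
  then show ?thesis using assms(1) by (cases rule: edge.cases) (auto simp: gadget_rank.simps split: if_splits)
qed

lemma potential1_ge: "-1 \<le> potential1 x"
  by (cases x rule: mate_of.cases) simp_all

lemma potential1_mate_of: "potential1 x + potential1 (mate_of x) = 0"
  by (cases x rule: mate_of.cases) simp_all

lemma potential2_ge: "-1 \<le> potential2 x"
  by (cases x rule: mate_of.cases) simp_all

lemma potential2_mate_of: "potential2 x + potential2 (mate_of x) = 0"
  by (cases x rule: mate_of.cases) simp_all

definition bound :: "'c vertex \<Rightarrow> 'c vertex \<Rightarrow> int" where
  "bound x y = (if rank x y < rank x (mate_of x) then 1 else if y = mate_of x then 0 else -1)"

lemma vote_bound: "rank x y < 5 \<Longrightarrow> vote x y (mate_of x) \<le> bound x y"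
  using rank_mate_of_unique[of x y]
  by (cases "rank x y" "rank x (mate_of x)" rule: linorder_cases)
    (auto simp: bound_def vote_less vote_greater vote_refl)

text \<open>On an edge from an outer node to \<open>D0\<close>, the outer node loses a vote and
  \<open>D0\<close> wins one; as \<open>D0\<close> has potential -1, the outer end needs potential
  1. Mates such as \<open>XP\<close> and \<open>XQ\<close> have opposite potentials and cannot both
  have it. \<open>potential1\<close> serves the path ends \<open>XQ\<close> and \<open>YB'\<close>;
  to this end it changes sign along each path at the chosen label, where a path edge loses the votes
  of both its ends.\<close>

lemma edge_potential1_aux:
  assumes "edge x y" "x \<in> nodes" "y \<in> nodes" "y = d0 \<Longrightarrow> fst x \<notin> {XA, XA', XP, YA, YA', YP}"
  shows "bound x y + bound y x \<le> potential1 x + potential1 y"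
  using assms
proof (cases rule: edge.cases)
  \<comment> \<open>The \<open>conf\<close> edges.\<close>
  case (25 q t c s)
  then show ?thesis using assms consistent[of q c] by (auto simp: bound_def gadget_rank.simps)
next
  \<comment> \<open>Rules 7 and 21 leave the last label of a path. Their potentials are determined
    by the fact that the chosen label does not exceed the last one.\<close>
  case (7 s c)
  then show ?thesis using assms labels[of c] by (auto simp: bound_def gadget_rank.simps)
next
  case (21 s c)
  then show ?thesis using assms labels[of c] by (auto simp: bound_def gadget_rank.simps)
qed (auto simp: bound_def gadget_rank.simps)

lemma edge_potential1:
  assumes "x \<in> nodes" "y \<in> nodes" "rank x y < 5"
    and "x = d0 \<Longrightarrow> fst y \<notin> {XA, XA', XP, YA, YA', YP}" "y = d0 \<Longrightarrow> fst x \<notin> {XA, XA', XP, YA, YA', YP}"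
  shows "bound x y + bound y x \<le> potential1 x + potential1 y"
  using rank_edge[OF assms(3)] edge_potential1_aux[of x y] edge_potential1_aux[of y x] assms
  by (auto simp: add.commute)

lemma edge_potential2_aux:
  assumes "edge x y" "x \<in> nodes" "y \<in> nodes" "y = d0 \<Longrightarrow> fst x \<notin> {XQ, YB'}"
  shows "bound x y + bound y x \<le> potential2 x + potential2 y"
  using assms
proof (cases rule: edge.cases)
  case (25 q t c s)
  then show ?thesis using assms consistent[of q c] by (auto simp: bound_def gadget_rank.simps)
next
  case (7 s c)
  then show ?thesis using assms labels[of c] by (auto simp: bound_def gadget_rank.simps)
next
  case (21 s c)
  then show ?thesis using assms labels[of c] by (auto simp: bound_def gadget_rank.simps)
qed (auto simp: bound_def gadget_rank.simps)

lemma edge_potential2: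
  assumes "x \<in> nodes" "y \<in> nodes" "rank x y < 5"
    and "x = d0 \<Longrightarrow> fst y \<notin> {XQ, YB'}" "y = d0 \<Longrightarrow> fst x \<notin> {XQ, YB'}"
  shows "bound x y + bound y x \<le> potential2 x + potential2 y"
  using rank_edge[OF assms(3)] edge_potential2_aux[of x y] edge_potential2_aux[of y x] assms
  by (auto simp: add.commute)



lemma popular_of_labels: "popular_mating mate_of"
  unfolding popular_mating_def
proof (intro conjI allI impI mating_mate_of)
  fix n assume n: "mating n"
  have nn: "n x \<in> nodes" "n (n x) = x" "n x \<noteq> x \<Longrightarrow> rank x (n x) < 5" if "x \<in> nodes" for x
    using n that by (auto simp: mating_def)
  have bound: "vote x (n x) (mate_of x) + vote (n x) x (mate_of (n x)) \<le> bound x (n x) + bound (n x) x"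
    if "x \<in> nodes" "n x \<noteq> x" for x
    using vote_bound[OF nn(3)[OF that]] vote_bound[OF gadget_rank_sym[OF nn(3)[OF that]]] by linarith
  have d0: "n d0 = x" if "x \<in> nodes" "n x = d0" for x using nn(2)[OF that(1)] that(2) by simp
  show "gain n mate_of \<le> 0"
  proof (cases "fst (n d0) \<in> {XA, XA', XP, YA, YA', YP}")
    case True
    show ?thesis
    proof (rule gain_nonpos[OF mating_mate_of n, of potential2])
      show "potential2 x + potential2 (mate_of x) = 0" for x by (rule potential2_mate_of)
      show "- 1 \<le> potential2 x" for x by (rule potential2_ge)
      show "vote x (n x) (mate_of x) + vote (n x) x (mate_of (n x)) \<le> potential2 x + potential2 (n x)"
        if x: "x \<in> nodes" "n x \<noteq> x" for x
      proof -
        have "bound x (n x) + bound (n x) x \<le> potential2 x + potential2 (n x)"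
        proof (rule edge_potential2[OF x(1) nn(1)[OF x(1)] nn(3)[OF x]])
          assume "n x = d0"
          then have "n d0 = x" by (rule d0[OF x(1)])
          then show "fst x \<notin> {XQ, YB'}" using True by auto
        qed (use True in auto)
        with bound[OF x] show ?thesis by simp
      qed
    qed
  next
    case False
    show ?thesis
    proof (rule gain_nonpos[OF mating_mate_of n, of potential1])
      show "potential1 x + potential1 (mate_of x) = 0" for x by (rule potential1_mate_of)
      show "- 1 \<le> potential1 x" for x by (rule potential1_ge)
      show "vote x (n x) (mate_of x) + vote (n x) x (mate_of (n x)) \<le> potential1 x + potential1 (n x)"
        if x: "x \<in> nodes" "n x \<noteq> x" for x
      proof -
        have "bound x (n x) + bound (n x) x \<le> potential1 x + potential1 (n x)"
        proof (rule edge_potential1[OF x(1) nn(1)[OF x(1)] nn(3)[OF x]])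
          assume "n x = d0"
          then have "n d0 = x" by (rule d0[OF x(1)])
          then show "fst x \<notin> {XA, XA', XP, YA, YA', YP}" using False by auto
        qed (use False in auto)
        with bound[OF x] show ?thesis by simp
      qed
    qed
  qed
qed

end

theorem popular_iff_labels:
  "(\<exists>m. popular_mating m) \<longleftrightarrow>
   (\<exists>f g. (\<forall>c\<in>C. f c < L \<and> g c < L) \<and> (\<forall>q\<in>C. \<forall>c\<in>C. \<not> conf q (g q) c (f c)))"
  (is "?P \<longleftrightarrow> ?Q")
proof
  assume ?P
  then show ?Q using labels_of_popular by blast
next
  assume ?Q
  then obtain f g where "\<And>c. c \<in> C \<Longrightarrow> f c < L" "\<And>c. c \<in> C \<Longrightarrow> g c < L"
    "\<And>q c. q \<in> C \<Longrightarrow> c \<in> C \<Longrightarrow> \<not> conf q (g q) c (f c)" by blast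
  from popular_of_labels[OF this] show ?P by blast
qed

end

section \<open>Popular matchings of presented graphs\<close>

lemma popular_mating_transfer:
  assumes V: "ranked_graph V R rank vote" and W: "ranked_graph W R rank' vote'"
    and h: "bij_betw h W V"
    and rank: "\<And>u v. u \<in> W \<Longrightarrow> v \<in> W \<Longrightarrow> rank' u v = rank (h u) (h v)"
    and vote: "\<And>u v w. u \<in> W \<Longrightarrow> v \<in> W \<Longrightarrow> w \<in> W \<Longrightarrow> vote' u v w = vote (h u) (h v) (h w)"
    and pop: "ranked_graph.popular_mating W R rank' vote' m"
  shows "\<exists>m. ranked_graph.popular_mating V R rank vote m"
proof -
  interpret V: ranked_graph V R rank vote by (rule V)
  interpret W: ranked_graph W R rank' vote' by (rule W)
  define g where "g = inv_into W h"
  have g: "g x \<in> W" "h (g x) = x" if "x \<in> V" for x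
    using h that f_inv_into_f[of x h W] inv_into_into[of x h W] by (auto simp: g_def bij_betw_def)
  have h': "h u \<in> V" "g (h u) = u" if "u \<in> W" for u
    using h that unfolding g_def by (auto simp: bij_betw_def)
  have m: "W.mating m" "W.mating k \<Longrightarrow> W.gain k m \<le> 0" for k
    using pop by (auto simp: W.popular_mating_def)
  let ?m = "\<lambda>x. h (m (g x))"
  have m': "V.mating ?m"
    unfolding V.mating_def
  proof (intro ballI conjI)
    fix x assume x: "x \<in> V"
    then have mg: "m (g x) \<in> W" "m (m (g x)) = g x" "m (g x) = g x \<or> rank' (g x) (m (g x)) < R"
      using m(1) g by (auto simp: W.mating_def)
    then show "?m x \<in> V" "?m (?m x) = x" using g h' x by auto
    show "?m x = x \<or> rank x (?m x) < R" using mg x g rank[of "g x" "m (g x)"] by auto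
  qed
  have "V.gain k ?m \<le> 0" if k: "V.mating k" for k
  proof -
    let ?k = "\<lambda>u. g (k (h u))"
    have k': "W.mating ?k"
      unfolding W.mating_def
    proof (intro ballI conjI)
      fix u assume u: "u \<in> W"
      then have kV: "k (h u) \<in> V" "k (k (h u)) = h u" using k h' by (auto simp: V.mating_def)
      then show "?k u \<in> W" "?k (?k u) = u" using g h' u by auto
      have "k (h u) = h u \<or> rank (h u) (k (h u)) < R" using k h' u by (auto simp: V.mating_def)
      then show "?k u = u \<or> rank' u (?k u) < R" using u kV g h' rank by auto
    qed
    have "V.gain k ?m = (\<Sum>u\<in>W. vote (h u) (k (h u)) (?m (h u)))"
      unfolding V.gain_def by (rule sum.reindex_bij_betw[OF h, symmetric])
    also have "\<dots> = W.gain ?k m"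
      unfolding W.gain_def
    proof (rule sum.cong)
      fix u assume u: "u \<in> W"
      then have "k (h u) \<in> V" using k h' by (auto simp: V.mating_def)
      moreover have "m u \<in> W" using m(1) u by (auto simp: W.mating_def)
      ultimately show "vote (h u) (k (h u)) (?m (h u)) = vote' u (?k u) (m u)"
        using vote[of u "?k u" "m u"] u g h' by simp
    qed simp
    also have "\<dots> \<le> 0" by (rule m(2)[OF k'])
    finally show ?thesis .
  qed
  with m' show ?thesis unfolding V.popular_mating_def by blast
qed

section \<open>Graphs on numbers, with ties broken by number\<close>

locale presented_graph =
  fixes n R :: nat and rk :: "nat \<Rightarrow> nat \<Rightarrow> nat"
  assumes rk_self: "rk u u = R"
    and rk_sym: "u < n \<Longrightarrow> v < n \<Longrightarrow> rk u v < R \<Longrightarrow> rk v u < R"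
begin

text \<open>Ties are broken in the order in which \<open>pref_lists\<close> enumerates the nodes of
  equal rank. As \<open>rk u u\<close> is \<open>R\<close>, every neighbour is preferred to staying
  alone.\<close>

definition prefers :: "nat \<Rightarrow> nat \<Rightarrow> nat \<Rightarrow> bool" where
  "prefers u v w \<longleftrightarrow> rk u v < rk u w \<or> rk u v = rk u w \<and> v < w"

definition vote :: "nat \<Rightarrow> nat \<Rightarrow> nat \<Rightarrow> int" where
  "vote u v w = of_bool (prefers u v w) - of_bool (prefers u w v)"

definition edges :: "nat set set" where
  "edges = {{u, v} | u v. u < n \<and> v < n \<and> rk u v < R}"

sublocale ranked_graph "{..<n}" R rk vote
  by standard (auto simp: rk_self rk_sym vote_def prefers_def)

lemma edge_iff: "{u, v} \<in> edges \<longleftrightarrow> u < n \<and> v < n \<and> rk u v < R"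
  using rk_sym by (auto simp: edges_def doubleton_eq_iff)

lemma neighbours_edges: "u < n \<Longrightarrow> neighbours edges u = {v. v < n \<and> rk u v < R}"
  by (auto simp: neighbours_def edge_iff)

lemma preference_graph_edges: "preference_graph {..<n} edges prefers"
proof -
  have "card {u, v} = 2" if "rk u v < R" for u v
    using that rk_self[of u] by (cases "u = v") auto
  then show ?thesis
    by (auto simp: preference_graph_def edges_def irreflp_on_def transp_on_def totalp_on_def prefers_def)
qed

lemma sorted_blocks:
  "sorted_wrt (prefers u) (concat (map (\<lambda>r. filter (\<lambda>v. rk u v = r) [0..<n]) [0..<k]))"
proof (induction k)
  case (Suc k)
  have "sorted_wrt (prefers u) (filter (\<lambda>v. rk u v = k) [0..<n])"
    by (rule sorted_wrt_mono_rel[of _ "(<)"]) (auto simp: prefers_def sorted_wrt_filter)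
  moreover have "\<forall>v\<in>set (concat (map (\<lambda>r. filter (\<lambda>v. rk u v = r) [0..<n]) [0..<k])).
      \<forall>w\<in>set (filter (\<lambda>v. rk u v = k) [0..<n]). prefers u v w"
    by (auto simp: prefers_def)
  ultimately have "sorted_wrt (prefers u) (concat (map (\<lambda>r. filter (\<lambda>v. rk u v = r) [0..<n]) [0..<k]) @
      filter (\<lambda>v. rk u v = k) [0..<n])"
    using Suc unfolding sorted_wrt_append by blast
  then show ?case by simp
qed simp

lemma distinct_blocks: "distinct (concat (map (\<lambda>r. filter (\<lambda>v. rk u v = r) [0..<n]) [0..<k]))"
  by (induction k) auto

lemma presents_pref_lists: "presents (pref_lists n R rk) {..<n} edges prefers"
  by (auto simp: presents_def pref_lists_def neighbours_edges sorted_blocks distinct_blocks)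

lemma partner_eq: "matching edges M \<Longrightarrow> {u, v} \<in> M \<Longrightarrow> partner M u = v"
  unfolding partner_def
proof (rule the_equality)
  fix w assume M: "matching edges M" "{u, v} \<in> M" "{u, w} \<in> M"
  then have "{u, v} = {u, w}"
    unfolding matching_def pairwise_def disjnt_def by (metis Int_iff empty_iff insertI1)
  then show "w = v" by (auto simp: doubleton_eq_iff)
qed

definition mate :: "nat set set \<Rightarrow> nat \<Rightarrow> nat" where
  "mate M u = (if matched M u then partner M u else u)"

lemma mate_cases:
  assumes "matching edges M"
  obtains "\<not> matched M u" "mate M u = u"
  | v where "matched M u" "mate M u = v" "partner M u = v" "{u, v} \<in> M" "u < n" "v < n" "rk u v < R" "v \<noteq> u"
proof (cases "matched M u")
  case True
  then obtain v where v: "{u, v} \<in> M" by (auto simp: matched_def)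
  then have "u < n" "v < n" "rk u v < R" using assms edge_iff by (auto simp: matching_def)
  moreover from this have "v \<noteq> u" using rk_self[of u] by auto
  ultimately show ?thesis using that(2)[of v] v True partner_eq[OF assms v] by (simp add: mate_def)
qed (use that in \<open>simp add: mate_def\<close>)

lemma mating_mate:
  assumes "matching edges M"
  shows "mating (mate M)"
  unfolding mating_def
proof (intro ballI conjI)
  fix u assume "u \<in> {..<n}"
  then show "mate M u \<in> {..<n}" "mate M u = u \<or> rk u (mate M u) < R"
    by (rule_tac mate_cases[OF assms, of u], simp, simp)+
  show "mate M (mate M u) = u"
  proof (rule mate_cases[OF assms, of u])
    fix v assume v: "mate M u = v" "{u, v} \<in> M"
    then have "{v, u} \<in> M" by (simp add: insert_commute)
    then show ?thesis using partner_eq[OF assms, of v u] v by (auto simp: mate_def matched_def)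
  qed simp
qed

lemma matching_of_mating:
  assumes k: "mating k"
  obtains M where "matching edges M" "\<And>u. u < n \<Longrightarrow> mate M u = k u"
proof -
  define M where "M = {{u, k u} | u. u < n \<and> k u \<noteq> u}"
  have k: "k u < n" "k (k u) = u" "k u \<noteq> u \<Longrightarrow> rk u (k u) < R" if "u < n" for u
    using k that by (auto simp: mating_def)
  have "M \<subseteq> edges"
  proof
    fix e assume "e \<in> M"
    then obtain u where "e = {u, k u}" "u < n" "k u \<noteq> u" by (auto simp: M_def)
    then show "e \<in> edges" using k[of u] edge_iff[of u "k u"] by simp
  qed
  moreover have "pairwise disjnt M"
  proof (rule pairwiseI)
    fix e e' assume e: "e \<in> M" "e' \<in> M" "e \<noteq> e'"
    obtain u v where u: "u < n" "e = {u, k u}" and v: "v < n" "e' = {v, k v}" using e by (auto simp: M_def)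
    have "u \<noteq> v" using u v e(3) by blast
    moreover have "k u \<noteq> v"
    proof
      assume "k u = v"
      then have "k v = u" using k(2)[OF u(1)] by simp
      with \<open>k u = v\<close> have "e = e'" using u v by (simp add: insert_commute)
      with e(3) show False ..
    qed
    moreover have "k u \<noteq> k v" using \<open>u \<noteq> v\<close> k(2)[OF u(1)] k(2)[OF v(1)] by metis
    moreover have "u \<noteq> k v" using \<open>k u \<noteq> v\<close> k(2)[OF v(1)] by metis
    ultimately have "u \<noteq> v" "k u \<noteq> v" "u \<noteq> k v" "k u \<noteq> k v" by blast+
    then show "disjnt e e'" unfolding u(2) v(2) disjnt_def by simp
  qed
  ultimately have M: "matching edges M" by (simp add: matching_def)
  have "mate M u = k u" if "u < n" for u
  proof (rule mate_cases[OF M, of u])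
    fix v assume v: "{u, v} \<in> M" "mate M u = v"
    then obtain x where "x < n" "{u, v} = {x, k x}" by (auto simp: M_def)
    then have "v = k u" using k(2)[of x] by (auto simp: doubleton_eq_iff)
    with v show ?thesis by simp
  next
    assume u: "\<not> matched M u" "mate M u = u"
    have "k u = u"
    proof (rule ccontr)
      assume "k u \<noteq> u"
      then have "{u, k u} \<in> M" using that unfolding M_def by blast
      with u(1) show False unfolding matched_def by blast
    qed
    with u(2) show ?thesis by simp
  qed
  with M that show ?thesis by blast
qed

lemma prefers_matching_iff:
  assumes "matching edges M" "matching edges N"
  shows "prefers_matching prefers u M N \<longleftrightarrow> prefers u (mate M u) (mate N u)"
proof (rule mate_cases[OF assms(1), of u]; rule mate_cases[OF assms(2), of u])
  fix v w assume "matched M u" "mate M u = v" "partner M u = v" "matched N u" "mate N u = w" "partner N u = w"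
  then show ?thesis by (simp add: prefers_matching_def)
next
  fix v assume "matched M u" "mate M u = v" "rk u v < R" "\<not> matched N u" "mate N u = u"
  then show ?thesis by (simp add: prefers_matching_def prefers_def rk_self)
next
  fix v assume "\<not> matched M u" "mate M u = u" "matched N u" "mate N u = v" "rk u v < R"
  then show ?thesis by (simp add: prefers_matching_def prefers_def rk_self)
next
  assume "\<not> matched M u" "mate M u = u" "\<not> matched N u" "mate N u = u"
  then show ?thesis by (simp add: prefers_matching_def prefers_def)
qed

lemma vote_margin_eq_gain:
  assumes "matching edges M" "matching edges N"
  shows "vote_margin {..<n} prefers M N = gain (mate M) (mate N)"
proof -
  have "int (card {u \<in> {..<n}. Q u}) = (\<Sum>u<n. of_bool (Q u))" for Q
    using sum.inter_filter[of "{..<n}" "\<lambda>_. 1 :: int" Q] by (simp add: of_bool_def)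
  then show ?thesis
    unfolding vote_margin_def votes_def gain_def prefers_matching_iff[OF assms] prefers_matching_iff[OF assms(2,1)]
    by (simp add: vote_def sum_subtractf)
qed

lemma gain_swap: "gain k m = - gain m k"
  by (simp add: gain_def vote_def flip: sum_negf)

lemma gain_cong: "(\<And>u. u < n \<Longrightarrow> k u = k' u) \<Longrightarrow> (\<And>u. u < n \<Longrightarrow> m u = m' u) \<Longrightarrow> gain k m = gain k' m'"
  unfolding gain_def by (intro sum.cong) auto

lemma popular_iff_popular_mating: "(\<exists>M. popular {..<n} edges prefers M) \<longleftrightarrow> (\<exists>m. popular_mating m)"
proof
  assume "\<exists>M. popular {..<n} edges prefers M"
  then obtain M where M: "matching edges M" "\<And>N. matching edges N \<Longrightarrow> vote_margin {..<n} prefers M N \<ge> 0"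
    by (auto simp: popular_def)
  have "gain k (mate M) \<le> 0" if k: "mating k" for k
  proof -
    obtain N where N: "matching edges N" "\<And>u. u < n \<Longrightarrow> mate N u = k u" by (rule matching_of_mating[OF k]) auto
    have "gain k (mate M) = gain (mate N) (mate M)" using N(2) by (intro gain_cong) auto
    also have "\<dots> = - vote_margin {..<n} prefers M N"
      by (simp add: vote_margin_eq_gain[OF M(1) N(1)] gain_swap[of "mate N"])
    finally show ?thesis using M(2)[OF N(1)] by simp
  qed
  then show "\<exists>m. popular_mating m" using mating_mate[OF M(1)] by (auto simp: popular_mating_def)
next
  assume "\<exists>m. popular_mating m"
  then obtain m where m: "mating m" "\<And>k. mating k \<Longrightarrow> gain k m \<le> 0" by (auto simp: popular_mating_def)
  obtain M where M: "matching edges M" "\<And>u. u < n \<Longrightarrow> mate M u = m u" by (rule matching_of_mating[OF m(1)]) auto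
  have "vote_margin {..<n} prefers M N \<ge> 0" if N: "matching edges N" for N
  proof -
    have "gain (mate N) m = gain (mate N) (mate M)" using M(2) by (intro gain_cong) auto
    then show ?thesis
      using m(2)[OF mating_mate[OF N]] by (simp add: vote_margin_eq_gain[OF M(1) N] gain_swap[of "mate M"])
  qed
  with M(1) show "\<exists>M. popular {..<n} edges prefers M" by (auto simp: popular_def)
qed

end

lemma partner_neighbour:
  assumes "preference_graph V E P" "matching E M" "matched M u"
  shows "u \<in> V" "partner M u \<in> neighbours E u"
proof -
  obtain v where v: "{u, v} \<in> M" using assms(3) by (auto simp: matched_def)
  have "w = v" if w: "{u, w} \<in> M" for w
  proof -
    have "{u, v} = {u, w}"
      using v w assms(2) unfolding matching_def pairwise_def disjnt_def by (metis Int_iff empty_iff insertI1)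
    then show ?thesis by (auto simp: doubleton_eq_iff)
  qed
  with v have p: "partner M u = v" unfolding partner_def by (rule the_equality)
  have "{u, v} \<in> E" using v assms(2) unfolding matching_def by blast
  then show "u \<in> V" "partner M u \<in> neighbours E u"
    using assms(1) unfolding preference_graph_def neighbours_def p by blast+
qed

text \<open>A presentation fixes preferences between neighbours only. This is enough, since votes
  compare partners, and partners are neighbours.\<close>

lemma popular_cong:
  assumes G: "preference_graph V E P"
    and eq: "\<And>u v w. u \<in> V \<Longrightarrow> v \<in> neighbours E u \<Longrightarrow> w \<in> neighbours E u \<Longrightarrow> P u v w \<longleftrightarrow> P' u v w"
    and pop: "popular V E P M"
  shows "popular V E P' M"
proof -
  have "prefers_matching P u M N \<longleftrightarrow> prefers_matching P' u M N"
    if "matching E M" "matching E N" for u M N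
  proof (cases "matched M u \<and> matched N u")
    case True
    then have "P u (partner M u) (partner N u) \<longleftrightarrow> P' u (partner M u) (partner N u)"
        "P u (partner N u) (partner M u) \<longleftrightarrow> P' u (partner N u) (partner M u)"
      using eq partner_neighbour[OF G that(1)] partner_neighbour[OF G that(2)] by blast+
    then show ?thesis by (simp add: prefers_matching_def)
  qed (auto simp: prefers_matching_def)
  then have "vote_margin V P M N = vote_margin V P' M N" if "matching E M" "matching E N" for M N
    using that unfolding vote_margin_def votes_def by presburger
  with pop show ?thesis unfolding popular_def by metis
qed

lemma (in presented_graph) in_problem_iff:
  "encode_instance (pref_lists n R rk) \<in> popular_matching_problem \<longleftrightarrow> (\<exists>m. popular_mating m)"
  unfolding popular_iff_popular_mating[symmetric]
proof
  assume "encode_instance (pref_lists n R rk) \<in> popular_matching_problem"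
  then obtain pl V E P M where pl: "encode_instance (pref_lists n R rk) = encode_instance pl"
    and G: "preference_graph V E P" and pr: "presents pl V E P" and pop: "popular V E P M"
    unfolding popular_matching_problem_def mem_Collect_eq by (elim exE conjE)
  have "pl = pref_lists n R rk" using injD[OF inj_encode_instance pl] by simp
  note uniq = presents_unique[OF G pr[unfolded this] preference_graph_edges presents_pref_lists]
  have "popular V E prefers M"
    by (rule popular_cong[OF G _ pop]) (use uniq in blast)
  then have "popular {..<n} edges prefers M" using uniq by simp
  then show "\<exists>M. popular {..<n} edges prefers M" ..
next
  assume "\<exists>M. popular {..<n} edges prefers M"
  then show "encode_instance (pref_lists n R rk) \<in> popular_matching_problem"
    unfolding popular_matching_problem_def mem_Collect_eq
    using preference_graph_edges presents_pref_lists by metis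
qed

text \<open>Carries the votes of the numbered graph over to the gadget nodes: \<open>idx\<close> is
  to be the number of a node.\<close>

definition tie_vote :: "('v \<Rightarrow> nat) \<Rightarrow> ('v \<Rightarrow> 'v \<Rightarrow> nat) \<Rightarrow> 'v \<Rightarrow> 'v \<Rightarrow> 'v \<Rightarrow> int" where
  "tie_vote idx rank x y z =
     of_bool (rank x y < rank x z \<or> rank x y = rank x z \<and> idx y < idx z) -
     of_bool (rank x z < rank x y \<or> rank x z = rank x y \<and> idx z < idx y)"

theorem pref_lists_in_problem_iff:
  assumes h: "bij_betw h {..<n} V"
    and self: "\<And>x. rank x x = R"
    and sym: "\<And>x y. x \<in> V \<Longrightarrow> y \<in> V \<Longrightarrow> rank x y < R \<Longrightarrow> rank y x < R"
  shows "encode_instance (pref_lists n R (\<lambda>u v. rank (h u) (h v))) \<in> popular_matching_problem \<longleftrightarrow>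
    (\<exists>m. ranked_graph.popular_mating V R rank (tie_vote (inv_into {..<n} h) rank) m)"
proof -
  let ?rk = "\<lambda>u v. rank (h u) (h v)" and ?vote = "tie_vote (inv_into {..<n} h) rank"
  let ?g = "inv_into {..<n} h"
  have hV: "h u \<in> V" if "u < n" for u using h that by (auto simp: bij_betw_def)
  interpret W: presented_graph n R ?rk
    by standard (use self sym hV in auto)
  interpret V: ranked_graph V R rank ?vote
    using bij_betw_finite[OF h] by unfold_locales (auto simp: self sym tie_vote_def)
  have g: "?g (h u) = u" if "u < n" for u using h that by (auto simp: bij_betw_def)
  have hg: "h (?g x) = x" "?g x < n" if "x \<in> V" for x
    using that h f_inv_into_f[of x h "{..<n}"] inv_into_into[of x h "{..<n}"] by (auto simp: bij_betw_def)
  have vote: "W.vote u v w = ?vote (h u) (h v) (h w)" if "u < n" "v < n" "w < n" for u v w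
    using that by (simp add: W.vote_def W.prefers_def tie_vote_def g)
  have g_bij: "bij_betw ?g V {..<n}" by (rule bij_betw_inv_into[OF h])
  have "(\<exists>m. W.popular_mating m) \<longleftrightarrow> (\<exists>m. V.popular_mating m)"
  proof
    assume "\<exists>m. W.popular_mating m"
    then obtain m where "W.popular_mating m" ..
    then show "\<exists>m. V.popular_mating m"
      using popular_mating_transfer[OF V.ranked_graph_axioms W.ranked_graph_axioms h] vote by auto
  next
    assume "\<exists>m. V.popular_mating m"
    then obtain m where "V.popular_mating m" ..
    then show "\<exists>m. W.popular_mating m"
      using popular_mating_transfer[OF W.ranked_graph_axioms V.ranked_graph_axioms g_bij] vote hg by auto
  qed
  with W.in_problem_iff show ?thesis by simp
qed

section \<open>Computations as consistent labellings\<close>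

type_synonym trans = "nat \<times> nat list \<times> nat \<times> (nat \<times> head_move) list"

definition source :: "trans \<Rightarrow> nat" where "source \<delta> = fst \<delta>"
definition scanned :: "trans \<Rightarrow> nat list" where "scanned \<delta> = fst (snd \<delta>)"
definition target :: "trans \<Rightarrow> nat" where "target \<delta> = fst (snd (snd \<delta>))"
definition actions :: "trans \<Rightarrow> (nat \<times> head_move) list" where "actions \<delta> = snd (snd (snd \<delta>))"

definition fits :: "trans \<Rightarrow> config \<Rightarrow> bool" where
  "fits \<delta> c \<longleftrightarrow> fst c = source \<delta> \<and> map read_tape (snd c) = scanned \<delta>"

definition fire :: "trans \<Rightarrow> config \<Rightarrow> config" where
  "fire \<delta> c = (target \<delta>, map2 write_move (actions \<delta>) (snd c))"

text \<open>Tape contents are addressed relative to the head, so that no head positions need to be stored.\<close>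

definition content :: "config \<Rightarrow> nat \<Rightarrow> int \<Rightarrow> nat" where
  "content c k p = fst (snd c ! k) (snd (snd c ! k) + p)"

text \<open>The cells to the right and to the left of the head of tape \<open>k\<close> have the indices
  \<open>\<kappa> = 2 * k\<close> and \<open>\<kappa> = 2 * k + 1\<close>, respectively.\<close>

definition cell_pos :: "nat \<Rightarrow> nat \<Rightarrow> int" where
  "cell_pos \<kappa> j = (if even \<kappa> then int j else - 1 - int j)"

lemma step_fire: "step M c c' \<longleftrightarrow> (\<exists>\<delta>\<in>transitions M. fits \<delta> c \<and> c' = fire \<delta> c)"
proof
  assume "step M c c'"
  then obtain a where a: "(fst c, map read_tape (snd c), fst c', a) \<in> transitions M"
    "snd c' = map2 write_move a (snd c)" unfolding step_def by blast
  let ?\<delta> = "(fst c, map read_tape (snd c), fst c', a)"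
  have "fits ?\<delta> c" by (simp add: fits_def source_def scanned_def)
  moreover have "c' = fire ?\<delta> c" using a(2) by (simp add: prod_eq_iff fire_def target_def actions_def)
  ultimately show "\<exists>\<delta>\<in>transitions M. fits \<delta> c \<and> c' = fire \<delta> c" using a(1) by blast
next
  assume "\<exists>\<delta>\<in>transitions M. fits \<delta> c \<and> c' = fire \<delta> c"
  then obtain \<delta> where \<delta>: "\<delta> \<in> transitions M" "fits \<delta> c" "c' = fire \<delta> c" by blast
  then have "(fst c, map read_tape (snd c), fst c', actions \<delta>) \<in> transitions M"
    by (simp add: fits_def fire_def source_def scanned_def target_def actions_def)
  moreover have "snd c' = map2 write_move (actions \<delta>) (snd c)" using \<delta>(3) by (simp add: fire_def)
  ultimately show "step M c c'" unfolding step_def by blast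
qed

lemma content_fire:
  assumes "k < length (snd c)" "length (actions \<delta>) = length (snd c)"
  shows "content (fire \<delta> c) k p =
    (if p + offset (snd (actions \<delta> ! k)) = 0 then fst (actions \<delta> ! k)
     else content c k (p + offset (snd (actions \<delta> ! k))))"
proof -
  obtain f h where t: "snd c ! k = (f, h)" by fastforce
  obtain s d where a: "actions \<delta> ! k = (s, d)" by fastforce
  show ?thesis using assms by (auto simp: content_def fire_def t a algebra_simps)
qed

text \<open>A label is the index of a pair of a transition and a symbol. The added idle transitions
  repeat a halted accepting configuration; they pad an accepting run to any length, and an idle
  transition at the last time expresses acceptance. \<open>S\<close> exceeds the written symbols and
  also the symbols 0, 1, 2 of the initial tapes.\<close>

locale machine_labels =
  fixes M :: turing_machine and S :: nat and labs :: "(trans \<times> nat) list"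
  assumes wf: "wf_tm M" and S: "S \<ge> 3"
    and written: "\<And>\<delta> a. \<delta> \<in> transitions M \<Longrightarrow> a \<in> set (actions \<delta>) \<Longrightarrow> fst a < S"
    and labs: "set labs =
      ({\<delta> \<in> transitions M. set (scanned \<delta>) \<subseteq> {..<S}} \<union>
       {(accept M, r, accept M, map (\<lambda>s. (s, Stay)) r) | r. length r = tapes M \<and> set r \<subseteq> {..<S} \<and>
          \<not> (\<exists>q a. (accept M, r, q, a) \<in> transitions M)}) \<times> {..<S}"
begin

abbreviation "K \<equiv> tapes M"

definition idles :: "trans set" where
  "idles = {(accept M, r, accept M, map (\<lambda>s. (s, Stay)) r) | r. length r = K \<and> set r \<subseteq> {..<S} \<and>
     \<not> (\<exists>q a. (accept M, r, q, a) \<in> transitions M)}"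

definition available :: "trans set" where
  "available = {\<delta> \<in> transitions M. set (scanned \<delta>) \<subseteq> {..<S}} \<union> idles"

lemma set_labs: "set labs = available \<times> {..<S}"
  by (simp add: labs available_def idles_def)

text \<open>The constraints on a single cell. They are imposed through the pair formed by the two
  labels of the same cell.\<close>

definition admissible :: "bool list \<Rightarrow> nat \<Rightarrow> nat \<Rightarrow> nat \<Rightarrow> nat \<Rightarrow> trans \<Rightarrow> nat \<Rightarrow> bool" where
  "admissible w N \<kappa> t j \<delta> s \<longleftrightarrow>
     (cell_pos \<kappa> j = 0 \<longrightarrow> s = scanned \<delta> ! (\<kappa> div 2)) \<and>
     (t = 0 \<longrightarrow> source \<delta> = start M \<and> s = (if \<kappa> = 0 then word_contents w (int j) else 0)) \<and>
     (Suc t = N \<longrightarrow> \<delta> \<in> idles)"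

text \<open>At equal times, distinct cells are compared only by their transitions, which makes the
  transition a function of time. For consecutive times, adding the head move turns an address
  relative to the new head into one relative to the old head.\<close>

definition conflict :: "bool list \<Rightarrow> nat \<Rightarrow> nat \<times> nat \<times> nat \<Rightarrow> nat \<Rightarrow> nat \<times> nat \<times> nat \<Rightarrow> nat \<Rightarrow> bool" where
  "conflict w N = (\<lambda>(\<kappa>, t, j) l (\<kappa>', t', j') l'.
     (case (labs ! l, labs ! l') of ((\<delta>, s), (\<delta>', s')) \<Rightarrow>
       t' = t \<and> (\<delta>' \<noteq> \<delta> \<or> \<kappa>' = \<kappa> \<and> j' = j \<and> (s' \<noteq> s \<or> \<not> admissible w N \<kappa> t j \<delta> s)) \<or>
       t' = Suc t \<and> (source \<delta>' \<noteq> target \<delta> \<or>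
         \<kappa>' div 2 = \<kappa> div 2 \<and> cell_pos \<kappa> j = cell_pos \<kappa>' j' + offset (snd (actions \<delta> ! (\<kappa> div 2))) \<and>
         s' \<noteq> (if cell_pos \<kappa> j = 0 then fst (actions \<delta> ! (\<kappa> div 2)) else s))))"

definition cells :: "nat \<Rightarrow> (nat \<times> nat \<times> nat) set" where
  "cells N = {..<2 * K} \<times> {..<N} \<times> {..<N}"

lemma cellsE:
  assumes "x \<in> cells N"
  obtains \<kappa> t j where "x = (\<kappa>, t, j)" "\<kappa> div 2 < K" "t < N"
proof -
  obtain \<kappa> t j where x: "x = (\<kappa>, t, j)" by (cases x)
  with assms have "\<kappa> < 2 * K" "t < N" by (auto simp: cells_def)
  then have "\<kappa> div 2 < K" by linarith
  with x \<open>t < N\<close> that show thesis by blast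
qed

definition labelling :: "bool list \<Rightarrow> nat \<Rightarrow> (nat \<times> nat \<times> nat \<Rightarrow> nat) \<Rightarrow> (nat \<times> nat \<times> nat \<Rightarrow> nat) \<Rightarrow> bool" where
  "labelling w N f g \<longleftrightarrow> (\<forall>c\<in>cells N. f c < length labs \<and> g c < length labs) \<and>
     (\<forall>q\<in>cells N. \<forall>c\<in>cells N. \<not> conflict w N q (g q) c (f c))"

definition bounded :: "config \<Rightarrow> bool" where
  "bounded c \<longleftrightarrow> length (snd c) = K \<and> (\<forall>k<K. \<forall>i. fst (snd c ! k) i < S)"

lemma K_pos: "K \<ge> 1"
  using wf by (simp add: wf_tm_def)

lemma lengths: "\<delta> \<in> available \<Longrightarrow> length (scanned \<delta>) = K \<and> length (actions \<delta>) = K"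
  using wf by (auto simp: available_def idles_def wf_tm_def scanned_def actions_def)

lemma fire_idle:
  assumes "\<delta> \<in> idles" "fits \<delta> c"
  shows "fire \<delta> c = c" "halted M c" "fst c = accept M"
proof -
  obtain r where r: "\<delta> = (accept M, r, accept M, map (\<lambda>s. (s, Stay)) r)"
    "\<not> (\<exists>q a. (accept M, r, q, a) \<in> transitions M)"
    using assms(1) by (auto simp: idles_def)
  have c: "fst c = accept M" "r = map read_tape (snd c)"
    using assms(2) r(1) by (auto simp: fits_def source_def scanned_def)
  have wm: "write_move (read_tape x, Stay) x = x" for x by (cases x) auto
  then show "fire \<delta> c = c"
    unfolding r(1) fire_def actions_def target_def c(2)
    by (cases c) (use c(1) in \<open>auto simp: o_def wm intro!: nth_equalityI\<close>)
  show "fst c = accept M" by (rule c(1))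
  show "halted M c" using r(2) unfolding c(2) by (simp add: halted_def step_def c(1))
qed

lemma step_of_fire:
  assumes "\<delta> \<in> available" "fits \<delta> c"
  shows "(step M)\<^sup>*\<^sup>* c (fire \<delta> c)"
proof (cases "\<delta> \<in> idles")
  case True
  then show ?thesis using fire_idle(1)[OF True assms(2)] by simp
next
  case False
  then have "step M c (fire \<delta> c)" using assms step_fire by (auto simp: available_def)
  then show ?thesis by blast
qed

lemma bounded_init: "bounded (init_config M w)"
  using S K_pos by (auto simp: bounded_def init_config_def word_contents_def nth_Cons')

lemma bounded_fire:
  assumes "bounded c" "\<delta> \<in> transitions M"
  shows "bounded (fire \<delta> c)"
  unfolding bounded_def
proof (intro conjI allI impI)
  have len: "length (actions \<delta>) = K" using wf assms(2) by (auto simp: wf_tm_def actions_def)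
  then show "length (snd (fire \<delta> c)) = K" using assms(1) by (simp add: fire_def bounded_def)
  fix k i assume k: "k < K"
  obtain f h where t: "snd c ! k = (f, h)" by fastforce
  obtain s d where a: "actions \<delta> ! k = (s, d)" by fastforce
  have "(s, d) \<in> set (actions \<delta>)" using a k len by (metis nth_mem)
  then have "s < S" using written[OF assms(2)] by force
  moreover have "f i < S" using assms(1) k t unfolding bounded_def by (metis fst_conv)
  ultimately show "fst (snd (fire \<delta> c) ! k) i < S"
    using assms(1) len k by (simp add: fire_def bounded_def t a)
qed

lemma labelling_of_accepting:
  assumes acc: "accepts M w" and N: "\<And>n c. (step M ^^ n) (init_config M w) c \<Longrightarrow> n < N"
  shows "\<exists>f g. labelling w N f g"
proof -
  obtain c n where c: "(step M ^^ n) (init_config M w) c" "halted M c" "fst c = accept M"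
    using acc by (auto simp: accepts_def dest: rtranclp_imp_relpowp)
  have n: "n < N" by (rule N[OF c(1)])
  obtain run where run: "run 0 = init_config M w" "run n = c" "\<And>i. i < n \<Longrightarrow> step M (run i) (run (Suc i))"
    using c(1) by (auto simp: relpowp_fun_conv)
  \<comment> \<open>After its last step the run is frozen in the final accepting configuration,
    where idle transitions fire.\<close>
  define cfg where "cfg t = run (min t n)" for t
  have bounded: "bounded (cfg t)" for t
  proof (induction t)
    case 0
    then show ?case using run(1) bounded_init by (simp add: cfg_def)
  next
    case (Suc t)
    show ?case
    proof (cases "t < n")
      case True
      then obtain \<delta> where "\<delta> \<in> transitions M" "run (Suc t) = fire \<delta> (run t)"
        using run(3) step_fire by blast
      then show ?thesis using Suc True bounded_fire by (simp add: cfg_def min_def)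
    qed (use Suc in \<open>auto simp: cfg_def min_def split: if_splits\<close>)
  qed
  have reads: "set (map read_tape (snd (cfg t))) \<subseteq> {..<S}" for t
  proof
    fix a assume "a \<in> set (map read_tape (snd (cfg t)))"
    then obtain k where k: "k < length (snd (cfg t))" "a = read_tape (snd (cfg t) ! k)"
      by (auto simp: in_set_conv_nth)
    obtain f h where "snd (cfg t) ! k = (f, h)" by fastforce
    then have "f h < S" using bounded[of t] k(1) unfolding bounded_def by (metis fst_conv)
    then show "a \<in> {..<S}" using k(2) \<open>snd (cfg t) ! k = (f, h)\<close> by simp
  qed
  have "\<exists>\<delta>. \<delta> \<in> available \<and> fits \<delta> (cfg t) \<and> cfg (Suc t) = fire \<delta> (cfg t) \<and> (n \<le> t \<longrightarrow> \<delta> \<in> idles)" for t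
  proof (cases "t < n")
    case True
    then obtain \<delta> where d: "\<delta> \<in> transitions M" "fits \<delta> (run t)" "run (Suc t) = fire \<delta> (run t)"
      using run(3) step_fire by blast
    have "set (scanned \<delta>) \<subseteq> {..<S}" using reads[of t] d(2) True by (simp add: cfg_def fits_def del: set_map)
    then show ?thesis using d True by (intro exI[of _ \<delta>]) (auto simp: cfg_def available_def)
  next
    case False
    let ?r = "map read_tape (snd c)"
    let ?\<delta> = "(accept M, ?r, accept M, map (\<lambda>s. (s, Stay)) ?r)"
    have cfg: "cfg t = c" "cfg (Suc t) = c" using False run(2) by (auto simp: cfg_def min_def)
    have "\<not> (\<exists>q a. (accept M, ?r, q, a) \<in> transitions M)"
    proof
      assume "\<exists>q a. (accept M, ?r, q, a) \<in> transitions M"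
      then obtain q a where qa: "(accept M, ?r, q, a) \<in> transitions M" by blast
      have "fits (accept M, ?r, q, a) c" by (simp add: fits_def source_def scanned_def c(3))
      then have "step M c (fire (accept M, ?r, q, a) c)" using qa step_fire by blast
      with c(2) show False unfolding halted_def by blast
    qed
    moreover have "set ?r \<subseteq> {..<S}" using reads[of t] unfolding cfg .
    moreover have "length ?r = K" using bounded[of t] cfg by (simp add: bounded_def)
    ultimately have idle: "?\<delta> \<in> idles" unfolding idles_def by blast
    moreover have "fits ?\<delta> c" by (simp add: fits_def source_def scanned_def c(3))
    ultimately show ?thesis
      using fire_idle(1)[of ?\<delta> c] cfg by (intro exI[of _ ?\<delta>]) (simp add: available_def)
  qed
  then obtain \<delta> where \<delta>: "\<And>t. \<delta> t \<in> available" "\<And>t. fits (\<delta> t) (cfg t)"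
    "\<And>t. cfg (Suc t) = fire (\<delta> t) (cfg t)" "\<And>t. n \<le> t \<Longrightarrow> \<delta> t \<in> idles"
    by metis
  define lab where "lab = (\<lambda>(\<kappa>, t, j). (\<delta> t, content (cfg t) (\<kappa> div 2) (cell_pos \<kappa> j)))"
  have "\<exists>l<length labs. labs ! l = lab x" if x_in: "x \<in> cells N" for x
  proof -
    obtain \<kappa> t j where x: "x = (\<kappa>, t, j)" "\<kappa> div 2 < K" by (rule cellsE[OF x_in])
    have "lab x \<in> set labs"
      using bounded[of t] \<delta>(1)[of t] x by (auto simp: set_labs lab_def content_def bounded_def)
    then show ?thesis by (metis in_set_conv_nth)
  qed
  then obtain f where f: "\<And>x. x \<in> cells N \<Longrightarrow> f x < length labs \<and> labs ! f x = lab x" by metis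
  have "\<not> conflict w N q (f q) x (f x)" if qx: "q \<in> cells N" "x \<in> cells N" for q x
  proof -
    obtain \<kappa> t j where q: "q = (\<kappa>, t, j)" "\<kappa> div 2 < K" "t < N" by (rule cellsE[OF qx(1)])
    obtain \<kappa>' t' j' where x: "x = (\<kappa>', t', j')" "\<kappa>' div 2 < K" by (rule cellsE[OF qx(2)])
    have len: "length (snd (cfg t)) = K" using bounded[of t] by (simp add: bounded_def)
    have init: "content (cfg 0) (\<kappa> div 2) (cell_pos \<kappa> j) = (if \<kappa> = 0 then word_contents w (int j) else 0)"
      using q(2) by (auto simp: cfg_def run(1) content_def init_config_def nth_Cons' word_contents_def cell_pos_def
          split: if_splits)
    have src: "source (\<delta> 0) = start M"
      using \<delta>(2)[of 0] run(1) by (simp add: fits_def cfg_def init_config_def)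
    have "scanned (\<delta> t) ! (\<kappa> div 2) = content (cfg t) (\<kappa> div 2) 0"
    proof -
      have "scanned (\<delta> t) = map read_tape (snd (cfg t))" using \<delta>(2)[of t] by (simp add: fits_def)
      then show ?thesis using q(2) len by (cases "snd (cfg t) ! (\<kappa> div 2)") (simp add: content_def)
    qed
    then have adm: "admissible w N \<kappa> t j (\<delta> t) (content (cfg t) (\<kappa> div 2) (cell_pos \<kappa> j))"
      using init src \<delta>(4)[of t] n by (auto simp: admissible_def)
    have "source (\<delta> (Suc t)) = target (\<delta> t)"
      using \<delta>(2)[of "Suc t"] \<delta>(3)[of t] by (simp add: fits_def fire_def)
    moreover have "content (cfg (Suc t)) (\<kappa> div 2) p =
      (if p + offset (snd (actions (\<delta> t) ! (\<kappa> div 2))) = 0 then fst (actions (\<delta> t) ! (\<kappa> div 2))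
       else content (cfg t) (\<kappa> div 2) (p + offset (snd (actions (\<delta> t) ! (\<kappa> div 2)))))" for p
      unfolding \<delta>(3) using q(2) len lengths[OF \<delta>(1)[of t]] by (intro content_fire) auto
    ultimately show ?thesis
      using f[OF qx(1)] f[OF qx(2)] adm by (auto simp: conflict_def q(1) x(1) lab_def)
  qed
  with f show ?thesis unfolding labelling_def by blast
qed

lemma accepting_of_labelling:
  assumes lab: "labelling w N f g" and N: "N \<ge> 1"
  shows "accepts M w"
proof -
  define D where "D t = fst (labs ! f (0, t, 0))" for t
  define u where "u t \<kappa> j = snd (labs ! f (\<kappa>, t, j))" for t \<kappa> j
  have inn: "(\<kappa>, t, j) \<in> cells N" if "\<kappa> < 2 * K" "t < N" "j < N" for \<kappa> t j
    using that by (simp add: cells_def)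
  have K: "0 < 2 * K" using K_pos by simp
  have no: "\<not> conflict w N q (g q) x (f x)" if "q \<in> cells N" "x \<in> cells N" for q x
    using lab that by (auto simp: labelling_def)
  \<comment> \<open>Every cell is compared with the cell \<open>(0, t, 0)\<close>, so all
    transitions at time \<open>t\<close> equal \<open>D t\<close>.\<close>
  have g0: "fst (labs ! g (\<kappa>, t, j)) = D t" if "\<kappa> < 2 * K" "t < N" "j < N" for \<kappa> t j
    using no[OF inn[OF that] inn[OF K that(2), of 0]] that(3) by (auto simp: conflict_def D_def split: prod.splits)
  have f0: "fst (labs ! f (\<kappa>, t, j)) = D t" if "\<kappa> < 2 * K" "t < N" "j < N" for \<kappa> t j
    using no[OF inn[OF that] inn[OF that]] g0[OF that] by (auto simp: conflict_def split: prod.splits)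
  have lg: "labs ! g (\<kappa>, t, j) = (D t, u t \<kappa> j)" "labs ! f (\<kappa>, t, j) = (D t, u t \<kappa> j)"
    "admissible w N \<kappa> t j (D t) (u t \<kappa> j)" if "\<kappa> < 2 * K" "t < N" "j < N" for \<kappa> t j
    using no[OF inn[OF that] inn[OF that]] g0[OF that] f0[OF that]
    by (auto simp: conflict_def u_def split: prod.splits)
  have D: "D t \<in> available" if "t < N" for t
  proof -
    have "labs ! f (0, t, 0) \<in> set labs"
      using lab inn[OF K that, of 0] that unfolding labelling_def by (intro nth_mem) auto
    then show ?thesis unfolding set_labs D_def by auto
  qed
  have next_source: "source (D (Suc t)) = target (D t)" if "Suc t < N" for t
    using no[OF inn[OF K, of t 0] inn[OF K, of "Suc t" 0]] lg[OF K, of t 0] lg[OF K, of "Suc t" 0] that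
    by (auto simp: conflict_def)
  have next_symbol: "u (Suc t) \<kappa>' j' = (if cell_pos \<kappa> j = 0 then fst (actions (D t) ! (\<kappa> div 2)) else u t \<kappa> j)"
    if "Suc t < N" "\<kappa> < 2 * K" "\<kappa>' < 2 * K" "j < N" "j' < N" "\<kappa>' div 2 = \<kappa> div 2"
      "cell_pos \<kappa> j = cell_pos \<kappa>' j' + offset (snd (actions (D t) ! (\<kappa> div 2)))" for t \<kappa> \<kappa>' j j'
    using no[OF inn[of \<kappa> t j] inn[of \<kappa>' "Suc t" j']] lg[of \<kappa> t j] lg[of \<kappa>' "Suc t" j'] that
    by (auto simp: conflict_def)
  have fits: "fits (D t) c"
    if t: "t < N" and c: "fst c = source (D t)" "length (snd c) = K"
      "\<And>k. k < K \<Longrightarrow> u t (2 * k) 0 = content c k 0" for t c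
  proof -
    have "map read_tape (snd c) = scanned (D t)"
    proof (rule nth_equalityI)
      show "length (map read_tape (snd c)) = length (scanned (D t))" using lengths[OF D[OF t]] c(2) by simp
      fix k assume "k < length (map read_tape (snd c))"
      then have k: "k < K" using c(2) by simp
      then have "scanned (D t) ! k = content c k 0"
        using lg(3)[of "2 * k" t 0] t c(3) by (simp add: admissible_def cell_pos_def)
      then show "map read_tape (snd c) ! k = scanned (D t) ! k"
        using k c(2) by (cases "snd c ! k") (simp add: content_def)
    qed
    with c(1) show ?thesis by (simp add: fits_def)
  qed
  \<comment> \<open>The cells at the border of the diagram may have no predecessor in it. The labels
    are therefore trusted only within a cone that shrinks by one cell per step; at time N - 1 it
    still contains the cells under the heads.\<close>
  have "\<exists>c. (step M)\<^sup>*\<^sup>* (init_config M w) c \<and> fst c = source (D t) \<and> length (snd c) = K \<and>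
      (\<forall>\<kappa><2 * K. \<forall>j<N. \<bar>cell_pos \<kappa> j\<bar> + int t < int N \<longrightarrow> u t \<kappa> j = content c (\<kappa> div 2) (cell_pos \<kappa> j))"
    if "t < N" for t
    using that
  proof (induction t)
    case 0
    have "u 0 \<kappa> j = content (init_config M w) (\<kappa> div 2) (cell_pos \<kappa> j)" if "\<kappa> < 2 * K" "j < N" for \<kappa> j
    proof -
      have "u 0 \<kappa> j = (if \<kappa> = 0 then word_contents w (int j) else 0)"
        using lg(3)[of \<kappa> 0 j] that 0 by (simp add: admissible_def)
      also have "\<dots> = content (init_config M w) (\<kappa> div 2) (cell_pos \<kappa> j)"
        using that by (auto simp: content_def init_config_def nth_Cons' word_contents_def cell_pos_def
          split: if_splits)
      finally show ?thesis .
    qed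
    moreover have "source (D 0) = start M" using lg(3)[of 0 0 0] K 0 by (simp add: admissible_def)
    ultimately show ?case
      using K_pos by (intro exI[of _ "init_config M w"]) (auto simp: init_config_def)
  next
    case (Suc t)
    then obtain c where c: "(step M)\<^sup>*\<^sup>* (init_config M w) c" "fst c = source (D t)" "length (snd c) = K"
      and u: "\<And>\<kappa> j. \<kappa> < 2 * K \<Longrightarrow> j < N \<Longrightarrow> \<bar>cell_pos \<kappa> j\<bar> + int t < int N \<Longrightarrow>
        u t \<kappa> j = content c (\<kappa> div 2) (cell_pos \<kappa> j)"
      by auto
    have tN: "t < N" using Suc.prems by simp
    have fit: "fits (D t) c"
      using u[of "2 * _" 0] tN by (intro fits[OF tN c(2,3)]) (auto simp: cell_pos_def)
    let ?c = "fire (D t) c"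
    have len: "length (actions (D t)) = length (snd c)" using lengths[OF D[OF tN]] c(3) by simp
    have "u (Suc t) \<kappa>' j' = content ?c (\<kappa>' div 2) (cell_pos \<kappa>' j')"
      if k: "\<kappa>' < 2 * K" "j' < N" "\<bar>cell_pos \<kappa>' j'\<bar> + int (Suc t) < int N" for \<kappa>' j'
    proof -
      define p where "p = cell_pos \<kappa>' j' + offset (snd (actions (D t) ! (\<kappa>' div 2)))"
      \<comment> \<open>\<open>\<kappa>\<close> and \<open>j\<close> invert \<open>cell_pos\<close>:
        they are the half of the tape and the index of the old address \<open>p\<close>.\<close>
      define \<kappa> where "\<kappa> = (if p \<ge> 0 then 2 * (\<kappa>' div 2) else 2 * (\<kappa>' div 2) + 1)"
      define j where "j = nat (if p \<ge> 0 then p else - 1 - p)"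
      have p: "\<bar>p\<bar> + int t < int N"
        using k(3) unfolding p_def by (cases "snd (actions (D t) ! (\<kappa>' div 2))") auto
      have "\<kappa>' div 2 < K" using k(1) by linarith
      then have "\<kappa> < 2 * K" by (simp add: \<kappa>_def)
      then have \<kappa>: "\<kappa> < 2 * K" "\<kappa> div 2 = \<kappa>' div 2" "cell_pos \<kappa> j = p" "j < N"
        using p by (auto simp: \<kappa>_def j_def cell_pos_def)
      have "u (Suc t) \<kappa>' j' = (if p = 0 then fst (actions (D t) ! (\<kappa>' div 2)) else u t \<kappa> j)"
        using next_symbol[OF Suc.prems \<kappa>(1) k(1) \<kappa>(4) k(2)] \<kappa>(2,3) p_def by simp
      also have "u t \<kappa> j = content c (\<kappa>' div 2) p" using u[OF \<kappa>(1,4)] \<kappa>(2,3) p by simp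
      finally show ?thesis
        using content_fire[OF _ len, of "\<kappa>' div 2" "cell_pos \<kappa>' j'"] k(1) c(3) p_def by simp
    qed
    moreover have "(step M)\<^sup>*\<^sup>* (init_config M w) ?c"
      using c(1) step_of_fire[OF D[OF tN] fit] by (rule rtranclp_trans)
    ultimately show ?case
      using next_source[OF Suc.prems] len c(3) by (intro exI[of _ ?c]) (auto simp: fire_def)
  qed
  from this[of "N - 1"] N obtain c where c: "(step M)\<^sup>*\<^sup>* (init_config M w) c" "fst c = source (D (N - 1))" "length (snd c) = K"
      and u: "\<And>\<kappa> j. \<kappa> < 2 * K \<Longrightarrow> j < N \<Longrightarrow> \<bar>cell_pos \<kappa> j\<bar> + int (N - 1) < int N \<Longrightarrow>
        u (N - 1) \<kappa> j = content c (\<kappa> div 2) (cell_pos \<kappa> j)"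
    by auto
  have NN: "N - 1 < N" using N by simp
  have "fits (D (N - 1)) c"
    using u[of "2 * _" 0] NN by (intro fits[OF NN c(2,3)]) (auto simp: cell_pos_def)
  moreover have "D (N - 1) \<in> idles" using lg(3)[OF K NN, of 0] N by (simp add: admissible_def)
  ultimately show ?thesis using fire_idle(2,3) c(1) unfolding accepts_def by blast
qed

lemma accepts_iff_labelling:
  assumes "\<And>n c. (step M ^^ n) (init_config M w) c \<Longrightarrow> n < N" "N \<ge> 1"
  shows "accepts M w \<longleftrightarrow> (\<exists>f g. labelling w N f g)"
proof
  assume "accepts M w"
  then show "\<exists>f g. labelling w N f g" by (rule labelling_of_accepting) (rule assms(1))
next
  assume "\<exists>f g. labelling w N f g"
  then show "accepts M w" using accepting_of_labelling assms(2) by blast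
qed

text \<open>The gadget needs at least one label. In the accepting state with blanks under all heads,
  there is either a transition or an idle one.\<close>

lemma labs_nonempty: "labs \<noteq> []"
proof -
  let ?r = "replicate K (0 :: nat)"
  have r: "length ?r = K" "set ?r \<subseteq> {..<S}" using S by (simp_all add: set_replicate_conv_if)
  have "available \<noteq> {}"
  proof (cases "\<exists>q a. (accept M, ?r, q, a) \<in> transitions M")
    case True
    then obtain q a where "(accept M, ?r, q, a) \<in> transitions M" by blast
    then have "(accept M, ?r, q, a) \<in> available" using r(2) by (simp add: available_def scanned_def)
    then show ?thesis by blast
  next
    case False
    then have "(accept M, ?r, accept M, map (\<lambda>s. (s, Stay)) ?r) \<in> idles" using r unfolding idles_def by blast
    then show ?thesis unfolding available_def by blast
  qed
  then obtain \<delta> where "\<delta> \<in> available" by blast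
  then have "(\<delta>, 0) \<in> set labs" using S by (simp add: set_labs)
  then show ?thesis by force
qed

end

lemma ex_machine_labels:
  assumes "wf_tm M"
  shows "\<exists>S labs. machine_labels M S labs"
proof -
  let ?W = "\<Union>\<delta>\<in>transitions M. fst ` set (actions \<delta>)"
  have fin: "finite (transitions M)" using assms by (simp add: wf_tm_def)
  then have "finite ?W" by simp
  then obtain b where b: "\<forall>s\<in>?W. s \<le> b" unfolding finite_nat_set_iff_bounded_le by blast
  define S where "S = max 3 (Suc b)"
  let ?R = "{r. length r = tapes M \<and> set r \<subseteq> {..<S} \<and> \<not> (\<exists>q a. (accept M, r, q, a) \<in> transitions M)}"
  have "finite {r. set r \<subseteq> {..<S} \<and> length r = tapes M}" by (rule finite_lists_length_eq) simp
  then have "finite ?R" by (rule rev_finite_subset) blast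
  then have "finite {(accept M, r, accept M, map (\<lambda>s. (s, Stay)) r) | r. length r = tapes M \<and> set r \<subseteq> {..<S} \<and>
      \<not> (\<exists>q a. (accept M, r, q, a) \<in> transitions M)}"
    unfolding setcompr_eq_image by (rule finite_imageI)
  moreover have "finite {\<delta> \<in> transitions M. set (scanned \<delta>) \<subseteq> {..<S}}" using fin by simp
  ultimately have "finite (({\<delta> \<in> transitions M. set (scanned \<delta>) \<subseteq> {..<S}} \<union>
       {(accept M, r, accept M, map (\<lambda>s. (s, Stay)) r) | r. length r = tapes M \<and> set r \<subseteq> {..<S} \<and>
          \<not> (\<exists>q a. (accept M, r, q, a) \<in> transitions M)}) \<times> {..<S})"
    by (intro finite_cartesian_product finite_UnI finite_lessThan)
  from finite_list[OF this] obtain labs where labs: "set labs = ({\<delta> \<in> transitions M. set (scanned \<delta>) \<subseteq> {..<S}} \<union>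
       {(accept M, r, accept M, map (\<lambda>s. (s, Stay)) r) | r. length r = tapes M \<and> set r \<subseteq> {..<S} \<and>
          \<not> (\<exists>q a. (accept M, r, q, a) \<in> transitions M)}) \<times> {..<S}" by (elim exE)
  have "fst a < S" if "\<delta> \<in> transitions M" "a \<in> set (actions \<delta>)" for \<delta> a
  proof -
    have "fst a \<in> ?W" using that by blast
    with b have "fst a \<le> b" by blast
    then show ?thesis by (simp add: S_def)
  qed
  then have "machine_labels M S labs"
    by (intro machine_labels.intro assms labs) (simp_all add: S_def)
  then show ?thesis by (intro exI)
qed

section \<open>The reduction\<close>

text \<open>Rulers have lengths of this form, so the time bound has to be brought below such a
  power; the conditions on \<open>c\<close> and \<open>d\<close> keep the length at least 2.\<close>

lemma poly_less_power:
  fixes p :: "nat poly"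
  shows "\<exists>c d. c \<ge> 2 \<and> d \<ge> 1 \<and> (\<forall>n. poly p n < (n + c) ^ d)"
proof (induction p)
  case 0
  show ?case by (intro exI[of _ 2] exI[of _ 1]) auto
next
  case (pCons a q)
  then obtain c d where cd: "c \<ge> 2" "d \<ge> 1" "\<And>n. poly q n < (n + c) ^ d" by blast
  have "poly (pCons a q) n < (n + (c + a)) ^ Suc d" for n
  proof -
    have "poly (pCons a q) n \<le> a + n * (n + c) ^ d" using cd(3)[of n] by simp
    also have "\<dots> \<le> a * (n + (c + a)) ^ d + n * (n + (c + a)) ^ d"
      using cd(1) by (intro add_mono mult_mono power_mono) auto
    also have "\<dots> < (n + (c + a)) ^ Suc d" using cd(1) by (simp add: algebra_simps)
    finally show ?thesis .
  qed
  then show ?case using cd(1,2) by (intro exI[of _ "c + a"] exI[of _ "Suc d"]) auto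
qed

section \<open>Ranks depend on observations only\<close>

lemma gadget_rank_cong:
  assumes "c1' = c1 \<longleftrightarrow> c2' = c2" "c1 = o1 \<longleftrightarrow> c2 = o1" "c1' = o1 \<longleftrightarrow> c2' = o1"
    and "conf1 c1 s c1' s' \<longleftrightarrow> conf2 c2 s c2' s'" "conf1 c1' s' c1 s \<longleftrightarrow> conf2 c2' s' c2 s"
  shows "gadget_rank o1 L conf1 (\<rho>, c1, s) (\<rho>', c1', s') = gadget_rank o1 L conf2 (\<rho>, c2, s) (\<rho>', c2', s')"
  using assms by (cases \<rho>) (simp_all add: gadget_rank.simps)

lemma cell_pos_cong:
  assumes "j1' = j1 \<longleftrightarrow> j2' = j2" "j1' = Suc j1 \<longleftrightarrow> j2' = Suc j2" "j1 = Suc j1' \<longleftrightarrow> j2 = Suc j2'"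
    and "j1 = 0 \<longleftrightarrow> j2 = 0" "j1' = 0 \<longleftrightarrow> j2' = 0"
  shows "cell_pos \<kappa> j1 = cell_pos \<kappa>' j1' + offset h \<longleftrightarrow> cell_pos \<kappa> j2 = cell_pos \<kappa>' j2' + offset h"
  using assms by (cases h; cases "even \<kappa>"; cases "even \<kappa>'"; simp add: cell_pos_def; presburger)

lemma cell_pos_0_cong: "j1 = 0 \<longleftrightarrow> j2 = 0 \<Longrightarrow> cell_pos \<kappa> j1 = 0 \<longleftrightarrow> cell_pos \<kappa> j2 = 0"
  by (simp add: cell_pos_def)

text \<open>The two sides may concern different inputs and different sizes. The input letter enters
  only through \<open>admissible\<close>, which is tested on a cell paired with itself; hence
  agreement is required only for equal indices.\<close>

lemma (in machine_labels) conflict_cong: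
  assumes t: "t1' = t1 \<longleftrightarrow> t2' = t2" "t1' = Suc t1 \<longleftrightarrow> t2' = Suc t2" "t1 = 0 \<longleftrightarrow> t2 = 0" "Suc t1 = N1 \<longleftrightarrow> Suc t2 = N2"
    and j: "j1' = j1 \<longleftrightarrow> j2' = j2" "j1' = Suc j1 \<longleftrightarrow> j2' = Suc j2" "j1 = Suc j1' \<longleftrightarrow> j2 = Suc j2'"
      "j1 = 0 \<longleftrightarrow> j2 = 0" "j1' = 0 \<longleftrightarrow> j2' = 0"
    and letter: "j1' = j1 \<Longrightarrow> word_contents w1 (int j1) = word_contents w2 (int j2)"
  shows "conflict w1 N1 (\<kappa>, t1, j1) l (\<kappa>', t1', j1') l' \<longleftrightarrow> conflict w2 N2 (\<kappa>, t2, j2) l (\<kappa>', t2', j2') l'"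
proof -
  obtain \<delta> s \<delta>' s' where l: "labs ! l = (\<delta>, s)" "labs ! l' = (\<delta>', s')" by fastforce
  have adm: "admissible w1 N1 \<kappa> t1 j1 \<delta> s \<longleftrightarrow> admissible w2 N2 \<kappa> t2 j2 \<delta> s" if "j1' = j1"
    using t(3,4) letter[OF that] cell_pos_0_cong[OF j(4)] by (simp add: admissible_def)
  note pos = cell_pos_cong[OF j, of \<kappa> \<kappa>' "snd (actions \<delta> ! (\<kappa> div 2))"] cell_pos_0_cong[OF j(4), of \<kappa>]
  show ?thesis
  proof (cases "j1' = j1")
    case True
    show ?thesis unfolding conflict_def prod.case l t(1,2) j(1) pos adm[OF True] by (rule refl)
  next
    case False
    then have "j2' \<noteq> j2" using j(1) by simp
    then show ?thesis unfolding conflict_def prod.case l t(1,2) pos by (simp add: False)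
  qed
qed

lemma ruler_first: "t < N \<Longrightarrow> t = 0 \<longleftrightarrow> ruler N (int t) = 1"
  by (auto simp: ruler_def)

text \<open>The bound 2 matters: on a ruler of length 1 the only cell carries the mark 1.\<close>

lemma ruler_last: "N \<ge> 2 \<Longrightarrow> t < N \<Longrightarrow> Suc t = N \<longleftrightarrow> ruler N (int t) = 3"
  by (auto simp: ruler_def)

lemma ticks_eqD:
  assumes "ticks (int b1 - int a1) = ticks (int b2 - int a2)"
  shows "b1 = a1 \<longleftrightarrow> b2 = a2" "b1 = Suc a1 \<longleftrightarrow> b2 = Suc a2" "a1 = Suc b1 \<longleftrightarrow> a2 = Suc b2"
  using assms by (auto simp: ticks_def split: if_splits)

section \<open>Numbering of the nodes and the reduction function\<close>

context machine_labels
begin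

definition roles :: "role list" where
  "roles = [XA, XB, XA', XB', XS, XP, XQ, YA, YB, YA', YB', YS, YP, YQ, D0, D1, D2, D3]"

text \<open>The part of a node whose range does not depend on the input. The program is unrolled
  over the indices of this list and loops over the coordinates t and j.\<close>

definition kinds :: "(role \<times> nat \<times> nat) list" where
  "kinds = List.product roles (List.product [0..<2 * K] [0..<length labs])"

definition node :: "nat \<Rightarrow> nat \<Rightarrow> nat \<Rightarrow> (nat \<times> nat \<times> nat) vertex" where
  "node z t j = (case kinds ! z of (\<rho>, \<kappa>, s) \<Rightarrow> (\<rho>, (\<kappa>, t, j), s))"

definition node_of_number :: "nat \<Rightarrow> nat \<Rightarrow> (nat \<times> nat \<times> nat) vertex" where
  "node_of_number N u = node (u div (N * N)) (u div N mod N) (u mod N)"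

definition node_rank :: "bool list \<Rightarrow> nat \<Rightarrow> (nat \<times> nat \<times> nat) vertex \<Rightarrow> (nat \<times> nat \<times> nat) vertex \<Rightarrow> nat" where
  "node_rank w N = gadget_rank (0, 0, 0) (length labs) (conflict w N)"

lemma set_roles: "set roles = UNIV"
  unfolding roles_def by (auto intro: role.exhaust)

lemma distinct_kinds: "distinct kinds"
  unfolding kinds_def by (intro distinct_product) (simp_all add: roles_def)

lemma set_kinds: "set kinds = UNIV \<times> {..<2 * K} \<times> {..<length labs}"
  by (simp add: kinds_def set_roles lessThan_atLeast0)

lemma number_of_node:
  assumes "t < N" "j < N"
  shows "node_of_number N (z * N * N + t * N + j) = node z t j"
proof -
  have "(z * N * N + t * N + j) div N = z * N + t" "(z * N * N + t * N + j) mod N = j"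
    using assms by (simp_all flip: add_mult_distrib)
  moreover have "(z * N + t) div N = z" "(z * N + t) mod N = t" using assms by simp_all
  ultimately show ?thesis by (simp add: node_of_number_def div_mult2_eq)
qed

lemma bij_betw_node_of_number:
  assumes "N \<ge> 1"
  shows "bij_betw (node_of_number N) {..<length kinds * N * N} (UNIV \<times> cells N \<times> {..<length labs})"
proof (rule bij_betwI')
  fix u v assume u: "u \<in> {..<length kinds * N * N}" and v: "v \<in> {..<length kinds * N * N}"
  have lt: "x div (N * N) < length kinds" if "x \<in> {..<length kinds * N * N}" for x
    using that assms by (simp add: less_mult_imp_div_less mult.assoc)
  have dec: "x = (x div (N * N) * N + x div N mod N) * N + x mod N" for x
    by (simp add: div_mult2_eq)
  show "node_of_number N u = node_of_number N v \<longleftrightarrow> u = v"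
  proof
    assume eq: "node_of_number N u = node_of_number N v"
    then have "kinds ! (u div (N * N)) = kinds ! (v div (N * N))" "u div N mod N = v div N mod N" "u mod N = v mod N"
      by (auto simp: node_of_number_def node_def split: prod.splits)
    moreover from this have "u div (N * N) = v div (N * N)"
      using distinct_kinds lt[OF u] lt[OF v] by (simp add: nth_eq_iff_index_eq)
    ultimately show "u = v" using dec[of u] dec[of v] by metis
  qed simp
next
  fix u assume u: "u \<in> {..<length kinds * N * N}"
  then have "kinds ! (u div (N * N)) \<in> set kinds"
    using assms by (intro nth_mem) (simp add: less_mult_imp_div_less mult.assoc)
  then show "node_of_number N u \<in> UNIV \<times> cells N \<times> {..<length labs}"
    using assms by (auto simp: set_kinds node_of_number_def node_def cells_def)
next
  fix x assume x: "x \<in> (UNIV :: role set) \<times> cells N \<times> {..<length labs}"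
  obtain \<rho> \<kappa> t j s where xx: "x = (\<rho>, (\<kappa>, t, j), s)" by (metis prod_cases3)
  with x have tj: "t < N" "j < N" and "(\<rho>, \<kappa>, s) \<in> set kinds" by (auto simp: set_kinds cells_def)
  then obtain z where z: "z < length kinds" "kinds ! z = (\<rho>, \<kappa>, s)" by (metis in_set_conv_nth)
  have "z * N * N + t * N + j < length kinds * N * N"
  proof -
    have "t * N + j < Suc t * N" using tj by simp
    also have "\<dots> \<le> N * N" using tj by (intro mult_le_mono1) simp
    finally have "t * N + j < N * N" .
    then have "z * (N * N) + (t * N + j) < Suc z * (N * N)" by simp
    also have "\<dots> \<le> length kinds * (N * N)" using z(1) by (intro mult_le_mono1) simp
    finally show ?thesis by (simp add: mult.assoc add.assoc)
  qed
  moreover have "x = node_of_number N (z * N * N + t * N + j)"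
    using number_of_node[OF tj] z(2) by (simp add: node_def xx)
  ultimately show "\<exists>u\<in>{..<length kinds * N * N}. x = node_of_number N u" by blast
qed

text \<open>Only the kinds are shared by the two pairs of nodes. This uniformity is what lets one
  finite table serve all inputs.\<close>

lemma node_rank_cong:
  assumes obs: "observe w1 N1 t1 j1 t1' j1' = observe w2 N2 t2 j2 t2' j2'"
    and 1: "N1 \<ge> 2" "t1 < N1" "j1 < N1" "t1' < N1" "j1' < N1"
    and 2: "N2 \<ge> 2" "t2 < N2" "j2 < N2" "t2' < N2" "j2' < N2"
  shows "node_rank w1 N1 (node z t1 j1) (node z' t1' j1') = node_rank w2 N2 (node z t2 j2) (node z' t2' j2')"
proof -
  have o: "word_contents w1 (int j1) = word_contents w2 (int j2)"
    "ruler N1 (int t1) = ruler N2 (int t2)" "ruler N1 (int j1) = ruler N2 (int j2)"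
    "ruler N1 (int t1') = ruler N2 (int t2')" "ruler N1 (int j1') = ruler N2 (int j2')"
    "ticks (int t1' - int t1) = ticks (int t2' - int t2)" "ticks (int j1' - int j1) = ticks (int j2' - int j2)"
    using obs by (simp_all add: observe_def)
  have first: "t1 = 0 \<longleftrightarrow> t2 = 0" "j1 = 0 \<longleftrightarrow> j2 = 0" "t1' = 0 \<longleftrightarrow> t2' = 0" "j1' = 0 \<longleftrightarrow> j2' = 0"
    unfolding 1(2-5)[THEN ruler_first] 2(2-5)[THEN ruler_first] o(2-5) by (rule refl)+
  have last: "Suc t1 = N1 \<longleftrightarrow> Suc t2 = N2" "Suc t1' = N1 \<longleftrightarrow> Suc t2' = N2"
    unfolding ruler_last[OF 1(1,2)] ruler_last[OF 2(1,2)] ruler_last[OF 1(1,4)] ruler_last[OF 2(1,4)] o(2,4)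
    by (rule refl)+
  note t = ticks_eqD[OF o(6)] and j = ticks_eqD[OF o(7)]
  obtain \<rho> \<kappa> s where z: "kinds ! z = (\<rho>, \<kappa>, s)" by (rule prod_cases3)
  obtain \<rho>' \<kappa>' s' where z': "kinds ! z' = (\<rho>', \<kappa>', s')" by (rule prod_cases3)
  have c1: "conflict w1 N1 (\<kappa>, t1, j1) s (\<kappa>', t1', j1') s' \<longleftrightarrow> conflict w2 N2 (\<kappa>, t2, j2) s (\<kappa>', t2', j2') s'"
    by (rule conflict_cong[OF t(1,2) first(1) last(1) j first(2,4) o(1)])
  have j': "j1 = j1' \<longleftrightarrow> j2 = j2'" "t1 = t1' \<longleftrightarrow> t2 = t2'" using j(1) t(1) by (simp_all add: eq_commute)
  have "word_contents w1 (int j1') = word_contents w2 (int j2')" if "j1 = j1'"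
    using that o(1) j'(1) by simp
  then have c2: "conflict w1 N1 (\<kappa>', t1', j1') s' (\<kappa>, t1, j1) s \<longleftrightarrow> conflict w2 N2 (\<kappa>', t2', j2') s' (\<kappa>, t2, j2) s"
    by (rule conflict_cong[OF j'(2) t(3) first(3) last(2) j'(1) j(3,2) first(4,2)])
  show ?thesis
    unfolding node_rank_def node_def z z' prod.case
    by (rule gadget_rank_cong) (simp_all add: t(1) j(1) first c1 c2)
qed

lemma poly_time_reduction:
  assumes "c \<ge> 2" "d \<ge> 1"
  shows "poly_time_computable (\<lambda>w. encode_instance (pref_lists (length kinds * (length w + c) ^ d * (length w + c) ^ d) 5
    (\<lambda>u v. node_rank w ((length w + c) ^ d) (node_of_number ((length w + c) ^ d) u) (node_of_number ((length w + c) ^ d) v))))"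
proof -
  let ?N = "\<lambda>w :: bool list. (length w + c) ^ d"
  have N: "?N w \<ge> 2" for w
    using assms self_le_power[of "length w + c" d] by simp
  \<comment> \<open>The rank is taken from any pair of nodes, for any input, that shows the given
    observation; \<open>node_rank_cong\<close> makes all of them agree. No algorithm for
    \<open>A\<close> is required, since the machine tabulates its finitely many values.\<close>
  define A where "A z r z' obs \<longleftrightarrow> (\<exists>w t j t' j'. t < ?N w \<and> j < ?N w \<and> t' < ?N w \<and> j' < ?N w \<and>
      obs = observe w (?N w) t j t' j' \<and> node_rank w (?N w) (node z t j) (node z' t' j') = r)" for z r z' obs
  show ?thesis
  proof (rule poly_time_pref_lists[OF assms, where A = A])
    fix w z z' r t j t' j'
    assume b: "t < ?N w" "j < ?N w" "t' < ?N w" "j' < ?N w"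
    show "A z r z' (observe w (?N w) t j t' j') \<longleftrightarrow>
      node_rank w (?N w) (node_of_number (?N w) (z * ?N w * ?N w + t * ?N w + j))
        (node_of_number (?N w) (z' * ?N w * ?N w + t' * ?N w + j')) = r"
      unfolding number_of_node[OF b(1,2)] number_of_node[OF b(3,4)] A_def
      using node_rank_cong[OF _ N _ _ _ _ N] b by metis
  qed
qed

lemma in_problem_iff_accepts:
  assumes N: "N \<ge> 1" and time: "\<And>n c. (step M ^^ n) (init_config M w) c \<Longrightarrow> n < N"
  shows "encode_instance (pref_lists (length kinds * N * N) 5
      (\<lambda>u v. node_rank w N (node_of_number N u) (node_of_number N v))) \<in> popular_matching_problem
    \<longleftrightarrow> accepts M w"
proof -
  let ?h = "node_of_number N" and ?n = "length kinds * N * N"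
  let ?vote = "tie_vote (inv_into {..<?n} ?h) (node_rank w N)"
  interpret gadget "cells N" "(0, 0, 0)" "length labs" "conflict w N" ?vote
    by unfold_locales
      (use N K_pos labs_nonempty in \<open>auto simp: cells_def tie_vote_def node_rank_def\<close>)
  have "encode_instance (pref_lists ?n 5 (\<lambda>u v. node_rank w N (?h u) (?h v))) \<in> popular_matching_problem \<longleftrightarrow>
      (\<exists>m. ranked_graph.popular_mating (UNIV \<times> cells N \<times> {..<length labs}) 5 (node_rank w N) ?vote m)"
    by (rule pref_lists_in_problem_iff[OF bij_betw_node_of_number[OF N]])
      (simp_all add: node_rank_def gadget_rank_self gadget_rank_sym)
  also have "\<dots> \<longleftrightarrow> (\<exists>m. popular_mating m)" by (simp add: node_rank_def)
  also have "\<dots> \<longleftrightarrow> (\<exists>f g. labelling w N f g)"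
    unfolding popular_iff_labels labelling_def by (rule refl)
  also have "\<dots> \<longleftrightarrow> accepts M w" by (rule accepts_iff_labelling[OF time N, symmetric])
  finally show ?thesis .
qed

end

theorem theorem16: "NP_hard popular_matching_problem"
  unfolding NP_hard_def
proof
  fix A assume "A \<in> NP"
  then obtain M and p :: "nat poly" where M: "wf_tm M" "\<And>w. runs_within M w (poly p (length w))"
    "A = {w. accepts M w}" unfolding NP_def by blast
  obtain S labs where "machine_labels M S labs" using ex_machine_labels[OF M(1)] by blast
  then interpret machine_labels M S labs .
  obtain c d where cd: "c \<ge> 2" "d \<ge> 1" "\<And>n. poly p n < (n + c) ^ d" using poly_less_power[of p] by blast
  have "w \<in> A \<longleftrightarrow> encode_instance (pref_lists (length kinds * (length w + c) ^ d * (length w + c) ^ d) 5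
    (\<lambda>u v. node_rank w ((length w + c) ^ d) (node_of_number ((length w + c) ^ d) u)
      (node_of_number ((length w + c) ^ d) v))) \<in> popular_matching_problem" for w
  proof -
    have "n < (length w + c) ^ d" if "(step M ^^ n) (init_config M w) x" for n x
      using M(2)[of w] that cd(3)[of "length w"] unfolding runs_within_def by (meson le_less_trans)
    moreover have "(length w + c) ^ d \<ge> 1" using cd(1) by simp
    ultimately show ?thesis using in_problem_iff_accepts M(3) by simp
  qed
  with poly_time_reduction[OF cd(1,2)] show "poly_time_reducible A popular_matching_problem"
    unfolding poly_time_reducible_def by blast
qed

end
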